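(* Let $\Omega\subset\subset\mathbb{C}^{n}$ be a smoothly bounded domain with Bergman projection $B$. Suppose that there exist a pair $(k_{1},k_{2})\in\mathbb{N}\times\mathbb{N}$ and a constant $C_{1}>0$ such that $$\|Bf\|_{k_{2}}\leq C_{1}\|f\|_{k_{1}}\qquad\text{for all } f\in H^{k_{1}}(\Omega).$$ Then there is a constant $C>0$ such that $$\|Bf\|_{k_{2}}\leq C\|f\|$$ for all conjugate holomorphic functions $f$ in $L^2(\Omega)$ (in particular $Bf\in H^{k_2}(\Omega)$ for such $f$).
   Context: $\mathbb{N}=\{1,2,\dots\}$. $\Omega\subset\subset\mathbb{C}^n$ is a bounded domain with smooth boundary. $\|\cdot\|$ is the $L^2(\Omega)$ norm with respect to Lebesgue measure. $H^k(\Omega)$ is the $L^2$ Sobolev space of complex-valued functions with norm $\|f\|_k^2=\sum_{|\alpha|\le k}\|D^\alpha f\|^2$ (all real partial derivatives of order at most $k$). The Bergman projection $B$ is the orthogonal projection of $L^2(\Omega)$ onto its closed subspace $A^0(\Omega)$ of square-integrable holomorphic functions. A function $f$ is conjugate holomorphic if $\overline f$ is holomorphic. *)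

theory Defs
  imports "HOL-Analysis.Analysis"
begin

section \<open>Smooth functions and smoothly bounded domains\<close>

definition partial_deriv :: "'a::euclidean_space \<Rightarrow> ('a \<Rightarrow> 'b::real_normed_vector) \<Rightarrow> 'a \<Rightarrow> 'b" where
  "partial_deriv b f = (\<lambda>x. frechet_derivative f (at x) b)"

primrec Ck_on :: "nat \<Rightarrow> ('a::euclidean_space \<Rightarrow> 'b::real_normed_vector) \<Rightarrow> 'a set \<Rightarrow> bool" where
  "Ck_on 0 f U \<longleftrightarrow> continuous_on U f"
| "Ck_on (Suc k) f U \<longleftrightarrow>
     (\<forall>x\<in>U. f differentiable at x) \<and> (\<forall>b\<in>Basis. Ck_on k (partial_deriv b f) U)"

definition smooth_on :: "('a::euclidean_space \<Rightarrow> 'b::real_normed_vector) \<Rightarrow> 'a set \<Rightarrow> bool" where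
  "smooth_on f U \<longleftrightarrow> (\<forall>k. Ck_on k f U)"

text \<open>A bounded domain with a smooth defining function \<open>r\<close> near its boundary.\<close>

definition smoothly_bounded_domain :: "'a::euclidean_space set \<Rightarrow> bool" where
  "smoothly_bounded_domain \<Omega> \<longleftrightarrow>
     open \<Omega> \<and> connected \<Omega> \<and> \<Omega> \<noteq> {} \<and> bounded \<Omega> \<and>
     (\<exists>U (r :: 'a \<Rightarrow> real). open U \<and> frontier \<Omega> \<subseteq> U \<and> smooth_on r U \<and>
        \<Omega> \<inter> U = {x \<in> U. r x < 0} \<and>
        (\<forall>p\<in>frontier \<Omega>. \<exists>b\<in>Basis. partial_deriv b r p \<noteq> 0))"

section \<open>Square-integrable functions\<close>

text \<open>
  Elements of \<open>L\<^sup>2(\<Omega>)\<close> are represented by functions on the whole space whose values off \<open>\<Omega>\<close> are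
  irrelevant; nothing below distinguishes functions that agree almost everywhere on \<open>\<Omega>\<close>, except
  holomorphy, which is required of the representative itself.
\<close>

definition L2 :: "'a::euclidean_space set \<Rightarrow> ('a \<Rightarrow> complex) set" where
  "L2 \<Omega> = {f. f \<in> borel_measurable (lebesgue_on \<Omega>) \<and>
              integrable (lebesgue_on \<Omega>) (\<lambda>x. (norm (f x))\<^sup>2)}"

definition L2_inner :: "'a::euclidean_space set \<Rightarrow> ('a \<Rightarrow> complex) \<Rightarrow> ('a \<Rightarrow> complex) \<Rightarrow> complex" where
  "L2_inner \<Omega> f g = (LINT x|lebesgue_on \<Omega>. f x * cnj (g x))"

definition L2_norm :: "'a::euclidean_space set \<Rightarrow> ('a \<Rightarrow> complex) \<Rightarrow> real" where
  "L2_norm \<Omega> f = sqrt (LINT x|lebesgue_on \<Omega>. (norm (f x))\<^sup>2)"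

section \<open>Sobolev spaces\<close>

definition basis_list :: "'a::euclidean_space list" where
  "basis_list = (SOME xs. set xs = Basis \<and> distinct xs)"

lemma basis_list: "set (basis_list :: 'a::euclidean_space list) = Basis"
    "distinct (basis_list :: 'a::euclidean_space list)"
proof -
  have "\<exists>xs. set xs = (Basis :: 'a set) \<and> distinct xs"
    using finite_distinct_list[OF finite_Basis] by auto
  from someI_ex[OF this] show "set (basis_list :: 'a list) = Basis" "distinct (basis_list :: 'a list)"
    by (simp_all add: basis_list_def)
qed

text \<open>
  A multi-index assigns to each coordinate direction an order of differentiation. On
  \<^typ>\<open>complex ^ 'n\<close>, the members of \<^const>\<open>Basis\<close> are the \<open>2n\<close> real coordinate directions.
\<close>

definition multi_indices :: "nat \<Rightarrow> ('a::euclidean_space \<Rightarrow> nat) set" where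
  "multi_indices k = {\<alpha>. (\<forall>b. b \<notin> Basis \<longrightarrow> \<alpha> b = 0) \<and> (\<Sum>b\<in>Basis. \<alpha> b) \<le> k}"

lemma finite_multi_indices: "finite (multi_indices k :: ('a::euclidean_space \<Rightarrow> nat) set)"
proof (rule finite_subset)
  show "multi_indices k \<subseteq>
      {\<alpha> :: 'a \<Rightarrow> nat. \<forall>b. (b \<in> Basis \<longrightarrow> \<alpha> b \<in> {..k}) \<and> (b \<notin> Basis \<longrightarrow> \<alpha> b = 0)}"
  proof (clarsimp simp: multi_indices_def)
    fix \<alpha> :: "'a \<Rightarrow> nat" and b :: 'a
    assume "sum \<alpha> Basis \<le> k" "b \<in> Basis"
    then show "\<alpha> b \<le> k"
      using member_le_sum[of b Basis \<alpha>] by simp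
  qed
  show "finite {\<alpha> :: 'a \<Rightarrow> nat. \<forall>b. (b \<in> Basis \<longrightarrow> \<alpha> b \<in> {..k}) \<and> (b \<notin> Basis \<longrightarrow> \<alpha> b = 0)}"
    by (rule finite_set_of_finite_funs) auto
qed

text \<open>
  The classical derivative of multi-index \<open>\<alpha>\<close>. It is only applied to smooth functions, for
  which the order of differentiation, and hence the choice of \<^const>\<open>basis_list\<close>, is immaterial.
\<close>

definition multi_deriv ::
    "('a::euclidean_space \<Rightarrow> nat) \<Rightarrow> ('a \<Rightarrow> 'b::real_normed_vector) \<Rightarrow> 'a \<Rightarrow> 'b" where
  "multi_deriv \<alpha> \<phi> = foldr (\<lambda>b. partial_deriv b ^^ \<alpha> b) basis_list \<phi>"

definition test_fun :: "'a::euclidean_space set \<Rightarrow> ('a \<Rightarrow> real) \<Rightarrow> bool" where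
  "test_fun \<Omega> \<phi> \<longleftrightarrow>
     smooth_on \<phi> UNIV \<and> compact (closure {x. \<phi> x \<noteq> 0}) \<and> closure {x. \<phi> x \<noteq> 0} \<subseteq> \<Omega>"

definition is_weak_deriv ::
    "'a::euclidean_space set \<Rightarrow> ('a \<Rightarrow> nat) \<Rightarrow> ('a \<Rightarrow> complex) \<Rightarrow> ('a \<Rightarrow> complex) \<Rightarrow> bool" where
  "is_weak_deriv \<Omega> \<alpha> f g \<longleftrightarrow>
     (\<forall>\<phi>. test_fun \<Omega> \<phi> \<longrightarrow>
        (LINT x|lebesgue_on \<Omega>. multi_deriv \<alpha> \<phi> x *\<^sub>R f x) =
        (-1) ^ (\<Sum>b\<in>Basis. \<alpha> b) * (LINT x|lebesgue_on \<Omega>. \<phi> x *\<^sub>R g x))"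

definition sobolev :: "nat \<Rightarrow> 'a::euclidean_space set \<Rightarrow> ('a \<Rightarrow> complex) set" where
  "sobolev k \<Omega> = {f \<in> L2 \<Omega>. \<forall>\<alpha>\<in>multi_indices k. \<exists>g\<in>L2 \<Omega>. is_weak_deriv \<Omega> \<alpha> f g}"

text \<open>For \<open>f\<close> in the Sobolev space, weak derivatives are unique almost everywhere on \<open>\<Omega>\<close>.\<close>

definition weak_deriv ::
    "'a::euclidean_space set \<Rightarrow> ('a \<Rightarrow> nat) \<Rightarrow> ('a \<Rightarrow> complex) \<Rightarrow> 'a \<Rightarrow> complex" where
  "weak_deriv \<Omega> \<alpha> f = (SOME g. g \<in> L2 \<Omega> \<and> is_weak_deriv \<Omega> \<alpha> f g)"

definition sobolev_norm :: "nat \<Rightarrow> 'a::euclidean_space set \<Rightarrow> ('a \<Rightarrow> complex) \<Rightarrow> real" where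
  "sobolev_norm k \<Omega> f = sqrt (\<Sum>\<alpha>\<in>multi_indices k. (L2_norm \<Omega> (weak_deriv \<Omega> \<alpha> f))\<^sup>2)"

section \<open>Holomorphic functions of several variables and the Bergman projection\<close>

text \<open>Complex differentiability: the real derivative exists and is complex linear.\<close>

definition holomorphic_sv :: "(complex ^ 'n \<Rightarrow> complex) \<Rightarrow> (complex ^ 'n) set \<Rightarrow> bool" where
  "holomorphic_sv f \<Omega> \<longleftrightarrow>
     (\<forall>z\<in>\<Omega>. \<exists>D. (f has_derivative D) (at z) \<and> (\<forall>c v. D (c *s v) = c * D v))"

definition conj_holomorphic_sv :: "(complex ^ 'n \<Rightarrow> complex) \<Rightarrow> (complex ^ 'n) set \<Rightarrow> bool" where
  "conj_holomorphic_sv f \<Omega> \<longleftrightarrow> holomorphic_sv (\<lambda>z. cnj (f z)) \<Omega>"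

text \<open>Members are normalised to vanish off \<open>\<Omega>\<close>, so that each one is a single HOL function.\<close>

definition bergman_space :: "(complex ^ 'n) set \<Rightarrow> (complex ^ 'n \<Rightarrow> complex) set" where
  "bergman_space \<Omega> = {g \<in> L2 \<Omega>. holomorphic_sv g \<Omega> \<and> (\<forall>z. z \<notin> \<Omega> \<longrightarrow> g z = 0)}"

text \<open>
  The orthogonal projection onto the Bergman space: \<open>B f\<close> is the element \<open>g\<close> of the space with
  \<open>f - g\<close> orthogonal to the space.
\<close>

definition bergman_proj ::
    "(complex ^ 'n) set \<Rightarrow> (complex ^ 'n \<Rightarrow> complex) \<Rightarrow> complex ^ 'n \<Rightarrow> complex" where
  "bergman_proj \<Omega> f =
     (THE g. g \<in> bergman_space \<Omega> \<and>
             (\<forall>h\<in>bergman_space \<Omega>. L2_inner \<Omega> (\<lambda>z. f z - g z) h = 0))"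

end

theory Submission
  imports Defs "HOL-Complex_Analysis.Complex_Analysis"
begin

text \<open>
  A Bergman projection \<open>B f\<close> is determined by the integrals of \<open>f * cnj h\<close> over \<open>\<Omega>\<close>, for \<open>h\<close> in the
  Bergman space. For conjugate holomorphic \<open>f\<close> these integrands are conjugate holomorphic, so every
  \<open>\<partial>/\<partial>z\<^sub>i\<close> annihilates them. This leaves so much freedom in the choice of a function with
  projection \<open>B f\<close> that \<open>f\<close> may be replaced by one that lies in the Sobolev space of order \<open>k1\<close>.

  Let \<open>\<rho>\<close> be smooth, positive in \<open>\<Omega>\<close>, and zero with nonzero gradient on the boundary
  (\<open>global_defining_function\<close>). Near the boundary some \<open>\<partial>\<rho>/\<partial>z\<^sub>i\<close> is nonzero, so a function \<open>\<rho>\<^sup>m a\<close> is a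
  combination of derivatives \<open>\<partial>/\<partial>z\<^sub>i\<close> of functions divisible by \<open>\<rho>\<^sup>m\<^sup>+\<^sup>1\<close>, up to an error again divisible
  by \<open>\<rho>\<^sup>m\<^sup>+\<^sup>1\<close>. Integration by parts against a conjugate holomorphic \<open>u\<close> discards the derivatives.
  Starting from the constant \<open>1\<close>, this yields for every \<open>m\<close> a function \<open>a\<close>, smooth up to the boundary, with
  \<open>\<integral> u = \<integral> \<rho>\<^sup>m a u\<close> for all integrable conjugate holomorphic \<open>u\<close> (\<open>weighted_integral_identity\<close>).
  Hence \<open>f\<close> and \<open>\<rho>\<^sup>k\<^sup>1 a f\<close> have the same projection (\<open>bergman_proj_weight\<close>).

  On the other hand, a derivative of a conjugate holomorphic function costs no more than one power of
  \<open>\<rho>\<close>: the norm of \<open>\<rho>\<^sup>j\<^sup>+\<^sup>1 \<partial>g\<close> is at most a constant times the norm of \<open>\<rho>\<^sup>j g\<close>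
  (\<open>weighted_derivative_estimate\<close>, a Caccioppoli inequality). The weight \<open>\<rho>\<^sup>k\<^sup>1\<close> pays for \<open>k1\<close>
  derivatives, whether they fall on \<open>f\<close> or on the weight itself, so the Sobolev norm of \<open>\<rho>\<^sup>k\<^sup>1 a f\<close> of
  order \<open>k1\<close> is at most a constant times the norm of \<open>f\<close> (\<open>weighted_iterated_estimate\<close>). The assumed estimate
  for \<open>B\<close>, applied to \<open>\<rho>\<^sup>k\<^sup>1 a f\<close>, gives the theorem.

  No integration by parts sees the boundary: everything is first multiplied by a cutoff
  that vanishes where \<open>\<rho>\<close> is small. Its derivatives are of size \<open>1/\<rho>\<close>, and the available power of \<open>\<rho>\<close>
  absorbs them in the limit.

  The Sobolev norm is built from arbitrarily chosen weak derivatives. They have the same norm as the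
  classical derivatives of a smooth function, because test functions separate square-integrable functions
  (\<open>L2_norm_weak_deriv\<close>). Conjugate holomorphic functions are smooth by the Cauchy integral formula in one
  variable at a time.
\<close>

section \<open>Calculus of smooth functions\<close>

lemma partial_deriv_eq:
  "(f has_derivative D) (at x) \<Longrightarrow> partial_deriv b f x = D b"
  unfolding partial_deriv_def using frechet_derivative_at by metis

lemma partial_deriv_has_derivative:
  "f differentiable (at x) \<Longrightarrow> (f has_derivative (\<lambda>v. partial_deriv v f x)) (at x)"
  by (simp add: partial_deriv_def frechet_derivative_works flip: fun_eq_iff)

lemma differentiable_cong_open:
  assumes "open U" "x \<in> U" "\<And>y. y \<in> U \<Longrightarrow> f y = g y" "f differentiable (at x)"
  shows "g differentiable (at x)"
  using assms unfolding differentiable_def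
  by (meson has_derivative_transform_within_open)

lemma partial_deriv_cong_open:
  assumes "open U" "x \<in> U" "\<And>y. y \<in> U \<Longrightarrow> f y = g y"
  shows "partial_deriv b f x = partial_deriv b g x"
proof -
  have "(f has_derivative D) (at x) \<longleftrightarrow> (g has_derivative D) (at x)" for D
    using assms by (metis has_derivative_transform_within_open)
  then show ?thesis
    by (simp add: partial_deriv_def frechet_derivative_def)
qed

lemma Ck_on_cong:
  assumes "open U" "\<And>y. y \<in> U \<Longrightarrow> f y = g y" "Ck_on k f U"
  shows "Ck_on k g U"
  using assms(2,3)
proof (induction k arbitrary: f g)
  case 0
  then show ?case using continuous_on_cong by force
next
  case (Suc k)
  have "Ck_on k (partial_deriv b g) U" if "b \<in> Basis" for b
    using Suc.IH[of "partial_deriv b f"] Suc.prems that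
      partial_deriv_cong_open[OF assms(1) _ Suc.prems(1)] by auto
  then show ?case using Suc.prems differentiable_cong_open[OF assms(1) _ Suc.prems(1)] by auto
qed

lemma Ck_on_SucD: "Ck_on (Suc k) f U \<Longrightarrow> Ck_on k f U"
proof (induction k arbitrary: f)
  case 0
  then show ?case
    by (auto intro!: continuous_at_imp_continuous_on differentiable_imp_continuous_within)
next
  case (Suc k)
  then show ?case by (auto simp del: Ck_on.simps(1))
qed

lemma Ck_on_subset:
  "Ck_on k f U \<Longrightarrow> V \<subseteq> U \<Longrightarrow> Ck_on k f V"
  by (induction k arbitrary: f) (auto intro: continuous_on_subset)

lemma Ck_on_add:
  assumes "open U" "Ck_on k f U" "Ck_on k g U"
  shows "Ck_on k (\<lambda>x. f x + g x) U"
  using assms(2,3)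
proof (induction k arbitrary: f g)
  case 0
  then show ?case by (auto intro: continuous_on_add)
next
  case (Suc k)
  have "Ck_on k (partial_deriv b (\<lambda>x. f x + g x)) U" if "b \<in> Basis" for b
  proof (rule Ck_on_cong[OF assms(1)])
    show "Ck_on k (\<lambda>x. partial_deriv b f x + partial_deriv b g x) U"
      using Suc that by auto
    show "partial_deriv b f y + partial_deriv b g y = partial_deriv b (\<lambda>x. f x + g x) y"
      if "y \<in> U" for y
      using Suc.prems that
      by (intro partial_deriv_eq[symmetric, where D="\<lambda>b. partial_deriv b f y + partial_deriv b g y"]
          has_derivative_add partial_deriv_has_derivative) auto
  qed
  then show ?case using Suc.prems by auto
qed

lemma Ck_on_bilinear:
  assumes "bounded_bilinear pr" "open U" "Ck_on k f U" "Ck_on k g U"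
  shows "Ck_on k (\<lambda>x. pr (f x) (g x)) U"
  using assms(3,4)
proof (induction k arbitrary: f g)
  case 0
  then show ?case by (auto intro: bounded_bilinear.continuous_on[OF assms(1)])
next
  case (Suc k)
  have D: "((\<lambda>x. pr (f x) (g x)) has_derivative
      (\<lambda>v. pr (f y) (partial_deriv v g y) + pr (partial_deriv v f y) (g y))) (at y)"
    if "y \<in> U" for y
    using Suc.prems that
    by (intro bounded_bilinear.FDERIV[OF assms(1)] partial_deriv_has_derivative) auto
  have "Ck_on k (partial_deriv b (\<lambda>x. pr (f x) (g x))) U" if "b \<in> Basis" for b
  proof (rule Ck_on_cong[OF assms(2)])
    have "Ck_on k f U" "Ck_on k g U" using Suc.prems by (blast intro: Ck_on_SucD)+
    then show "Ck_on k (\<lambda>y. pr (f y) (partial_deriv b g y) + pr (partial_deriv b f y) (g y)) U"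
      using Suc that by (intro Ck_on_add[OF assms(2)]) auto
    show "pr (f y) (partial_deriv b g y) + pr (partial_deriv b f y) (g y)
        = partial_deriv b (\<lambda>x. pr (f x) (g x)) y"
      if "y \<in> U" for y
      using partial_deriv_eq[OF D[OF that]] by simp
  qed
  moreover have "\<forall>x\<in>U. (\<lambda>x. pr (f x) (g x)) differentiable at x"
    using D by (auto simp: differentiable_def)
  ultimately show ?case by auto
qed

lemma Ck_on_const: "Ck_on k (\<lambda>x::'a::euclidean_space. c) U"
proof (induction k arbitrary: c)
  case (Suc k)
  have "partial_deriv b (\<lambda>x. c) = (\<lambda>x. 0)" for b :: 'a
    using partial_deriv_eq[OF has_derivative_const] by auto
  then show ?case using Suc by auto
qed simp

lemma smooth_on_const [simp]: "smooth_on (\<lambda>x. c) U"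
  by (simp add: smooth_on_def Ck_on_const)

lemma smooth_on_cong:
  "open U \<Longrightarrow> (\<And>y. y \<in> U \<Longrightarrow> f y = g y) \<Longrightarrow> smooth_on f U \<Longrightarrow> smooth_on g U"
  unfolding smooth_on_def using Ck_on_cong by blast

lemma smooth_on_subset: "smooth_on f U \<Longrightarrow> V \<subseteq> U \<Longrightarrow> smooth_on f V"
  unfolding smooth_on_def using Ck_on_subset by blast

lemma smooth_on_differentiable: "smooth_on f U \<Longrightarrow> x \<in> U \<Longrightarrow> f differentiable (at x)"
  unfolding smooth_on_def using Ck_on.simps(2) by blast

lemma smooth_on_continuous: "smooth_on f U \<Longrightarrow> continuous_on U f"
  unfolding smooth_on_def using Ck_on.simps(1) by blast

lemma smooth_on_partial_deriv: "smooth_on f U \<Longrightarrow> b \<in> Basis \<Longrightarrow> smooth_on (partial_deriv b f) U"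
  unfolding smooth_on_def using Ck_on.simps(2) by blast

lemma smooth_on_has_derivative:
  "smooth_on f U \<Longrightarrow> x \<in> U \<Longrightarrow> (f has_derivative (\<lambda>v. partial_deriv v f x)) (at x)"
  by (simp add: smooth_on_differentiable partial_deriv_has_derivative)

lemma smooth_on_add:
  "open U \<Longrightarrow> smooth_on f U \<Longrightarrow> smooth_on g U \<Longrightarrow> smooth_on (\<lambda>x. f x + g x) U"
  unfolding smooth_on_def using Ck_on_add by blast

lemma smooth_on_bilinear:
  "bounded_bilinear pr \<Longrightarrow> open U \<Longrightarrow> smooth_on f U \<Longrightarrow> smooth_on g U \<Longrightarrow>
    smooth_on (\<lambda>x. pr (f x) (g x)) U"
  unfolding smooth_on_def using Ck_on_bilinear by blast

lemmas smooth_on_mult = smooth_on_bilinear[OF bounded_bilinear_mult]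

lemma smooth_on_linear:
  assumes L: "bounded_linear L" and U: "open U" and f: "smooth_on f U"
  shows "smooth_on (\<lambda>x. L (f x)) U"
  by (rule smooth_on_bilinear[OF bounded_bilinear.comp[OF bounded_bilinear_scaleR bounded_linear_ident L],
        of U "\<lambda>_. 1", simplified]) (use assms in auto)

lemma partial_deriv_linear:
  assumes "bounded_linear L" "f differentiable (at x)"
  shows "partial_deriv b (\<lambda>x. L (f x)) x = L (partial_deriv b f x)"
  by (rule partial_deriv_eq) (intro bounded_linear.has_derivative[OF assms(1)]
      partial_deriv_has_derivative assms)

lemma partial_deriv_add:
  assumes "f differentiable (at x)" "g differentiable (at x)"
  shows "partial_deriv b (\<lambda>x. f x + g x) x = partial_deriv b f x + partial_deriv b g x"
  by (rule partial_deriv_eq) (intro has_derivative_add partial_deriv_has_derivative assms)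

lemma partial_deriv_mult:
  fixes f g :: "'a::euclidean_space \<Rightarrow> 'b::real_normed_algebra"
  assumes "f differentiable (at x)" "g differentiable (at x)"
  shows "partial_deriv b (\<lambda>x. f x * g x) x = f x * partial_deriv b g x + partial_deriv b f x * g x"
  by (rule partial_deriv_eq) (intro has_derivative_mult partial_deriv_has_derivative assms)

lemma smooth_on_uminus: "open U \<Longrightarrow> smooth_on f U \<Longrightarrow> smooth_on (\<lambda>x. - f x) U"
  using smooth_on_linear[OF bounded_linear_minus[OF bounded_linear_ident]] by blast

lemma smooth_on_diff:
  "open U \<Longrightarrow> smooth_on f U \<Longrightarrow> smooth_on g U \<Longrightarrow> smooth_on (\<lambda>x. f x - g x) U"
  using smooth_on_add[OF _ _ smooth_on_uminus, of U f g] by simp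

lemma smooth_on_power:
  fixes f :: "'a::euclidean_space \<Rightarrow> 'b::real_normed_algebra_1"
  shows "open U \<Longrightarrow> smooth_on f U \<Longrightarrow> smooth_on (\<lambda>x. f x ^ n) U"
  by (induction n) (auto intro: smooth_on_mult)

lemma smooth_on_sum:
  "open U \<Longrightarrow> (\<And>i. i \<in> I \<Longrightarrow> smooth_on (f i) U) \<Longrightarrow> smooth_on (\<lambda>x. \<Sum>i\<in>I. f i x) U"
  by (induction I rule: infinite_finite_induct) (auto intro: smooth_on_add)

lemma smooth_on_prod:
  fixes f :: "'i \<Rightarrow> 'a::euclidean_space \<Rightarrow> 'b::real_normed_field"
  shows "open U \<Longrightarrow> (\<And>i. i \<in> I \<Longrightarrow> smooth_on (f i) U) \<Longrightarrow> smooth_on (\<lambda>x. \<Prod>i\<in>I. f i x) U"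
  by (induction I rule: infinite_finite_induct) (auto intro: smooth_on_mult)

lemma partial_deriv_real: "(g has_real_derivative d) (at x) \<Longrightarrow> partial_deriv 1 g x = d"
  using partial_deriv_eq[of g "(*) d" x 1] by (simp add: has_field_derivative_def)

lemma smooth_on_real_has_derivative:
  assumes "smooth_on (g::real\<Rightarrow>real) V" "x \<in> V"
  shows "(g has_real_derivative partial_deriv 1 g x) (at x)"
proof -
  obtain d where "(g has_real_derivative d) (at x)"
    using smooth_on_differentiable[OF assms] real_differentiable_def by auto
  then show ?thesis using partial_deriv_real by metis
qed

lemma has_derivative_compose_real:
  fixes g :: "real \<Rightarrow> real"
  assumes "smooth_on g V" "f x \<in> V" "f differentiable (at x)"
  shows "((\<lambda>x. g (f x)) has_derivative (\<lambda>v. partial_deriv 1 g (f x) * partial_deriv v f x)) (at x)"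
  using has_derivative_compose[OF partial_deriv_has_derivative[OF assms(3)]
      smooth_on_real_has_derivative[OF assms(1,2), unfolded has_field_derivative_def]] .

text \<open>
  The induction is on the order of differentiability, with the outer function generalised: the chain
  rule turns it into its derivative.
\<close>

lemma Ck_on_compose_real:
  fixes g :: "real \<Rightarrow> real"
  assumes U: "open U" and f: "smooth_on f U" and "f ` U \<subseteq> V" "smooth_on g V"
  shows "Ck_on k (\<lambda>x. g (f x)) U"
  using assms(4)
proof (induction k arbitrary: g)
  case 0
  then show ?case
    using continuous_on_compose2[OF smooth_on_continuous[OF 0] smooth_on_continuous[OF f]] assms by auto
next
  case (Suc k)
  note D = has_derivative_compose_real[OF Suc.prems, of f]
  have "Ck_on k (partial_deriv b (\<lambda>x. g (f x))) U" if "b \<in> Basis" for b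
  proof (rule Ck_on_cong[OF U])
    show "Ck_on k (\<lambda>x. partial_deriv 1 g (f x) * partial_deriv b f x) U"
      using smooth_on_partial_deriv[OF f that] smooth_on_partial_deriv[OF Suc.prems]
      by (intro Ck_on_bilinear[OF bounded_bilinear_mult U] Suc.IH) (auto simp: smooth_on_def)
    show "partial_deriv 1 g (f y) * partial_deriv b f y = partial_deriv b (\<lambda>x. g (f x)) y"
      if "y \<in> U" for y
      using partial_deriv_eq[OF D] that assms(3) smooth_on_differentiable[OF f that] by (simp add: image_subset_iff)
  qed
  moreover have "\<forall>x\<in>U. (\<lambda>x. g (f x)) differentiable at x"
    using D assms(3) smooth_on_differentiable[OF f] by (auto simp: differentiable_def image_subset_iff) blast
  ultimately show ?case by auto
qed

lemma smooth_on_compose_real: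
  fixes g :: "real \<Rightarrow> real"
  assumes "open U" "smooth_on f U" "f ` U \<subseteq> V" "smooth_on g V"
  shows "smooth_on (\<lambda>x. g (f x)) U"
  using Ck_on_compose_real[OF assms] by (auto simp: smooth_on_def)

text \<open>
  The functions \<open>c / x\<^sup>n\<^sup>+\<^sup>1\<close> form a family that differentiation maps to itself, which makes the induction
  on the order of differentiability go through.
\<close>

lemma smooth_on_inverse_real: "smooth_on (inverse :: real \<Rightarrow> real) (- {0})"
proof -
  have "Ck_on k (\<lambda>x::real. c * inverse x ^ Suc n) (- {0})" for k c n
  proof (induction k arbitrary: c n)
    case 0
    then show ?case by (auto intro!: continuous_intros)
  next
    case (Suc k)
    have D: "((\<lambda>x::real. c * inverse x ^ Suc n) has_real_derivative
        (- c * (1 + n)) * inverse y ^ Suc (Suc n)) (at y)" if "y \<noteq> 0" for y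
      using that by (intro DERIV_cong[OF DERIV_cmult[OF DERIV_power[OF DERIV_inverse]]]) auto
    have "Ck_on k (partial_deriv 1 (\<lambda>x::real. c * inverse x ^ Suc n)) (- {0})"
      by (rule Ck_on_cong[OF _ _ Suc.IH[of "- c * (1 + n)" "Suc n"]])
        (use D[THEN partial_deriv_real] in \<open>auto simp del: power_Suc\<close>)
    then show ?case using D by (auto simp: real_differentiable_def simp del: power_Suc)
  qed
  from this[of _ 1 0] show ?thesis by (simp add: smooth_on_def)
qed

lemma smooth_on_inverse:
  fixes f :: "'a::euclidean_space \<Rightarrow> real"
  assumes "open U" "smooth_on f U" "\<And>x. x \<in> U \<Longrightarrow> f x \<noteq> 0"
  shows "smooth_on (\<lambda>x. inverse (f x)) U"
  by (rule smooth_on_compose_real[OF assms(1,2) _ smooth_on_inverse_real]) (use assms in auto)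

lemma smooth_on_ident: "smooth_on (\<lambda>x. x) U"
proof -
  have "Ck_on k (\<lambda>x::'a. x) U" for k
  proof (cases k)
    case (Suc j)
    have "partial_deriv b (\<lambda>x. x) = (\<lambda>x::'a. b)" for b
      using partial_deriv_eq[OF has_derivative_ident] by auto
    then show ?thesis using Suc by (auto simp: Ck_on_const)
  qed auto
  then show ?thesis by (simp add: smooth_on_def)
qed

section \<open>Smooth cutoff functions\<close>

lemma exp_inverse_power_tendsto_0:
  "((\<lambda>x::real. inverse x ^ k * exp (- inverse x)) \<longlongrightarrow> 0) (at_right 0)"
proof -
  have "((\<lambda>x::real. x ^ k / exp x) \<longlongrightarrow> 0) at_top"
    by (rule tendsto_power_div_exp_0)
  from filterlim_compose[OF this filterlim_inverse_at_top_right]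
  show ?thesis by (simp add: exp_minus divide_inverse)
qed

text \<open>
  For \<open>k = 0\<close> this is the standard smooth function that is flat at the origin. The other powers are
  included because its derivatives are linear combinations of members of the family.
\<close>

definition flat_exp :: "nat \<Rightarrow> real \<Rightarrow> real" where
  "flat_exp k x = (if x > 0 then inverse x ^ k * exp (- inverse x) else 0)"

lemma flat_exp_deriv:
  "(flat_exp k has_real_derivative - k * flat_exp (Suc k) x + flat_exp (k + 2) x) (at x)"
proof (cases x "0::real" rule: linorder_cases)
  case less
  have "((\<lambda>x. 0) has_real_derivative 0) (at x)" by simp
  then have "(flat_exp k has_real_derivative 0) (at x)"
    by (rule DERIV_cong_ev[THEN iffD1, rotated -1])
       (use less in \<open>auto simp: flat_exp_def eventually_nhds_metric intro!: exI[of _ "-x"]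
          simp: dist_real_def\<close>)
  then show ?thesis using less by (simp add: flat_exp_def)
next
  case equal
  \<comment> \<open>To the right of the origin the difference quotient is the member of the family of the next power.\<close>
  have "((\<lambda>h. (flat_exp k (0 + h) - flat_exp k 0) / h) \<longlongrightarrow> 0) (at 0)"
  proof (rule filterlim_split_at)
    show "((\<lambda>h. (flat_exp k (0 + h) - flat_exp k 0) / h) \<longlongrightarrow> 0) (at_left 0)"
      by (rule tendsto_eventually) (auto simp: eventually_at_left_field flat_exp_def intro!: exI[of _ "-1"])
    show "((\<lambda>h. (flat_exp k (0 + h) - flat_exp k 0) / h) \<longlongrightarrow> 0) (at_right 0)"
    proof (rule Lim_transform_eventually[OF exp_inverse_power_tendsto_0[of "Suc k"]])
      show "\<forall>\<^sub>F x in at_right 0. inverse x ^ Suc k * exp (- inverse x) =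
          (flat_exp k (0 + x) - flat_exp k 0) / x"
        by (auto simp: eventually_at_right_field flat_exp_def field_simps intro!: exI[of _ 1])
    qed
  qed
  then show ?thesis using equal by (simp add: DERIV_def flat_exp_def)
next
  case greater
  have "((\<lambda>x. inverse x ^ k * exp (- inverse x)) has_real_derivative
      - k * flat_exp (Suc k) x + flat_exp (k + 2) x) (at x)"
    by (rule DERIV_cong[OF DERIV_mult[OF DERIV_power[OF DERIV_inverse]
           DERIV_fun_exp[OF DERIV_minus[OF DERIV_inverse]]]])
       (use greater in \<open>cases k; auto simp: flat_exp_def algebra_simps\<close>)+
  then show ?thesis
    by (rule DERIV_cong_ev[THEN iffD1, rotated -1])
       (use greater in \<open>auto simp: flat_exp_def eventually_nhds_metric intro!: exI[of _ "x"]
          simp: dist_real_def\<close>)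
qed

lemma smooth_on_flat_exp: "smooth_on (flat_exp k) UNIV"
proof -
  have "Ck_on n (flat_exp k) UNIV" for n k
  proof (induction n arbitrary: k)
    case 0
    then show ?case
      by (auto intro!: continuous_at_imp_continuous_on DERIV_isCont[OF flat_exp_deriv])
  next
    case (Suc n)
    have "partial_deriv 1 (flat_exp k) = (\<lambda>x. - k * flat_exp (Suc k) x + flat_exp (k + 2) x)"
      using partial_deriv_real[OF flat_exp_deriv] by auto
    moreover have "Ck_on n (\<lambda>x. - k * flat_exp (Suc k) x + flat_exp (k + 2) x) UNIV"
      by (intro Ck_on_add Ck_on_bilinear[OF bounded_bilinear_mult] Ck_on_const Suc) auto
    moreover have "\<forall>x. flat_exp k differentiable at x"
      using flat_exp_deriv real_differentiable_def by blast
    ultimately show ?case by simp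
  qed
  then show ?thesis by (simp add: smooth_on_def)
qed

definition smooth_step :: "real \<Rightarrow> real" where
  "smooth_step x = flat_exp 0 x * inverse (flat_exp 0 x + flat_exp 0 (1 - x))"

lemma flat_exp_0_pos: "0 < flat_exp 0 x + flat_exp 0 (1 - x)"
  by (auto simp: flat_exp_def intro!: add_pos_pos add_pos_nonneg add_nonneg_pos)

lemma smooth_step_le_0: "x \<le> 0 \<Longrightarrow> smooth_step x = 0"
  and smooth_step_ge_1: "1 \<le> x \<Longrightarrow> smooth_step x = 1"
  and smooth_step_nonneg: "0 \<le> smooth_step x"
  and smooth_step_le_1: "smooth_step x \<le> 1"
  using flat_exp_0_pos[of x]
  by (auto simp: smooth_step_def flat_exp_def divide_simps simp flip: divide_inverse)

lemma smooth_on_smooth_step: "smooth_on smooth_step UNIV"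
proof -
  have 1: "smooth_on (\<lambda>x. flat_exp 0 (1 - x)) UNIV"
    by (rule smooth_on_compose_real[OF _ _ _ smooth_on_flat_exp])
       (auto intro!: smooth_on_diff smooth_on_ident)
  have "smooth_on (\<lambda>x. flat_exp 0 x * inverse (flat_exp 0 x + flat_exp 0 (1 - x))) UNIV"
    using flat_exp_0_pos
    by (intro smooth_on_mult smooth_on_inverse smooth_on_add smooth_on_flat_exp 1)
       (auto simp: less_le)
  then show ?thesis by (simp add: smooth_step_def[abs_def])
qed

lemma smooth_on_inner_self: "smooth_on (\<lambda>x::'a::euclidean_space. (x - p) \<bullet> (x - p)) U"
proof -
  have "smooth_on (\<lambda>x::'a. (x - p) \<bullet> (x - p)) UNIV"
    by (intro smooth_on_bilinear[OF bounded_bilinear_inner] smooth_on_diff smooth_on_ident) auto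
  then show ?thesis using smooth_on_subset by blast
qed

text \<open>
  Finitely many balls cover \<open>K\<close>. With one bump \<open>\<beta>\<close> per ball, equal to \<open>1\<close> on that ball, the product of all
  \<open>1 - \<beta>\<close> vanishes on \<open>K\<close>, and it is \<open>1\<close> outside the supports of the bumps.
\<close>

lemma smooth_cutoff:
  fixes K :: "'a::euclidean_space set"
  assumes "compact K" "open U" "K \<subseteq> U"
  obtains \<psi> :: "'a \<Rightarrow> real" and S where "smooth_on \<psi> UNIV" "\<And>x. 0 \<le> \<psi> x" "\<And>x. \<psi> x \<le> 1"
    "\<And>x. x \<in> K \<Longrightarrow> \<psi> x = 1" "compact S" "S \<subseteq> U" "\<And>x. x \<notin> S \<Longrightarrow> \<psi> x = 0"
proof -
  have ex: "\<exists>e>0. cball p (2 * e) \<subseteq> U" if "p \<in> K" for p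
  proof -
    have "p \<in> U" using that assms(3) by (rule subsetD[rotated])
    from assms(2)[unfolded open_contains_cball, rule_format, OF this]
    obtain e where "e > 0" "cball p e \<subseteq> U" by (elim exE conjE)
    then show ?thesis by (intro exI[of _ "e/2"]) auto
  qed
  define e where "e p = (SOME e. e > 0 \<and> cball p (2 * e) \<subseteq> U)" for p
  have e: "e p > 0" "cball p (2 * e p) \<subseteq> U" if "p \<in> K" for p
    using someI_ex[OF ex[OF that]] by (simp_all add: e_def)
  obtain F where F: "F \<subseteq> K" "finite F" "K \<subseteq> (\<Union>p\<in>F. ball p (e p))"
    by (rule compactE_image[OF assms(1), of K "\<lambda>p. ball p (e p)"]) (use e(1) in \<open>auto intro!: bexI\<close>)
  \<comment> \<open>The squared distance keeps the bump smooth at its centre. The step argument is at least 1 inside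
    the radius \<open>e p\<close> and at most 0 outside the radius \<open>2 * e p\<close>.\<close>
  define \<beta> where "\<beta> p x = smooth_step (2 - (x - p) \<bullet> (x - p) * inverse ((e p)\<^sup>2))" for p x :: 'a
  have sq: "(x - p) \<bullet> (x - p) = (dist p x)\<^sup>2" for p x :: 'a
    by (simp add: power2_norm_eq_inner dist_norm norm_minus_commute[of p])
  have \<beta>s: "smooth_on (\<beta> p) UNIV" for p
    unfolding \<beta>_def
    by (rule smooth_on_compose_real[OF _ _ _ smooth_on_smooth_step])
       (auto intro!: smooth_on_diff smooth_on_mult smooth_on_inner_self)
  have \<beta>1: "\<beta> p x = 1" if "p \<in> F" "x \<in> ball p (e p)" for p x
  proof -
    have "(dist p x)\<^sup>2 \<le> (e p)\<^sup>2" using that by (intro power_mono) auto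
    then show ?thesis unfolding \<beta>_def sq using e that F
      by (intro smooth_step_ge_1) (auto simp: divide_simps simp flip: divide_inverse)
  qed
  have \<beta>0: "\<beta> p x = 0" if "p \<in> F" "x \<notin> cball p (2 * e p)" for p x
  proof -
    have "(2 * e p)\<^sup>2 \<le> (dist p x)\<^sup>2"
      using that e(1)[of p] F by (intro power_mono) (auto intro: less_imp_le)
    moreover have "0 < (e p)\<^sup>2" using that e(1)[of p] F by auto
    moreover have "(2 * e p)\<^sup>2 = 4 * (e p)\<^sup>2" by (simp add: power_mult_distrib)
    ultimately have "2 * (e p)\<^sup>2 \<le> (dist p x)\<^sup>2" "0 < (e p)\<^sup>2" by linarith+
    then show ?thesis unfolding \<beta>_def sq
      by (intro smooth_step_le_0) (auto simp: power_mult_distrib divide_simps simp flip: divide_inverse)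
  qed
  define \<psi> where "\<psi> x = 1 - (\<Prod>p\<in>F. 1 - \<beta> p x)" for x
  have b: "0 \<le> 1 - \<beta> p x \<and> 1 - \<beta> p x \<le> 1" for p x
    by (simp add: \<beta>_def smooth_step_nonneg smooth_step_le_1)
  show ?thesis
  proof (rule that[of \<psi> "\<Union>p\<in>F. cball p (2 * e p)"])
    show "smooth_on \<psi> UNIV"
      unfolding \<psi>_def by (intro smooth_on_diff smooth_on_prod smooth_on_const \<beta>s open_UNIV)
    show "0 \<le> \<psi> x" "\<psi> x \<le> 1" for x
      using prod_nonneg[of F "\<lambda>p. 1 - \<beta> p x"] prod_le_1[of F "\<lambda>p. 1 - \<beta> p x"] b
      by (auto simp: \<psi>_def)
    show "\<psi> x = 1" if "x \<in> K" for x
      using F that \<beta>1 by (force simp: \<psi>_def prod_zero_iff)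
    show "compact (\<Union>p\<in>F. cball p (2 * e p))" using F by (auto intro!: compact_UN)
    show "(\<Union>p\<in>F. cball p (2 * e p)) \<subseteq> U" using F e by blast
    show "\<psi> x = 0" if "x \<notin> (\<Union>p\<in>F. cball p (2 * e p))" for x
    proof -
      have "(\<Prod>p\<in>F. 1 - \<beta> p x) = (\<Prod>p\<in>F. 1)" using that \<beta>0 by (intro prod.cong) auto
      then show ?thesis by (simp add: \<psi>_def)
    qed
  qed
qed

section \<open>A global defining function\<close>

text \<open>
  The given local defining function \<open>r\<close> is blended with the constant \<open>-1\<close> by a cutoff \<open>\<psi>\<close>, and the sign is
  reversed. Positivity inside survives because the blend is a convex combination. The gradient on the boundary
  survives because \<open>\<psi>\<close> attains its maximum \<open>1\<close> there, so that its own gradient vanishes.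
\<close>

lemma global_defining_function:
  fixes \<Omega> :: "'a::euclidean_space set"
  assumes "smoothly_bounded_domain \<Omega>"
  obtains \<rho> :: "'a \<Rightarrow> real" where "smooth_on \<rho> UNIV" "\<And>x. x \<in> \<Omega> \<Longrightarrow> \<rho> x > 0"
    "\<And>x. x \<in> frontier \<Omega> \<Longrightarrow> \<rho> x = 0"
    "\<And>x. x \<in> frontier \<Omega> \<Longrightarrow> \<exists>b\<in>Basis. partial_deriv b \<rho> x \<noteq> 0"
proof -
  from assms obtain U and r :: "'a \<Rightarrow> real" where U: "open U" "frontier \<Omega> \<subseteq> U" and r: "smooth_on r U"
    and eq: "\<Omega> \<inter> U = {x \<in> U. r x < 0}"
    and grad: "\<forall>p\<in>frontier \<Omega>. \<exists>b\<in>Basis. partial_deriv b r p \<noteq> 0"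
    and \<Omega>: "open \<Omega>" "bounded \<Omega>"
    unfolding smoothly_bounded_domain_def by auto
  have "compact (frontier \<Omega>)" using \<Omega> by (simp add: compact_frontier_bounded)
  from smooth_cutoff[OF this U] obtain \<psi> :: "'a \<Rightarrow> real" and S where \<psi>: "smooth_on \<psi> UNIV" "\<And>x. 0 \<le> \<psi> x" "\<And>x. \<psi> x \<le> 1"
    "\<And>x. x \<in> frontier \<Omega> \<Longrightarrow> \<psi> x = 1" and S: "compact S" "S \<subseteq> U" "\<And>x. x \<notin> S \<Longrightarrow> \<psi> x = 0"
    by metis
  define \<rho> where "\<rho> x = 1 - \<psi> x * (1 + r x)" for x
  have r0: "r p = 0" if p: "p \<in> frontier \<Omega>" for p
  proof (rule antisym)
    have "p \<notin> \<Omega>" using p \<Omega> by (simp add: frontier_def interior_open)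
    then show "0 \<le> r p" using eq p U by (metis (mono_tags, lifting) IntE mem_Collect_eq not_less subsetD)
    have "open (r -` {0<..} \<inter> U)"
      using smooth_on_continuous[OF r] continuous_on_open_vimage[OF U(1)] open_greaterThan by blast
    moreover have "(r -` {0<..} \<inter> U) \<inter> \<Omega> = {}" using eq by force
    ultimately have "(r -` {0<..} \<inter> U) \<inter> closure \<Omega> = {}"
      by (simp add: open_Int_closure_eq_empty)
    moreover have "p \<in> closure \<Omega>" "p \<in> U" using p U by (auto simp: frontier_def)
    ultimately show "r p \<le> 0" by force
  qed
  show ?thesis
  proof (rule that)
    have 1: "smooth_on \<rho> U"
      unfolding \<rho>_def using r smooth_on_subset[OF \<psi>(1), of U] U
      by (intro smooth_on_diff smooth_on_mult smooth_on_add smooth_on_const) auto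
    have 2: "smooth_on \<rho> (- S)"
      by (rule smooth_on_cong[of _ "\<lambda>_. 1"]) (use S compact_imp_closed in \<open>auto simp: \<rho>_def\<close>)
    \<comment> \<open>Outside the support of the cutoff the blend is constant, whatever values \<open>r\<close> takes there.\<close>
    have "Ck_on k f (U \<union> - S)" if "Ck_on k f U" "Ck_on k f (- S)" for k and f :: "'a \<Rightarrow> real"
      using that
    proof (induction k arbitrary: f)
      case 0
      then show ?case using U compact_imp_closed[OF S(1)]
        by (auto intro!: continuous_on_open_Un)
    qed auto
    moreover have "U \<union> - S = UNIV" using S by blast
    ultimately show "smooth_on \<rho> UNIV" using 1 2 by (auto simp: smooth_on_def)
    show "\<rho> x > 0" if "x \<in> \<Omega>" for x
    proof (cases "x \<in> S")
      case True
      then have "r x < 0" using eq S that by blast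
      have "\<rho> x = (1 - \<psi> x) + \<psi> x * (- r x)" by (simp add: \<rho>_def algebra_simps)
      moreover have "0 \<le> 1 - \<psi> x" "0 \<le> \<psi> x * (- r x)"
        using \<psi> \<open>r x < 0\<close> by (auto simp: mult_nonneg_nonpos)
      moreover have "0 < 1 - \<psi> x \<or> 0 < \<psi> x * (- r x)"
        using \<psi>(3)[of x] \<open>r x < 0\<close> by (cases "\<psi> x = 1") auto
      ultimately show ?thesis by linarith
    qed (simp add: \<rho>_def S)
    show "\<rho> x = 0" if "x \<in> frontier \<Omega>" for x using that \<psi>(4) r0 by (simp add: \<rho>_def)
    show "\<exists>b\<in>Basis. partial_deriv b \<rho> p \<noteq> 0" if p: "p \<in> frontier \<Omega>" for p
    proof -
      have pU: "p \<in> U" using p U by auto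
      have d\<psi>: "partial_deriv b \<psi> p = 0" for b
      proof -
        have "(\<lambda>v. partial_deriv v \<psi> p) = (\<lambda>v. 0)"
          by (rule differential_zero_maxmin[of p UNIV \<psi>])
            (use smooth_on_has_derivative[OF \<psi>(1)] \<psi>(3,4) p in auto)
        then show ?thesis by meson
      qed
      have "(\<rho> has_derivative (\<lambda>v. 0 - (\<psi> p * (0 + partial_deriv v r p) + partial_deriv v \<psi> p * (1 + r p)))) (at p)"
        unfolding \<rho>_def
        by (intro has_derivative_diff has_derivative_mult has_derivative_add has_derivative_const
            smooth_on_has_derivative[OF r pU] smooth_on_has_derivative[OF \<psi>(1)]) auto
      from partial_deriv_eq[OF this] have "partial_deriv b \<rho> p = - partial_deriv b r p" for b
        using \<psi>(4)[OF p] d\<psi> by simp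
      then show ?thesis using grad p by auto
    qed
  qed
qed

section \<open>Integration by parts\<close>

lemma Ck_on_Un:
  "open U \<Longrightarrow> open V \<Longrightarrow> Ck_on k f U \<Longrightarrow> Ck_on k f V \<Longrightarrow> Ck_on k f (U \<union> V)"
  by (induction k arbitrary: f) (auto intro!: continuous_on_open_Un)

lemma partial_deriv_0_open:
  assumes "open U" "x \<in> U" "\<And>y. y \<in> U \<Longrightarrow> f y = 0"
  shows "partial_deriv b f x = 0"
proof -
  have "partial_deriv b f x = partial_deriv b (\<lambda>_. 0) x"
    using assms by (intro partial_deriv_cong_open)
  then show ?thesis by (simp add: partial_deriv_eq[OF has_derivative_const])
qed

lemma integrable_lborel_compact_support:
  fixes f :: "'a::euclidean_space \<Rightarrow> complex"
  assumes "continuous_on UNIV f" "compact K" "\<And>x. x \<notin> K \<Longrightarrow> f x = 0"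
  shows "integrable lborel f"
proof -
  have "(\<lambda>x. indicator K x *\<^sub>R f x) = f" using assms(3) by (auto simp: indicator_def)
  then show ?thesis
    using borel_integrable_compact[OF assms(2) continuous_on_subset[OF assms(1)]] by auto
qed

lemma continuous_vanishing_bounded:
  fixes f :: "'a::euclidean_space \<Rightarrow> complex"
  assumes "continuous_on K f" "compact K" "\<And>x. x \<notin> K \<Longrightarrow> f x = 0"
  obtains M where "M > 0" "\<And>x. norm (f x) \<le> M"
proof -
  have "bounded (f ` K)"
    using assms by (intro compact_imp_bounded compact_continuous_image)
  then obtain M where "M > 0" and M: "\<And>x. x \<in> K \<Longrightarrow> norm (f x) \<le> M"
    by (auto simp: bounded_pos)
  then have "norm (f x) \<le> M" for x using assms(3) by (cases "x \<in> K") auto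
  then show ?thesis using that \<open>M > 0\<close> by blast
qed

text \<open>
  By translation invariance the difference quotients of \<open>v\<close> in direction \<open>b\<close> have integral zero. They are bounded,
  supported in a fixed ball, and converge to the partial derivative, so the limit has integral zero as well.
\<close>

lemma integral_partial_deriv_lborel:
  fixes v :: "'a::euclidean_space \<Rightarrow> complex"
  assumes v: "Ck_on 1 v UNIV" and K: "compact K" "\<And>x. x \<notin> K \<Longrightarrow> v x = 0" and b: "b \<in> Basis"
  shows "integral\<^sup>L lborel (partial_deriv b v) = 0"
proof -
  define p where "p = partial_deriv b v"
  have dv: "(v has_derivative (\<lambda>h. partial_deriv h v x)) (at x)" for x
    using v by (auto intro!: partial_deriv_has_derivative)
  have cont_p: "continuous_on UNIV p" using v b by (auto simp: p_def)
  have cont_v: "continuous_on UNIV v"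
    using dv has_derivative_continuous by (blast intro: continuous_at_imp_continuous_on)
  have p0: "p x = 0" if "x \<notin> K" for x
    unfolding p_def
    by (rule partial_deriv_0_open[of "- K"]) (use K that compact_imp_closed in auto)
  obtain M where M: "M > 0" "\<And>x. norm (p x) \<le> M"
    using continuous_vanishing_bounded[of K p] cont_p K p0 continuous_on_subset by blast
  obtain R where R: "R > 0" "K \<subseteq> cball 0 R"
    
    using bounded_subset_ballD[OF compact_imp_bounded[OF K(1)], of 0] ball_subset_cball by (meson order_trans)
  define q where "q n x = (real (Suc n)) *\<^sub>R (v (x + inverse (Suc n) *\<^sub>R b) - v x)" for n x
  have line: "((\<lambda>s. v (x + s *\<^sub>R b)) has_derivative (\<lambda>h. h *\<^sub>R p (x + s *\<^sub>R b))) (at s within S)" for x s S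
  proof -
    have "((\<lambda>s. x + s *\<^sub>R b) has_derivative (\<lambda>h. h *\<^sub>R b)) (at s within S)"
      by (auto intro!: derivative_eq_intros)
    from has_derivative_compose[OF this dv]
    have "((\<lambda>s. v (x + s *\<^sub>R b)) has_derivative (\<lambda>h. partial_deriv (h *\<^sub>R b) v (x + s *\<^sub>R b))) (at s within S)" .
    moreover have "partial_deriv (h *\<^sub>R b) v y = h *\<^sub>R p y" for h y
      using linear_scale[OF has_derivative_linear[OF dv[of y]]] by (simp add: p_def)
    ultimately show ?thesis by simp
  qed
  \<comment> \<open>The steps have length at most 1, so enlarging the radius by 1 captures all supports.\<close>
  have q_bound: "norm (q n x) \<le> indicator (cball 0 (R + 1)) x *\<^sub>R M" for n x
  proof -
    define t where "t = inverse (real (Suc n))"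
    have t: "0 < t" "t \<le> 1" unfolding t_def using inverse_le_1_iff[of "real (Suc n)"] by auto
    have "norm (v (x + t *\<^sub>R b) - v (x + 0 *\<^sub>R b)) \<le> M * norm (t - 0)"
    proof (rule differentiable_bound[of "UNIV::real set", OF _ line])
      show "onorm (\<lambda>h. h *\<^sub>R p (x + s *\<^sub>R b)) \<le> M" for s
        by (rule onorm_le) (use M in \<open>simp add: mult.commute[of M] mult_left_mono\<close>)
    qed auto
    then have "norm (v (x + t *\<^sub>R b) - v x) \<le> M * t" using t by simp
    then have "real (Suc n) * norm (v (x + t *\<^sub>R b) - v x) \<le> real (Suc n) * (M * t)"
      by (intro mult_left_mono) auto
    moreover have "real (Suc n) * (M * t) = M" by (simp add: t_def)
    moreover have "norm (q n x) = real (Suc n) * norm (v (x + t *\<^sub>R b) - v x)"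
      unfolding q_def t_def norm_scaleR by simp
    ultimately have 1: "norm (q n x) \<le> M" by linarith
    show ?thesis
    proof (cases "x \<in> cball 0 (R + 1)")
      case False
      then have "x \<notin> K" using R by auto
      moreover have "norm (x + t *\<^sub>R b) > R"
        using False t norm_triangle_ineq2[of x "- (t *\<^sub>R b)"] b by simp
      then have "x + t *\<^sub>R b \<notin> K" using R by auto
      ultimately have "q n x = 0" using K by (simp add: q_def t_def)
      then show ?thesis using False by simp
    qed (use 1 in simp)
  qed
  have q_lim: "(\<lambda>n. q n x) \<longlonglongrightarrow> p x" for x
  proof -
    have "((\<lambda>s. v (x + s *\<^sub>R b)) has_vector_derivative p x) (at 0)"
      using line[of x 0 UNIV] by (simp add: has_vector_derivative_def)
    then have 1: "((\<lambda>s. norm (v (x + s *\<^sub>R b) - v x - s *\<^sub>R p x) / norm s) \<longlongrightarrow> 0) (at 0)"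
      by (simp add: has_vector_derivative_def has_derivative_at)
    have "norm (v (x + s *\<^sub>R b) - v x - s *\<^sub>R p x) / norm s
        = norm ((v (x + s *\<^sub>R b) - v x) /\<^sub>R s - p x)" if "s \<noteq> 0" for s
    proof -
      have "(v (x + s *\<^sub>R b) - v x) /\<^sub>R s - p x = inverse s *\<^sub>R (v (x + s *\<^sub>R b) - v x - s *\<^sub>R p x)"
        using that by (simp add: scaleR_right_diff_distrib)
      then show ?thesis by (simp add: divide_inverse mult.commute)
    qed
    then have "((\<lambda>s. norm ((v (x + s *\<^sub>R b) - v x) /\<^sub>R s - p x)) \<longlongrightarrow> 0) (at 0)"
      by (intro Lim_transform_eventually[OF 1]) (auto simp: eventually_at_filter)
    then have "((\<lambda>s. (v (x + s *\<^sub>R b) - v x) /\<^sub>R s) \<longlongrightarrow> p x) (at 0)"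
      using tendsto_norm_zero_iff LIM_zero_iff by blast
    moreover have "filterlim (\<lambda>n. inverse (real (Suc n))) (at 0) sequentially"
      unfolding filterlim_at using LIMSEQ_inverse_real_of_nat by auto
    ultimately have "(\<lambda>n. (v (x + inverse (real (Suc n)) *\<^sub>R b) - v x) /\<^sub>R inverse (real (Suc n))) \<longlonglongrightarrow> p x"
      by (rule filterlim_compose)
    then show ?thesis by (simp add: q_def)
  qed
  have int_v: "integrable lborel v" using integrable_lborel_compact_support[OF cont_v K] .
  have meas: "v \<in> borel_measurable borel" using cont_v by (rule borel_measurable_continuous_onI)
  have shift: "integral\<^sup>L lborel (\<lambda>x. v (x + c)) = integral\<^sup>L lborel v"
    "integrable lborel (\<lambda>x. v (x + c))" for c
  proof -
    have "integral\<^sup>L lborel (\<lambda>x. v (c + x)) = integral\<^sup>L (distr lborel borel ((+) c)) v"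
      by (rule integral_distr[symmetric]) (use meas in auto)
    then show "integral\<^sup>L lborel (\<lambda>x. v (x + c)) = integral\<^sup>L lborel v"
      by (simp add: lborel_distr_plus add.commute)
    have "integrable (distr lborel borel ((+) c)) v = integrable lborel (\<lambda>x. v (c + x))"
      by (rule integrable_distr_eq) (use meas in auto)
    then show "integrable lborel (\<lambda>x. v (x + c))"
      using int_v by (simp add: lborel_distr_plus add.commute)
  qed
  have "integral\<^sup>L lborel (q n) = 0" for n
    unfolding q_def using shift int_v by simp
  moreover have "(\<lambda>n. integral\<^sup>L lborel (q n)) \<longlonglongrightarrow> integral\<^sup>L lborel p"
  proof (rule integral_dominated_convergence)
    show "integrable lborel (\<lambda>x. indicator (cball 0 (R + 1)) x *\<^sub>R M :: real)"
      by (intro borel_integrable_compact) auto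
    show "p \<in> borel_measurable lborel" using borel_measurable_continuous_onI[OF cont_p] by simp
    show "q n \<in> borel_measurable lborel" for n
      unfolding q_def using shift(2) int_v by simp
  qed (use q_bound q_lim in auto)
  ultimately show ?thesis using LIMSEQ_const_iff[of 0 "integral\<^sup>L lborel p"] by (simp add: p_def)
qed

text \<open>
  The functions integrated below are only controlled inside \<open>\<Omega>\<close>. This transfers their integrals to the
  whole space, where translations act.
\<close>

lemma lebesgue_on_compact_support:
  fixes f :: "'a::euclidean_space \<Rightarrow> complex"
  assumes \<Omega>: "open \<Omega>" and "continuous_on \<Omega> f" "compact K" "K \<subseteq> \<Omega>" "\<And>x. x \<in> \<Omega> \<Longrightarrow> x \<notin> K \<Longrightarrow> f x = 0"
  shows "integrable (lebesgue_on \<Omega>) f"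
    and "(LINT x|lebesgue_on \<Omega>. f x) = (LINT x|lborel. indicator \<Omega> x *\<^sub>R f x)"
proof -
  have eq: "(\<lambda>x. indicator \<Omega> x *\<^sub>R f x) = (\<lambda>x. indicator K x *\<^sub>R f x)"
    using assms by (auto simp: indicator_def fun_eq_iff)
  have "integrable lborel (\<lambda>x. indicator \<Omega> x *\<^sub>R f x)"
    unfolding eq by (intro borel_integrable_compact assms continuous_on_subset[OF assms(2)])
  then show "integrable (lebesgue_on \<Omega>) f"
    "(LINT x|lebesgue_on \<Omega>. f x) = (LINT x|lborel. indicator \<Omega> x *\<^sub>R f x)"
    using \<Omega> by (auto simp: integrable_restrict_space integral_restrict_space integral_completion integrable_completion)
qed

text \<open>
  Extended by zero, \<open>v\<close> is continuously differentiable everywhere, since \<open>\<Omega>\<close> and the complement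
  of \<open>K\<close> are open and cover the space.
\<close>

lemma integral_partial_deriv_zero:
  fixes v :: "'a::euclidean_space \<Rightarrow> complex"
  assumes \<Omega>: "open \<Omega>" and v: "Ck_on 1 v \<Omega>" and K: "compact K" "K \<subseteq> \<Omega>" "\<And>x. x \<notin> K \<Longrightarrow> v x = 0"
    and b: "b \<in> Basis"
  shows "integrable (lebesgue_on \<Omega>) (partial_deriv b v)"
    and "(LINT x|lebesgue_on \<Omega>. partial_deriv b v x) = 0"
proof -
  have cK: "open (- K)" using K compact_imp_closed by auto
  have "Ck_on 1 v (- K)"
    by (rule Ck_on_cong[OF cK _ Ck_on_const[of _ 0]]) (use K in auto)
  from Ck_on_Un[OF \<Omega> cK v this] have "Ck_on 1 v (\<Omega> \<union> - K)" .
  moreover have "\<Omega> \<union> - K = UNIV" using K by auto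
  ultimately have v1: "Ck_on 1 v UNIV" by simp
  have p0: "partial_deriv b v x = 0" if "x \<notin> K" for x
    by (rule partial_deriv_0_open[OF cK]) (use K that in auto)
  have c: "continuous_on \<Omega> (partial_deriv b v)" using v b by auto
  show "integrable (lebesgue_on \<Omega>) (partial_deriv b v)"
    using lebesgue_on_compact_support[OF \<Omega> c K(1,2)] p0 by blast
  have "(\<lambda>x. indicator \<Omega> x *\<^sub>R partial_deriv b v x) = partial_deriv b v"
    using p0 K by (force simp: indicator_def fun_eq_iff)
  then show "(LINT x|lebesgue_on \<Omega>. partial_deriv b v x) = 0"
    using lebesgue_on_compact_support(2)[OF \<Omega> c K(1,2)] p0 integral_partial_deriv_lborel[OF v1 K(1) K(3) b] by simp
qed

lemma integration_by_parts:
  fixes u w :: "'a::euclidean_space \<Rightarrow> complex"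
  assumes \<Omega>: "open \<Omega>" and u: "smooth_on u \<Omega>" and w: "smooth_on w \<Omega>"
    and K: "compact K" "K \<subseteq> \<Omega>" "\<And>x. x \<notin> K \<Longrightarrow> w x = 0" and b: "b \<in> Basis"
  shows "(LINT x|lebesgue_on \<Omega>. partial_deriv b w x * u x) = - (LINT x|lebesgue_on \<Omega>. w x * partial_deriv b u x)"
proof -
  define v where "v x = w x * u x" for x
  have eq: "partial_deriv b v x = w x * partial_deriv b u x + partial_deriv b w x * u x" if "x \<in> \<Omega>" for x
    unfolding v_def using that u w by (intro partial_deriv_mult smooth_on_differentiable)
  have sv: "smooth_on v \<Omega>" unfolding v_def by (intro smooth_on_mult \<Omega> u w)
  then have "Ck_on 1 v \<Omega>" by (simp only: smooth_on_def)
  from integral_partial_deriv_zero[OF \<Omega> this K(1,2) _ b]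
  have "(LINT x|lebesgue_on \<Omega>. partial_deriv b v x) = 0" using K by (simp add: v_def)
  moreover have "(LINT x|lebesgue_on \<Omega>. partial_deriv b v x) =
     (LINT x|lebesgue_on \<Omega>. w x * partial_deriv b u x + partial_deriv b w x * u x)"
    using eq by (intro Bochner_Integration.integral_cong) auto
  moreover have "\<dots> = (LINT x|lebesgue_on \<Omega>. w x * partial_deriv b u x) + (LINT x|lebesgue_on \<Omega>. partial_deriv b w x * u x)"
  proof (rule Bochner_Integration.integral_add)
    show "integrable (lebesgue_on \<Omega>) (\<lambda>x. w x * partial_deriv b u x)"
      by (rule lebesgue_on_compact_support[OF \<Omega> _ K(1,2)])
        (use u w b K \<Omega> in \<open>auto intro!: smooth_on_continuous smooth_on_mult smooth_on_partial_deriv\<close>)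
    have "partial_deriv b w x = 0" if "x \<notin> K" for x
      by (rule partial_deriv_0_open[of "-K"]) (use K that compact_imp_closed in auto)
    then show "integrable (lebesgue_on \<Omega>) (\<lambda>x. partial_deriv b w x * u x)"
      by (intro lebesgue_on_compact_support[OF \<Omega> _ K(1,2)])
        (use u w b \<Omega> in \<open>auto intro!: smooth_on_continuous smooth_on_mult smooth_on_partial_deriv\<close>)
  qed
  ultimately show ?thesis by (simp add: eq_neg_iff_add_eq_0 add.commute)
qed

lemma smooth_on_foldr_partial_deriv:
  "smooth_on f U \<Longrightarrow> set L \<subseteq> Basis \<Longrightarrow> smooth_on (foldr partial_deriv L f) U"
  by (induction L) (auto intro: smooth_on_partial_deriv)

lemma foldr_partial_deriv_0:
  assumes "open U" "x \<in> U" "\<And>y. y \<in> U \<Longrightarrow> f y = 0"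
  shows "foldr partial_deriv L f x = 0"
  using assms(2)
proof (induction L arbitrary: x)
  case (Cons b L)
  then show ?case by (auto intro: partial_deriv_0_open[OF assms(1)])
qed (use assms in auto)

text \<open>
  The derivatives leave \<open>\<phi>\<close> in the order opposite to that in which they were applied, whence \<open>foldr\<close> on
  the left and \<open>fold\<close> on the right. In this form partial derivatives never have to be interchanged.
\<close>

lemma integration_by_parts_iterated:
  fixes u :: "'a::euclidean_space \<Rightarrow> complex" and \<phi> :: "'a \<Rightarrow> real"
  assumes \<Omega>: "open \<Omega>" and u: "smooth_on u \<Omega>" and \<phi>: "smooth_on \<phi> UNIV"
    and K: "compact K" "K \<subseteq> \<Omega>" "\<And>x. x \<notin> K \<Longrightarrow> \<phi> x = 0" and L: "set L \<subseteq> Basis"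
  shows "(LINT x|lebesgue_on \<Omega>. foldr partial_deriv L \<phi> x *\<^sub>R u x)
      = (-1) ^ length L * (LINT x|lebesgue_on \<Omega>. \<phi> x *\<^sub>R fold partial_deriv L u x)"
  using L u
proof (induction L arbitrary: u)
  case (Cons b L)
  define \<psi> where "\<psi> = foldr partial_deriv L \<phi>"
  have s: "smooth_on \<psi> UNIV" unfolding \<psi>_def using Cons.prems \<phi> by (intro smooth_on_foldr_partial_deriv) auto
  then have s': "smooth_on (\<lambda>x. complex_of_real (\<psi> x)) \<Omega>"
    by (rule smooth_on_linear[OF bounded_linear_of_real \<Omega> smooth_on_subset]) auto
  have z: "\<psi> x = 0" if "x \<notin> K" for x
    unfolding \<psi>_def by (rule foldr_partial_deriv_0[of "-K"]) (use K that compact_imp_closed in auto)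
  have "partial_deriv b (\<lambda>x. complex_of_real (\<psi> x)) x = complex_of_real (partial_deriv b \<psi> x)" for x
    by (rule partial_deriv_linear[OF bounded_linear_of_real smooth_on_differentiable[OF s]]) auto
  with integration_by_parts[OF \<Omega> Cons.prems(2) s' K(1,2), of b] z Cons.prems
  have "(LINT x|lebesgue_on \<Omega>. partial_deriv b \<psi> x *\<^sub>R u x) = - (LINT x|lebesgue_on \<Omega>. \<psi> x *\<^sub>R partial_deriv b u x)"
    by (simp add: scaleR_conv_of_real)
  also have "(LINT x|lebesgue_on \<Omega>. \<psi> x *\<^sub>R partial_deriv b u x) =
     (-1) ^ length L * (LINT x|lebesgue_on \<Omega>. \<phi> x *\<^sub>R fold partial_deriv L (partial_deriv b u) x)"
    unfolding \<psi>_def using Cons.prems by (intro Cons.IH) (auto intro: smooth_on_partial_deriv)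
  finally show ?case by (simp add: \<psi>_def)
qed auto

text \<open>
  The single partial derivatives that make up a multi-index, in the order in which \<^const>\<open>multi_deriv\<close>
  nests them.
\<close>

definition deriv_list :: "('a::euclidean_space \<Rightarrow> nat) \<Rightarrow> 'a list" where
  "deriv_list \<alpha> = concat (map (\<lambda>b. replicate (\<alpha> b) b) basis_list)"

lemma multi_deriv_eq_foldr: "multi_deriv \<alpha> \<phi> = foldr partial_deriv (deriv_list \<alpha>) \<phi>"
proof -
  have 1: "foldr partial_deriv (replicate n b) f = (partial_deriv b ^^ n) f" for n b and f :: "'a \<Rightarrow> 'b"
    by (induction n) auto
  have "foldr (\<lambda>b. partial_deriv b ^^ \<alpha> b) xs \<phi>
      = foldr partial_deriv (concat (map (\<lambda>b. replicate (\<alpha> b) b) xs)) \<phi>" for xs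
    by (induction xs) (auto simp: 1)
  then show ?thesis by (simp add: multi_deriv_def deriv_list_def)
qed

lemma length_deriv_list: "length (deriv_list \<alpha>) = (\<Sum>b\<in>Basis. \<alpha> b)"
  using sum_list_distinct_conv_sum_set[OF basis_list(2), of \<alpha>]
  by (simp add: deriv_list_def length_concat o_def basis_list(1))

lemma set_deriv_list: "set (deriv_list \<alpha>) \<subseteq> Basis"
  by (auto simp: deriv_list_def basis_list(1))

lemma smooth_is_weak_deriv:
  assumes "open \<Omega>" "smooth_on u \<Omega>"
  shows "is_weak_deriv \<Omega> \<alpha> u (fold partial_deriv (deriv_list \<alpha>) u)"
  unfolding is_weak_deriv_def
proof (intro allI impI)
  fix \<phi> :: "'a \<Rightarrow> real" assume "test_fun \<Omega> \<phi>"
  then have \<phi>: "smooth_on \<phi> UNIV" "compact (closure {x. \<phi> x \<noteq> 0})" "closure {x. \<phi> x \<noteq> 0} \<subseteq> \<Omega>"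
    by (auto simp: test_fun_def)
  have "\<phi> x = 0" if "x \<notin> closure {x. \<phi> x \<noteq> 0}" for x
    using that closure_subset[of "{x. \<phi> x \<noteq> 0}"] by blast
  from integration_by_parts_iterated[OF assms \<phi> this set_deriv_list]
  show "(LINT x|lebesgue_on \<Omega>. multi_deriv \<alpha> \<phi> x *\<^sub>R u x) = (- 1) ^ sum \<alpha> Basis *
      (LINT x|lebesgue_on \<Omega>. \<phi> x *\<^sub>R fold partial_deriv (deriv_list \<alpha>) u x)"
    by (simp add: multi_deriv_eq_foldr length_deriv_list)
qed

section \<open>Square-integrable functions\<close>

lemma L2_measurable: "f \<in> L2 \<Omega> \<Longrightarrow> f \<in> borel_measurable (lebesgue_on \<Omega>)"
  by (simp add: L2_def)

lemma L2_square_integrable: "f \<in> L2 \<Omega> \<Longrightarrow> integrable (lebesgue_on \<Omega>) (\<lambda>x. (norm (f x))\<^sup>2)"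
  by (simp add: L2_def)

lemma L2I_bound:
  assumes "f \<in> borel_measurable (lebesgue_on \<Omega>)" "integrable (lebesgue_on \<Omega>) h"
    "\<And>x. x \<in> \<Omega> \<Longrightarrow> (norm (f x))\<^sup>2 \<le> h x"
  shows "f \<in> L2 \<Omega>"
  unfolding L2_def
proof (intro CollectI conjI assms(1))
  show "integrable (lebesgue_on \<Omega>) (\<lambda>x. (norm (f x))\<^sup>2)"
  proof (rule Bochner_Integration.integrable_bound[OF assms(2)])
    show "AE x in lebesgue_on \<Omega>. norm ((norm (f x))\<^sup>2) \<le> norm (h x)"
      using assms(3) by (intro AE_I2) (fastforce intro: order_trans[OF _ abs_ge_self])
  qed (use assms(1) in measurable)
qed

lemma norm_add_square_le: "(norm (a + b))\<^sup>2 \<le> 2 * (norm a)\<^sup>2 + 2 * (norm (b::'a::real_normed_vector))\<^sup>2"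
proof -
  have "(norm (a + b))\<^sup>2 \<le> (norm a + norm b)\<^sup>2" by (intro power_mono norm_triangle_ineq) auto
  also have "\<dots> \<le> 2 * (norm a)\<^sup>2 + 2 * (norm b)\<^sup>2"
    using sum_squares_ge_zero[of "norm a - norm b" 0] by (simp add: power2_eq_square algebra_simps)
  finally show ?thesis .
qed

lemma L2_add:
  assumes f: "f \<in> L2 \<Omega>" and g: "g \<in> L2 \<Omega>"
  shows "(\<lambda>x. f x + g x) \<in> L2 \<Omega>"
proof (rule L2I_bound)
  show "(\<lambda>x. f x + g x) \<in> borel_measurable (lebesgue_on \<Omega>)"
    using f[THEN L2_measurable] g[THEN L2_measurable] by measurable
  show "integrable (lebesgue_on \<Omega>) (\<lambda>x. 2 * (norm (f x))\<^sup>2 + 2 * (norm (g x))\<^sup>2)"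
    using f[THEN L2_square_integrable] g[THEN L2_square_integrable] by simp
qed (rule norm_add_square_le)

lemma L2_bounded_mult:
  assumes f: "f \<in> L2 \<Omega>" and a: "a \<in> borel_measurable (lebesgue_on \<Omega>)" "\<And>x. x \<in> \<Omega> \<Longrightarrow> norm (a x) \<le> M"
  shows "(\<lambda>x. a x * f x) \<in> L2 \<Omega>"
proof (rule L2I_bound)
  show "(\<lambda>x. a x * f x) \<in> borel_measurable (lebesgue_on \<Omega>)"
    using f[THEN L2_measurable] a(1) by measurable
  show "integrable (lebesgue_on \<Omega>) (\<lambda>x. M\<^sup>2 * (norm (f x))\<^sup>2)"
    using f[THEN L2_square_integrable] by simp
  show "(norm (a x * f x))\<^sup>2 \<le> M\<^sup>2 * (norm (f x))\<^sup>2" if "x \<in> \<Omega>" for x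
    using a(2)[OF that] by (auto simp: norm_mult power_mult_distrib intro!: mult_right_mono power_mono)
qed

lemma L2_mult_integrable:
  assumes f: "f \<in> L2 \<Omega>" and g: "g \<in> L2 \<Omega>"
  shows "integrable (lebesgue_on \<Omega>) (\<lambda>x. f x * cnj (g x))"
proof (rule Bochner_Integration.integrable_bound)
  show "integrable (lebesgue_on \<Omega>) (\<lambda>x. (norm (f x))\<^sup>2 + (norm (g x))\<^sup>2)"
    using f[THEN L2_square_integrable] g[THEN L2_square_integrable] by simp
  have [measurable]: "f \<in> borel_measurable (lebesgue_on \<Omega>)" "g \<in> borel_measurable (lebesgue_on \<Omega>)"
    using f g by (auto intro: L2_measurable)
  have "(\<lambda>x. cnj (g x)) \<in> borel_measurable (lebesgue_on \<Omega>)"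
    by (rule measurable_compose[OF _ borel_measurable_continuous_onI]) (auto intro: continuous_intros)
  then show "(\<lambda>x. f x * cnj (g x)) \<in> borel_measurable (lebesgue_on \<Omega>)" by measurable
  have "norm (f x) * norm (g x) \<le> (norm (f x))\<^sup>2 + (norm (g x))\<^sup>2" for x
  proof -
    have "0 \<le> (norm (f x) - norm (g x))\<^sup>2" "0 \<le> norm (f x) * norm (g x)" by auto
    then show ?thesis unfolding power2_diff by linarith
  qed
  then show "AE x in lebesgue_on \<Omega>. norm (f x * cnj (g x)) \<le> norm ((norm (f x))\<^sup>2 + (norm (g x))\<^sup>2)"
    by (auto simp: norm_mult)
qed

lemma L2_integrable:
  assumes "bounded \<Omega>" "open \<Omega>" "w \<in> L2 \<Omega>"
  shows "integrable (lebesgue_on \<Omega>) w"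
proof -
  have "finite_measure (lebesgue_on \<Omega>)"
    using assms by (intro finite_measure_lebesgue_on) (simp add: lmeasurable_open)
  then have "(\<lambda>_. 1) \<in> L2 \<Omega>" by (simp add: L2_def finite_measure.integrable_const)
  from L2_mult_integrable[OF assms(3) this] show ?thesis by simp
qed

lemma L2_norm_nonneg: "0 \<le> L2_norm \<Omega> f"
  by (simp add: L2_norm_def)

lemma L2_norm_cong_AE:
  assumes "AE x in lebesgue_on \<Omega>. f x = g x" "f \<in> L2 \<Omega>" "g \<in> L2 \<Omega>"
  shows "L2_norm \<Omega> f = L2_norm \<Omega> g"
  unfolding L2_norm_def
  by (rule arg_cong[where f=sqrt], rule integral_cong_AE)
     (use assms in \<open>auto dest!: L2_square_integrable borel_measurable_integrable\<close>)

lemma L2_cong: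
  assumes "\<And>x. x \<in> \<Omega> \<Longrightarrow> f x = g x" 
  shows "f \<in> L2 \<Omega> \<longleftrightarrow> g \<in> L2 \<Omega>" "L2_norm \<Omega> f = L2_norm \<Omega> g"
proof -
  have "f \<in> borel_measurable (lebesgue_on \<Omega>) \<longleftrightarrow> g \<in> borel_measurable (lebesgue_on \<Omega>)"
    using assms by (intro measurable_cong) auto
  moreover have "integrable (lebesgue_on \<Omega>) (\<lambda>x. (norm (f x))\<^sup>2) \<longleftrightarrow> integrable (lebesgue_on \<Omega>) (\<lambda>x. (norm (g x))\<^sup>2)"
    using assms by (intro Bochner_Integration.integrable_cong) auto
  ultimately show "f \<in> L2 \<Omega> \<longleftrightarrow> g \<in> L2 \<Omega>" by (simp add: L2_def)
  show "L2_norm \<Omega> f = L2_norm \<Omega> g"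
    unfolding L2_norm_def using assms by (intro arg_cong[where f=sqrt] Bochner_Integration.integral_cong) auto
qed

lemma L2_norm_leI:
  assumes "f \<in> L2 \<Omega>" "integrable (lebesgue_on \<Omega>) h" "\<And>x. x \<in> \<Omega> \<Longrightarrow> (norm (f x))\<^sup>2 \<le> h x"
    "(LINT x|lebesgue_on \<Omega>. h x) \<le> B\<^sup>2" "0 \<le> B"
  shows "L2_norm \<Omega> f \<le> B"
proof -
  have "(LINT x|lebesgue_on \<Omega>. (norm (f x))\<^sup>2) \<le> (LINT x|lebesgue_on \<Omega>. h x)"
    using assms by (intro integral_mono L2_square_integrable) auto
  also have "\<dots> \<le> B\<^sup>2" by fact
  finally show ?thesis unfolding L2_norm_def using assms(5) by (simp add: real_le_lsqrt)
qed

lemma L2_norm_square: "(L2_norm \<Omega> f)\<^sup>2 = (LINT x|lebesgue_on \<Omega>. (norm (f x))\<^sup>2)"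
  unfolding L2_norm_def by (intro real_sqrt_pow2) simp

text \<open>
  A triangle inequality with a constant is enough for the estimates below, and it follows from the
  pointwise inequality for squares.
\<close>

lemma L2_norm_add_le:
  assumes f: "f \<in> L2 \<Omega>" and g: "g \<in> L2 \<Omega>"
  shows "L2_norm \<Omega> (\<lambda>x. f x + g x) \<le> 2 * (L2_norm \<Omega> f + L2_norm \<Omega> g)"
proof (rule L2_norm_leI[OF L2_add[OF f g]])
  show "integrable (lebesgue_on \<Omega>) (\<lambda>x. 2 * (norm (f x))\<^sup>2 + 2 * (norm (g x))\<^sup>2)"
    using f[THEN L2_square_integrable] g[THEN L2_square_integrable] by simp
  have "(LINT x|lebesgue_on \<Omega>. 2 * (norm (f x))\<^sup>2 + 2 * (norm (g x))\<^sup>2) = 2 * (L2_norm \<Omega> f)\<^sup>2 + 2 * (L2_norm \<Omega> g)\<^sup>2"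
    unfolding L2_norm_square using f[THEN L2_square_integrable] g[THEN L2_square_integrable] by simp
  also have "\<dots> \<le> (2 * (L2_norm \<Omega> f + L2_norm \<Omega> g))\<^sup>2"
    using mult_nonneg_nonneg[OF L2_norm_nonneg[of \<Omega> f] L2_norm_nonneg[of \<Omega> g]]
    by (simp add: power2_eq_square algebra_simps)
  finally show "(LINT x|lebesgue_on \<Omega>. 2 * (norm (f x))\<^sup>2 + 2 * (norm (g x))\<^sup>2) \<le> (2 * (L2_norm \<Omega> f + L2_norm \<Omega> g))\<^sup>2" .
qed (use L2_norm_nonneg[of \<Omega> f] L2_norm_nonneg[of \<Omega> g] norm_add_square_le in auto)

lemma L2_norm_bounded_mult:
  assumes f: "f \<in> L2 \<Omega>" and a: "a \<in> borel_measurable (lebesgue_on \<Omega>)" "\<And>x. x \<in> \<Omega> \<Longrightarrow> norm (a x) \<le> M" "0 \<le> M"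
  shows "L2_norm \<Omega> (\<lambda>x. a x * f x) \<le> M * L2_norm \<Omega> f"
proof (rule L2_norm_leI[OF L2_bounded_mult[OF f a(1,2)]])
  show "integrable (lebesgue_on \<Omega>) (\<lambda>x. M\<^sup>2 * (norm (f x))\<^sup>2)"
    using f[THEN L2_square_integrable] by simp
  show "(norm (a x * f x))\<^sup>2 \<le> M\<^sup>2 * (norm (f x))\<^sup>2" if "x \<in> \<Omega>" for x
    using a(2)[OF that] by (auto simp: norm_mult power_mult_distrib intro!: mult_right_mono power_mono)
  show "(LINT x|lebesgue_on \<Omega>. M\<^sup>2 * (norm (f x))\<^sup>2) \<le> (M * L2_norm \<Omega> f)\<^sup>2"
    by (simp add: power_mult_distrib L2_norm_square)
qed (use a L2_norm_nonneg[of \<Omega> f] in auto)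

text \<open>
  Fatou's lemma, in the form in which it is used to remove cutoffs from a uniform bound.
\<close>

lemma integral_le_pointwise_limit:
  fixes f :: "nat \<Rightarrow> 'a \<Rightarrow> real"
  assumes f: "\<And>n. integrable M (f n)" "\<And>n x. x \<in> space M \<Longrightarrow> 0 \<le> f n x" "\<And>n. integral\<^sup>L M (f n) \<le> B"
    and g: "g \<in> borel_measurable M" "\<And>x. x \<in> space M \<Longrightarrow> (\<lambda>n. f n x) \<longlonglongrightarrow> g x"
  shows "integrable M g" "integral\<^sup>L M g \<le> B"
proof -
  have g0: "0 \<le> g x" if "x \<in> space M" for x
    using LIMSEQ_le_const[OF g(2)[OF that]] f(2)[OF that] by blast
  have "0 \<le> integral\<^sup>L M (f 0)" using f(2)[of _ 0] by (intro integral_nonneg_AE AE_I2)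
  then have B: "0 \<le> B" using f(3)[of 0] by (rule order_trans)
  have "(\<integral>\<^sup>+ x. ennreal (g x) \<partial>M) = (\<integral>\<^sup>+ x. liminf (\<lambda>n. ennreal (f n x)) \<partial>M)"
    using g(2) by (intro nn_integral_cong lim_imp_Liminf[symmetric] tendsto_ennrealI) auto
  also have "\<dots> \<le> liminf (\<lambda>n. \<integral>\<^sup>+ x. ennreal (f n x) \<partial>M)"
    using f(1) by (intro nn_integral_liminf) auto
  also have "\<dots> \<le> liminf (\<lambda>n. ennreal B)"
    using f by (intro Liminf_mono always_eventually allI) (subst nn_integral_eq_integral, auto intro: ennreal_leI)
  also have "\<dots> = ennreal B" by (simp add: Liminf_const)
  finally have le: "(\<integral>\<^sup>+ x. ennreal (g x) \<partial>M) \<le> ennreal B" .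
  then show i: "integrable M g"
    using g(1) g0 by (intro integrableI_nonneg) (auto intro: le_less_trans)
  have "ennreal (integral\<^sup>L M g) \<le> ennreal B"
    using le nn_integral_eq_integral[OF i] g0 by simp
  then show "integral\<^sup>L M g \<le> B" using B by (simp add: ennreal_le_iff)
qed

section \<open>Uniqueness of weak derivatives\<close>

lemma compact_sets_lebesgue_on:
  assumes "open \<Omega>" "compact K" "K \<subseteq> \<Omega>"
  shows "K \<in> sets (lebesgue_on \<Omega>)"
  using assms lmeasurable_compact[OF assms(2)] by (auto simp: sets_restrict_space_iff fmeasurableD)

text \<open>
  Test functions that are \<open>1\<close> on \<open>K\<close> and supported in shrinking neighbourhoods of \<open>K\<close> converge boundedly to
  the indicator function of \<open>K\<close>.
\<close>

lemma compact_integral_zero: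
  fixes w :: "'a::euclidean_space \<Rightarrow> complex"
  assumes \<Omega>: "open \<Omega>" and w: "integrable (lebesgue_on \<Omega>) w"
    and z: "\<And>\<phi>. test_fun \<Omega> \<phi> \<Longrightarrow> (LINT x|lebesgue_on \<Omega>. \<phi> x *\<^sub>R w x) = 0"
    and K: "compact K" "K \<subseteq> \<Omega>"
  shows "(LINT x|lebesgue_on \<Omega>. indicator K x *\<^sub>R w x) = 0"
proof (cases "K = {}")
  case False
  define U where "U n = {x\<in>\<Omega>. infdist x K < inverse (Suc n)}" for n
  have U: "open (U n)" "K \<subseteq> U n" for n
  proof -
    have "U n = \<Omega> \<inter> (\<lambda>x. infdist x K) -` {..<inverse (Suc n)}" by (auto simp: U_def)
    moreover have "open ((\<lambda>x. infdist x K) -` {..<inverse (real (Suc n))})"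
      by (intro open_vimage continuous_intros open_lessThan)
    ultimately show "open (U n)" using \<Omega> by auto
    show "K \<subseteq> U n" using K by (auto simp: U_def)
  qed
  have "\<exists>\<psi>. test_fun \<Omega> \<psi> \<and> (\<forall>x. 0 \<le> \<psi> x) \<and> (\<forall>x. \<psi> x \<le> 1) \<and> (\<forall>x\<in>K. \<psi> x = 1) \<and> (\<forall>x. x \<notin> U n \<longrightarrow> \<psi> x = 0)" for n
  proof -
    obtain \<psi> :: "'a \<Rightarrow> real" and S where *: "smooth_on \<psi> UNIV" "\<And>x. 0 \<le> \<psi> x" "\<And>x. \<psi> x \<le> 1"
      "\<And>x. x \<in> K \<Longrightarrow> \<psi> x = 1" "compact S" "S \<subseteq> U n" "\<And>x. x \<notin> S \<Longrightarrow> \<psi> x = 0"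
      using smooth_cutoff[OF K(1) U] by metis
    have "closure {x. \<psi> x \<noteq> 0} \<subseteq> S"
      by (intro closure_minimal compact_imp_closed *) (use *(7) in blast)
    moreover have "compact (closure {x. \<psi> x \<noteq> 0})"
      using bounded_subset[OF compact_imp_bounded[OF *(5)]] calculation
      by (simp add: compact_eq_bounded_closed)
    ultimately have "test_fun \<Omega> \<psi>" using * by (auto simp: test_fun_def U_def)
    then show ?thesis using * by blast
  qed
  then obtain \<psi> where \<psi>: "\<And>n. test_fun \<Omega> (\<psi> n)" "\<And>n x. 0 \<le> \<psi> n x" "\<And>n x. \<psi> n x \<le> 1"
    "\<And>n x. x \<in> K \<Longrightarrow> \<psi> n x = 1" "\<And>n x. x \<notin> U n \<Longrightarrow> \<psi> n x = 0" by metis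
  have "(\<lambda>n. LINT x|lebesgue_on \<Omega>. \<psi> n x *\<^sub>R w x) \<longlonglongrightarrow> (LINT x|lebesgue_on \<Omega>. indicator K x *\<^sub>R w x)"
  proof (rule integral_dominated_convergence)
    have [measurable]: "w \<in> borel_measurable (lebesgue_on \<Omega>)" using w by auto
    have "K \<in> sets (lebesgue_on \<Omega>)"
      by (rule compact_sets_lebesgue_on[OF \<Omega> K])
    then show "(\<lambda>x. indicator K x *\<^sub>R w x) \<in> borel_measurable (lebesgue_on \<Omega>)" by measurable
    show "(\<lambda>x. \<psi> n x *\<^sub>R w x) \<in> borel_measurable (lebesgue_on \<Omega>)" for n
    proof -
      have "smooth_on (\<psi> n) UNIV" using \<psi>(1)[of n] by (simp add: test_fun_def)
      then have "continuous_on \<Omega> (\<psi> n)" using smooth_on_continuous smooth_on_subset by blast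
      then have "\<psi> n \<in> borel_measurable (lebesgue_on \<Omega>)"
        using \<Omega> by (intro continuous_imp_measurable_on_sets_lebesgue) auto
      then show ?thesis by measurable
    qed
    show "integrable (lebesgue_on \<Omega>) (\<lambda>x. norm (w x))" using w by simp
    show "AE x in lebesgue_on \<Omega>. (\<lambda>n. \<psi> n x *\<^sub>R w x) \<longlonglongrightarrow> indicator K x *\<^sub>R w x"
    proof (intro AE_I2 tendsto_scaleR tendsto_const)
      fix x
      show "(\<lambda>n. \<psi> n x) \<longlonglongrightarrow> indicator K x"
      proof (cases "x \<in> K")
        case False
        then have "0 < infdist x K" using K \<open>K \<noteq> {}\<close>
          using in_closed_iff_infdist_zero[OF compact_imp_closed] infdist_nonneg[of x K] by fastforce
        then have "\<forall>\<^sub>F n in sequentially. inverse (real (Suc n)) < infdist x K"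
          using LIMSEQ_inverse_real_of_nat by (auto dest: order_tendstoD)
        then have "\<forall>\<^sub>F n in sequentially. \<psi> n x = indicator K x"
          by eventually_elim (use \<psi>(5) False in \<open>auto simp: U_def\<close>)
        then show ?thesis by (rule tendsto_eventually)
      qed (simp add: \<psi>)
    qed
    show "AE x in lebesgue_on \<Omega>. norm (\<psi> n x *\<^sub>R w x) \<le> norm (w x)" for n
      using \<psi>(2,3) by (intro AE_I2) (simp add: mult_left_le_one_le)
  qed
  then show ?thesis using z[OF \<psi>(1)] by (simp add: LIMSEQ_const_iff)
qed simp

text \<open>
  Up to a null set, a measurable set is an increasing union of compact sets. Hence the integral of \<open>w\<close>
  over any measurable subset of \<open>\<Omega>\<close> vanishes, and so does \<open>w\<close> almost everywhere.
\<close>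

lemma test_fun_separating:
  fixes w :: "'a::euclidean_space \<Rightarrow> complex"
  assumes \<Omega>: "open \<Omega>" "bounded \<Omega>" and w: "integrable (lebesgue_on \<Omega>) w"
    and z: "\<And>\<phi>. test_fun \<Omega> \<phi> \<Longrightarrow> (LINT x|lebesgue_on \<Omega>. \<phi> x *\<^sub>R w x) = 0"
  shows "AE x in lebesgue_on \<Omega>. w x = 0"
proof -
  have "finite_measure (lebesgue_on \<Omega>)"
    using \<Omega> by (intro finite_measure_lebesgue_on) (simp add: lmeasurable_open)
  then interpret finite_measure "lebesgue_on \<Omega>" .
  show ?thesis
  proof (rule density_zero[OF w])
  fix A assume A: "A \<in> sets (lebesgue_on \<Omega>)"
  have [measurable]: "w \<in> borel_measurable (lebesgue_on \<Omega>)" using w by auto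
  have A': "A \<in> sets lebesgue" "A \<subseteq> \<Omega>"
    using A \<Omega> by (auto simp: sets_restrict_space_iff)
  obtain C T where CT: "fsigma C" "T \<in> null_sets lebesgue" "C \<union> T = A"
    using lebesgue_set_almost_fsigma[OF A'(1)] by metis
  then obtain F :: "nat \<Rightarrow> 'a set" where F: "\<And>n. compact (F n)" "C = (\<Union>n. F n)"
    using fsigma_Union_compact[of C] unfolding range_subsetD by (metis mem_Collect_eq range_subsetD)
  define G where "G n = (\<Union>i\<le>n. F i)" for n
  have G: "compact (G n)" "G n \<subseteq> \<Omega>" for n
    using F CT A' by (auto simp: G_def)
  have Gs: "G n \<in> sets (lebesgue_on \<Omega>)" for n
    by (rule compact_sets_lebesgue_on[OF \<Omega>(1) G])
  have Cs: "C \<in> sets (lebesgue_on \<Omega>)"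
    unfolding F(2) using F CT A' \<Omega> by (intro sets.countable_UN image_subsetI compact_sets_lebesgue_on) auto
  have "(\<lambda>n. LINT x|lebesgue_on \<Omega>. indicator (G n) x *\<^sub>R w x) \<longlonglongrightarrow> (LINT x|lebesgue_on \<Omega>. indicator C x *\<^sub>R w x)"
  proof (rule integral_dominated_convergence)
    show "integrable (lebesgue_on \<Omega>) (\<lambda>x. norm (w x))" using w by simp
    show "AE x in lebesgue_on \<Omega>. (\<lambda>n. indicator (G n) x *\<^sub>R w x) \<longlonglongrightarrow> indicator C x *\<^sub>R w x"
    proof (intro AE_I2 tendsto_scaleR tendsto_const tendsto_eventually)
      fix x
      show "\<forall>\<^sub>F n in sequentially. indicator (G n) x = (indicator C x :: real)"
      proof (cases "x \<in> C")
        case True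
        then obtain i where "x \<in> F i" using F by auto
        then have "\<forall>n\<ge>i. indicator (G n) x = (indicator C x :: real)"
          using True by (auto simp: G_def indicator_def)
        then show ?thesis by (auto simp: eventually_sequentially)
      qed (auto simp: G_def F)
    qed
  qed (use Cs Gs in \<open>auto simp: indicator_def\<close>)
  then have "(LINT x|lebesgue_on \<Omega>. indicator C x *\<^sub>R w x) = 0"
    using compact_integral_zero[OF \<Omega>(1) w z G] by (simp add: LIMSEQ_const_iff)
  moreover have "(LINT x|lebesgue_on \<Omega>. indicator A x *\<^sub>R w x) = (LINT x|lebesgue_on \<Omega>. indicator C x *\<^sub>R w x)"
  proof (rule integral_cong_AE)
    have "T \<in> null_sets (lebesgue_on \<Omega>)"
      using CT A' \<Omega> by (auto simp: null_sets_restrict_space)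
    then have "AE x in lebesgue_on \<Omega>. x \<notin> T" by (rule AE_not_in)
    then show "AE x in lebesgue_on \<Omega>. indicator A x *\<^sub>R w x = indicator C x *\<^sub>R w x"
      by eventually_elim (use CT in \<open>auto simp: indicator_def\<close>)
  qed (use A Cs in auto)
  ultimately show "set_lebesgue_integral (lebesgue_on \<Omega>) A w = 0"
    by (simp add: set_lebesgue_integral_def)
  qed
qed

lemma test_fun_mult_integrable:
  assumes "open \<Omega>" "test_fun \<Omega> \<phi>" "integrable (lebesgue_on \<Omega>) w"
  shows "integrable (lebesgue_on \<Omega>) (\<lambda>x. \<phi> x *\<^sub>R (w x :: complex))"
proof -
  have c: "continuous_on UNIV \<phi>" using assms(2) smooth_on_continuous by (auto simp: test_fun_def)
  let ?S = "closure {x. \<phi> x \<noteq> 0}"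
  have "bounded (\<phi> ` ?S)" using assms(2) c
    by (intro compact_imp_bounded compact_continuous_image) (auto simp: test_fun_def intro: continuous_on_subset)
  then obtain M where M: "M > 0" "\<And>x. x \<in> ?S \<Longrightarrow> norm (\<phi> x) \<le> M" by (auto simp: bounded_pos)
  have M': "norm (\<phi> x) \<le> M" for x
    using M closure_subset[of "{x. \<phi> x \<noteq> 0}"] by (cases "\<phi> x = 0") auto
  have [measurable]: "w \<in> borel_measurable (lebesgue_on \<Omega>)" using assms by auto
  have [measurable]: "\<phi> \<in> borel_measurable (lebesgue_on \<Omega>)"
    using assms(1) continuous_on_subset[OF c] by (intro continuous_imp_measurable_on_sets_lebesgue) auto
  show ?thesis
  proof (rule Bochner_Integration.integrable_bound)
    show "integrable (lebesgue_on \<Omega>) (\<lambda>x. M * norm (w x))" using assms(3) by simp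
    show "AE x in lebesgue_on \<Omega>. norm (\<phi> x *\<^sub>R w x) \<le> norm (M * norm (w x))"
      using M' M(1) by (intro AE_I2) (simp add: abs_mult mult_right_mono)
  qed measurable
qed

text \<open>
  The Sobolev norm uses a weak derivative chosen by Hilbert's operator. Any weak derivative that is at hand
  computes the same norm.
\<close>

lemma L2_norm_weak_deriv:
  assumes \<Omega>: "open \<Omega>" "bounded \<Omega>" and g: "g \<in> L2 \<Omega>" "is_weak_deriv \<Omega> \<alpha> f g"
  shows "L2_norm \<Omega> (weak_deriv \<Omega> \<alpha> f) = L2_norm \<Omega> g"
proof -
  define d where "d = weak_deriv \<Omega> \<alpha> f"
  have d: "d \<in> L2 \<Omega>" "is_weak_deriv \<Omega> \<alpha> f d"
    using someI[of "\<lambda>g. g \<in> L2 \<Omega> \<and> is_weak_deriv \<Omega> \<alpha> f g" g] g by (auto simp: d_def weak_deriv_def)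
  have "AE x in lebesgue_on \<Omega>. d x - g x = 0"
  proof (rule test_fun_separating[OF \<Omega>])
    show "integrable (lebesgue_on \<Omega>) (\<lambda>x. d x - g x)"
      using L2_integrable[OF \<Omega>(2,1)] d g by simp
    fix \<phi> assume \<phi>: "test_fun \<Omega> \<phi>"
    have "(LINT x|lebesgue_on \<Omega>. \<phi> x *\<^sub>R d x) = (LINT x|lebesgue_on \<Omega>. \<phi> x *\<^sub>R g x)"
      using d(2) g(2) \<phi> unfolding is_weak_deriv_def by simp
    then show "(LINT x|lebesgue_on \<Omega>. \<phi> x *\<^sub>R (d x - g x)) = 0"
      using test_fun_mult_integrable[OF \<Omega>(1) \<phi> L2_integrable[OF \<Omega>(2,1)]] d g
      by (simp add: scaleR_right_diff_distrib)
  qed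
  then show ?thesis
    unfolding d_def[symmetric] using d g by (intro L2_norm_cong_AE) auto
qed

lemma sobolev_norm_smooth_le:
  fixes u :: "'a::euclidean_space \<Rightarrow> complex"
  assumes \<Omega>: "open \<Omega>" "bounded \<Omega>" and u: "smooth_on u \<Omega>"
    and bd: "\<And>L. set L \<subseteq> Basis \<Longrightarrow> length L \<le> k \<Longrightarrow>
      fold partial_deriv L u \<in> L2 \<Omega> \<and> L2_norm \<Omega> (fold partial_deriv L u) \<le> C"
  shows "u \<in> sobolev k \<Omega>"
    and "sobolev_norm k \<Omega> u \<le> sqrt (card (multi_indices k :: ('a \<Rightarrow> nat) set)) * C"
proof -
  define g where "g \<alpha> = fold partial_deriv (deriv_list \<alpha>) u" for \<alpha> :: "'a \<Rightarrow> nat"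
  have w: "is_weak_deriv \<Omega> \<alpha> u (g \<alpha>)" for \<alpha>
    unfolding g_def by (rule smooth_is_weak_deriv[OF \<Omega>(1) u])
  have g: "g \<alpha> \<in> L2 \<Omega>" "L2_norm \<Omega> (g \<alpha>) \<le> C" if "\<alpha> \<in> multi_indices k" for \<alpha>
    using bd[of "deriv_list \<alpha>"] set_deriv_list[of \<alpha>] that
    by (auto simp: g_def length_deriv_list multi_indices_def)
  have "u \<in> L2 \<Omega>" "0 \<le> C" using bd[of "[]"] L2_norm_nonneg[of \<Omega> u] by auto
  then show "u \<in> sobolev k \<Omega>" unfolding sobolev_def using g w by auto
  have "(\<Sum>\<alpha>\<in>multi_indices k. (L2_norm \<Omega> (weak_deriv \<Omega> \<alpha> u))\<^sup>2) \<le> (\<Sum>\<alpha>\<in>(multi_indices k :: ('a \<Rightarrow> nat) set). C\<^sup>2)"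
    using g(2) L2_norm_weak_deriv[OF \<Omega> g(1) w]
    by (intro sum_mono power_mono) (auto simp: L2_norm_nonneg)
  then have "sobolev_norm k \<Omega> u \<le> sqrt (card (multi_indices k :: ('a \<Rightarrow> nat) set) * C\<^sup>2)"
    unfolding sobolev_norm_def by (intro real_sqrt_le_mono) simp
  then show "sobolev_norm k \<Omega> u \<le> sqrt (card (multi_indices k :: ('a \<Rightarrow> nat) set)) * C"
    using \<open>0 \<le> C\<close> by (simp add: real_sqrt_mult)
qed

section \<open>Smoothness of holomorphic functions of several variables\<close>

lemma norm_axis_complex: "norm (axis i (c::complex) :: complex ^ 'n) = norm c"
  by (simp add: norm_eq_sqrt_inner inner_axis_axis)

lemma axis_complex_scale: "axis i (c::complex) = c *s (axis i 1 :: complex ^ 'n)"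
  by (simp add: axis_def vec_eq_iff)

lemma Basis_complex_vec_cases:
  assumes "b \<in> (Basis :: (complex ^ 'n) set)"
  obtains i c where "b = axis i c" "c \<in> {1, \<i>}"
  using assms by (auto simp: Basis_vec_def Basis_complex_def)

lemma bounded_linear_axis: "bounded_linear (\<lambda>c. axis i c :: complex ^ 'n)"
proof
  show "axis i (b1 + b2) = (axis i b1 + axis i b2 :: complex ^ 'n)" for b1 b2 
    by (simp add: axis_def vec_eq_iff)
  show "axis i (r *\<^sub>R b) = r *\<^sub>R (axis i b :: complex ^ 'n)" for r and b :: complex
    by (simp add: axis_def vec_eq_iff)
  show "\<exists>K. \<forall>x. norm (axis i x :: complex ^ 'n) \<le> norm x * K"
    by (intro exI[of _ 1]) (simp add: norm_axis_complex)
qed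

lemma holomorphic_svD:
  assumes "holomorphic_sv f \<Omega>" "z \<in> \<Omega>"
  shows "(f has_derivative (\<lambda>v. partial_deriv v f z)) (at z)"
    and "partial_deriv (c *s v) f z = c * partial_deriv v f z"
    and "partial_deriv (axis i c) f z = c * partial_deriv (axis i 1) f z"
proof -
  obtain D where D: "(f has_derivative D) (at z)" "\<And>c v. D (c *s v) = c * D v"
    using assms unfolding holomorphic_sv_def by blast
  then have "D = (\<lambda>v. partial_deriv v f z)" by (simp add: fun_eq_iff partial_deriv_eq)
  then show "(f has_derivative (\<lambda>v. partial_deriv v f z)) (at z)"
    and *: "partial_deriv (c *s v) f z = c * partial_deriv v f z" for c v
    using D by simp_all
  show "partial_deriv (axis i c) f z = c * partial_deriv (axis i 1) f z"
    using * axis_complex_scale by metis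
qed

lemma holomorphic_svI:
  assumes "\<And>z. z \<in> \<Omega> \<Longrightarrow> (f has_derivative D z) (at z)" "\<And>z c v. z \<in> \<Omega> \<Longrightarrow> D z (c *s v) = c * D z v"
  shows "holomorphic_sv f \<Omega>"
  using assms unfolding holomorphic_sv_def by blast

lemma holomorphic_sv_cong:
  assumes "open \<Omega>" "\<And>z. z \<in> \<Omega> \<Longrightarrow> f z = g z" "holomorphic_sv f \<Omega>"
  shows "holomorphic_sv g \<Omega>"
  using assms unfolding holomorphic_sv_def by (meson has_derivative_transform_within_open)

text \<open>
  Cauchy's formula for the derivative, on a circle of radius \<open>r\<close> about \<open>z\<close> in the \<open>i\<close>-th complex coordinate line.
  The kernel \<open>k\<close> and the circle \<open>c\<close> do not depend on \<open>z\<close>, so that the formula can be differentiated in \<open>z\<close>.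
\<close>

lemma cauchy_partial_deriv:
  fixes f :: "complex ^ 'n \<Rightarrow> complex"
  assumes f: "holomorphic_sv f \<Omega>" and r: "r > 0"
  obtains k c :: "real \<Rightarrow> complex" where "continuous_on {0..1} k" "continuous_on {0..1} c"
    "\<And>t. norm (c t) = r"
    "\<And>z. cball z r \<subseteq> \<Omega> \<Longrightarrow> partial_deriv (axis i 1) f z = integral (cbox 0 1) (\<lambda>t. k t * f (z + axis i (c t)))"
proof -
  define c where "c = circlepath 0 r"
  have c_eq: "c t = r * exp (2 * pi * \<i> * t)" for t by (simp add: c_def circlepath)
  have cr: "norm (c t) = r" for t
    using r by (simp add: c_eq norm_mult)
  then have c0: "c t \<noteq> 0" for t using r by (metis norm_zero less_irrefl)
  have cont: "continuous_on {0..1} c" unfolding c_eq by (intro continuous_intros)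
  define k where "k t = 1 / (2 * pi * \<i>) * (2 * pi * \<i> * r * exp (2 * pi * \<i> * t)) / (c t)\<^sup>2" for t :: real
  have cont_k: "continuous_on {0..1} k"
    unfolding k_def using c0 by (intro continuous_intros cont) auto
  have formula: "partial_deriv (axis i 1) f z = integral (cbox 0 1) (\<lambda>t. k t * f (z + axis i (c t)))"
    if z: "cball z r \<subseteq> \<Omega>" for z
  proof -
  define g where "g \<zeta> = f (z + axis i \<zeta>)" for \<zeta>
  have g: "(g has_field_derivative partial_deriv (axis i 1) f (z + axis i \<zeta>)) (at \<zeta>)" if "norm \<zeta> \<le> r" for \<zeta>
  proof -
    have "z + axis i \<zeta> \<in> \<Omega>" using z that by (auto simp: dist_norm norm_axis_complex)
    note D = holomorphic_svD[OF f this]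
    have "((\<lambda>\<zeta>. z + axis i \<zeta>) has_derivative (\<lambda>h. axis i h)) (at \<zeta>)"
      using bounded_linear.has_derivative[OF bounded_linear_axis has_derivative_ident]
      by (auto intro!: derivative_eq_intros)
    from has_derivative_compose[OF this D(1)]
    have "(g has_derivative (\<lambda>h. partial_deriv (axis i h) f (z + axis i \<zeta>))) (at \<zeta>)"
      by (simp add: g_def[abs_def])
    then have "(g has_derivative (\<lambda>h. h * partial_deriv (axis i 1) f (z + axis i \<zeta>))) (at \<zeta>)"
      by (subst (asm) D(3))
    then show ?thesis by (simp add: has_field_derivative_def mult.commute[of _ "partial_deriv _ _ _"])
  qed
  have "continuous_on (cball 0 r) g"
    using g by (intro continuous_at_imp_continuous_on ballI) (auto intro: DERIV_isCont)
  moreover have "g holomorphic_on ball 0 r"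
    unfolding holomorphic_on_open[OF open_ball] using g[OF less_imp_le] by (metis mem_ball_0)
  moreover have "0 \<in> ball 0 r" using r by simp
  ultimately have 1: "(\<lambda>u. g u / (u - 0)\<^sup>2) contour_integrable_on (circlepath 0 r)"
    "(g has_field_derivative 1 / (2 * of_real pi * \<i>) * contour_integral (circlepath 0 r) (\<lambda>u. g u / (u - 0)\<^sup>2)) (at 0)"
    by (rule Cauchy_derivative_integral_circlepath)+
  have "((\<lambda>t. g (c t) / (c t)\<^sup>2 * (2 * pi * \<i> * r * exp (2 * pi * \<i> * t))) has_integral
     contour_integral (circlepath 0 r) (\<lambda>u. g u / (u - 0)\<^sup>2)) {0..1}"
    using has_contour_integral_integral[OF 1(1)]
    by (simp add: has_contour_integral vector_derivative_circlepath c_def)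
  from has_integral_mult_right[OF this, of "1 / (2 * of_real pi * \<i>)"]
  have "((\<lambda>t. k t * g (c t)) has_integral
      1 / (2 * of_real pi * \<i>) * contour_integral (circlepath 0 r) (\<lambda>u. g u / (u - 0)\<^sup>2)) (cbox 0 1)"
    by (simp add: k_def mult_ac)
  moreover have "partial_deriv (axis i 1) f z = 1 / (2 * of_real pi * \<i>) * contour_integral (circlepath 0 r) (\<lambda>u. g u / (u - 0)\<^sup>2)"
    using DERIV_unique[OF g[of 0] 1(2)] r axis_complex_scale[of i 0] by simp
  ultimately show ?thesis
    by (simp add: g_def integral_unique)
  qed
  show thesis by (rule that[OF cont_k cont cr formula])
qed

lemma continuous_circle_shift:
  fixes c :: "real \<Rightarrow> complex" and g :: "complex ^ 'n \<Rightarrow> 'z::topological_space"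
  assumes "continuous_on \<Omega> g" "continuous_on {0..1} c" "\<And>z t. z \<in> U \<Longrightarrow> z + axis i (c t) \<in> \<Omega>"
  shows "continuous_on (U \<times> cbox 0 1) (\<lambda>(z :: complex ^ 'n, t). g (z + axis i (c t)))"
proof -
  have "continuous_on (U \<times> cbox 0 1) (\<lambda>x. c (snd x))"
    by (rule continuous_on_compose2[OF assms(2)]) (auto intro: continuous_intros)
  then have "continuous_on (U \<times> cbox 0 1) (\<lambda>x. fst x + (axis i (c (snd x)) :: complex ^ 'n))"
    by (intro continuous_intros bounded_linear.continuous_on[OF bounded_linear_axis])
  from continuous_on_compose2[OF assms(1) this]
  show ?thesis using assms(3) by (force simp: case_prod_unfold)
qed

lemma continuous_on_slice:
  assumes "continuous_on (U \<times> V) (\<lambda>(z, t). h z t)" "z \<in> U"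
  shows "continuous_on V (h z)"
proof -
  have "continuous_on V (\<lambda>t. (z, t))" by (intro continuous_intros)
  then have "continuous_on V (\<lambda>t. case (z, t) of (z, t) \<Rightarrow> h z t)"
    by (rule continuous_on_compose2[OF assms(1)]) (use assms(2) in auto)
  then show ?thesis by simp
qed

lemma circle_neighbourhood:
  fixes \<Omega> :: "(complex ^ 'n) set"
  assumes "open \<Omega>" "z0 \<in> \<Omega>"
  obtains r where "r > 0" "\<And>z. z \<in> ball z0 r \<Longrightarrow> cball z r \<subseteq> \<Omega>"
proof -
  obtain e where e: "e > 0" "cball z0 e \<subseteq> \<Omega>"
    using assms(1)[unfolded open_contains_cball] assms(2) by auto
  have "cball z (e/2) \<subseteq> \<Omega>" if "z \<in> ball z0 (e/2)" for z
  proof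
    fix x assume "x \<in> cball z (e/2)"
    then have "dist z0 x \<le> e" using that dist_triangle[of z0 x z] by simp
    then show "x \<in> \<Omega>" using e by auto
  qed
  then show ?thesis using that[of "e/2"] e by auto
qed

lemma holomorphic_sv_continuous: "holomorphic_sv f \<Omega> \<Longrightarrow> continuous_on \<Omega> f"
  by (meson holomorphic_svD(1) has_derivative_continuous continuous_at_imp_continuous_on)

text \<open>
  Differentiability at each point does not include continuity of the derivative. That comes from Cauchy's
  formula, whose integrand only involves values of \<open>f\<close>, and it is what differentiation under the
  integral sign requires in the next lemma.
\<close>

lemma holomorphic_sv_partial_deriv_continuous:
  fixes f :: "complex ^ 'n \<Rightarrow> complex"
  assumes \<Omega>: "open \<Omega>" and f: "holomorphic_sv f \<Omega>"
  shows "continuous_on \<Omega> (partial_deriv (axis i 1) f)"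
proof (intro continuous_at_imp_continuous_on ballI)
  fix z0 assume "z0 \<in> \<Omega>"
  from circle_neighbourhood[OF \<Omega> this]
  obtain r where r: "r > 0" "\<And>z. z \<in> ball z0 r \<Longrightarrow> cball z r \<subseteq> \<Omega>"
    by blast
  from cauchy_partial_deriv[OF f r(1), where i=i]
  obtain k c :: "real \<Rightarrow> complex" where kc: "continuous_on {0..1} k" "continuous_on {0..1} c"
    "\<And>t. norm (c t) = r"
    "\<And>z. cball z r \<subseteq> \<Omega> \<Longrightarrow> partial_deriv (axis i 1) f z = integral (cbox 0 1) (\<lambda>t. k t * f (z + axis i (c t)))"
    by blast
  have in\<Omega>: "z + axis i (c t) \<in> \<Omega>" if "z \<in> ball z0 r" for z t
    using r(2)[OF that] kc(3)[of t] by (auto simp: dist_norm norm_axis_complex)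
  have "continuous_on (ball z0 r \<times> cbox 0 1) (\<lambda>x. k (snd x))"
    by (rule continuous_on_compose2[OF kc(1)]) (auto intro: continuous_intros)
  moreover note continuous_circle_shift[OF holomorphic_sv_continuous[OF f] kc(2) in\<Omega>]
  ultimately have "continuous_on (ball z0 r \<times> cbox 0 1) (\<lambda>(z, t). k t * f (z + axis i (c t)))"
    unfolding case_prod_unfold by (intro continuous_on_mult)
  from integral_continuous_on_param[OF this]
  have "continuous_on (ball z0 r) (partial_deriv (axis i 1) f)"
    by (rule continuous_on_eq) (simp add: kc(4) r(2))
  then show "isCont (partial_deriv (axis i 1) f) z0"
    using r(1) by (meson centre_in_ball continuous_on_eq_continuous_at open_ball)
qed

text \<open>
  Differentiating Cauchy's formula under the integral sign shows that the partial derivative is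
  differentiable. Its derivative is an integral of complex linear maps, hence complex linear.
\<close>

lemma holomorphic_sv_partial_deriv_axis:
  fixes f :: "complex ^ 'n \<Rightarrow> complex"
  assumes \<Omega>: "open \<Omega>" and f: "holomorphic_sv f \<Omega>"
  shows "holomorphic_sv (partial_deriv (axis i 1) f) \<Omega>"
  unfolding holomorphic_sv_def
proof
  fix z0 assume "z0 \<in> \<Omega>"
  from circle_neighbourhood[OF \<Omega> this]
  obtain r where r: "r > 0" "\<And>z. z \<in> ball z0 r \<Longrightarrow> cball z r \<subseteq> \<Omega>"
    by blast
  from cauchy_partial_deriv[OF f r(1), where i=i]
  obtain k c :: "real \<Rightarrow> complex" where kc: "continuous_on {0..1} k" "continuous_on {0..1} c"
    "\<And>t. norm (c t) = r"
    "\<And>z. cball z r \<subseteq> \<Omega> \<Longrightarrow> partial_deriv (axis i 1) f z = integral (cbox 0 1) (\<lambda>t. k t * f (z + axis i (c t)))"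
    by blast
  have in\<Omega>: "z + axis i (c t) \<in> \<Omega>" if "z \<in> ball z0 r" for z t
    using r(2)[OF that] kc(3)[of t] by (auto simp: dist_norm norm_axis_complex)
  define F where "F z = Blinfun (\<lambda>v. partial_deriv v f z)" for z
  have F: "blinfun_apply (F z) = (\<lambda>v. partial_deriv v f z)" if "z \<in> \<Omega>" for z
    unfolding F_def using holomorphic_svD(1)[OF f that] has_derivative_bounded_linear
    by (intro bounded_linear_Blinfun_apply) blast
  have contF: "continuous_on \<Omega> F"
  proof (rule continuous_on_blinfun_componentwise)
    fix b :: "complex ^ 'n" assume "b \<in> Basis"
    then obtain j d where b: "b = axis j d" by (metis Basis_complex_vec_cases)
    have "continuous_on \<Omega> (\<lambda>z. d * partial_deriv (axis j 1) f z)"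
      by (intro continuous_intros holomorphic_sv_partial_deriv_continuous \<Omega> f)
    then show "continuous_on \<Omega> (\<lambda>z. F z b)"
      by (rule continuous_on_eq) (simp add: F b holomorphic_svD(3)[OF f, of _ j d])
  qed
  define fx where "fx z t = blinfun_mult_right (k t) o\<^sub>L F (z + axis i (c t))" for z t
  have contk: "continuous_on (ball z0 r \<times> cbox 0 1) (\<lambda>x. k (snd x))"
    by (rule continuous_on_compose2[OF kc(1)]) (auto intro: continuous_intros)
  have contfx: "continuous_on (ball z0 r \<times> cbox 0 1) (\<lambda>(z, t). fx z t)"
    using contk continuous_circle_shift[OF contF kc(2) in\<Omega>]
    unfolding case_prod_unfold fx_def
    by (intro bounded_bilinear.continuous_on[OF bounded_bilinear_blinfun_compose]
        bounded_linear.continuous_on[OF bounded_linear_blinfun_mult_right])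
  have contf: "continuous_on (ball z0 r \<times> cbox 0 1) (\<lambda>(z, t). k t * f (z + axis i (c t)))"
    using contk continuous_circle_shift[OF holomorphic_sv_continuous[OF f] kc(2) in\<Omega>]
    unfolding case_prod_unfold by (intro continuous_on_mult)
  have z0: "z0 \<in> ball z0 r" using r by simp
  have "((\<lambda>z. integral (cbox 0 1) (\<lambda>t. k t * f (z + axis i (c t)))) has_derivative integral (cbox 0 1) (fx z0))
     (at z0 within ball z0 r)"
  proof (rule leibniz_rule[OF _ _ contfx z0 convex_ball])
    show "((\<lambda>z. k t * f (z + axis i (c t))) has_derivative blinfun_apply (fx z t)) (at z within ball z0 r)"
      if "z \<in> ball z0 r" for z t
    proof -
      have "((\<lambda>z. z + axis i (c t)) has_derivative (\<lambda>h. h)) (at z within ball z0 r)"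
        by (auto intro!: derivative_eq_intros)
      from has_derivative_compose[OF this holomorphic_svD(1)[OF f in\<Omega>[OF that]]]
      have "((\<lambda>z. f (z + axis i (c t))) has_derivative (\<lambda>h. F (z + axis i (c t)) h)) (at z within ball z0 r)"
        by (simp add: F[OF in\<Omega>[OF that]])
      from has_derivative_mult_right[OF this, of "k t"] show ?thesis
        by (simp add: fx_def blinfun_compose.rep_eq o_def)
    qed
    show "(\<lambda>t. k t * f (z + axis i (c t))) integrable_on cbox 0 1" if "z \<in> ball z0 r" for z
      by (rule integrable_continuous, rule continuous_on_slice[OF contf that])
  qed
  then have "((\<lambda>z. integral (cbox 0 1) (\<lambda>t. k t * f (z + axis i (c t)))) has_derivative integral (cbox 0 1) (fx z0)) (at z0)"
    using at_within_open[OF z0 open_ball] by simp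
  then have D: "(partial_deriv (axis i 1) f has_derivative integral (cbox 0 1) (fx z0)) (at z0)"
    by (rule has_derivative_transform_within_open[OF _ open_ball z0]) (simp add: kc(4) r(2))
  have app: "integral (cbox 0 1) (fx z0) v = integral (cbox 0 1) (\<lambda>t. k t * partial_deriv v f (z0 + axis i (c t)))" for v
  proof -
    have "integral (cbox 0 1) ((\<lambda>B. blinfun_apply B v) \<circ> fx z0) = integral (cbox 0 1) (fx z0) v"
      by (intro integral_linear integrable_continuous continuous_on_slice[OF contfx z0] blinfun.bounded_linear_left)
    then show ?thesis
      by (simp add: o_def fx_def blinfun_compose.rep_eq F[OF in\<Omega>[OF z0]])
  qed
  have "integral (cbox 0 1) (fx z0) (d *s v) = d * integral (cbox 0 1) (fx z0) v" for d v
    unfolding app by (simp add: holomorphic_svD(2)[OF f in\<Omega>[OF z0]] mult.left_commute[of _ d])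
  then show "\<exists>D. (partial_deriv (axis i 1) f has_derivative D) (at z0) \<and> (\<forall>c v. D (c *s v) = c * D v)"
    using D by blast
qed

lemma holomorphic_sv_cmult: "holomorphic_sv f \<Omega> \<Longrightarrow> holomorphic_sv (\<lambda>z. c * f z) \<Omega>"
  by (rule holomorphic_svI[where D="\<lambda>z v. c * partial_deriv v f z"])
    (simp_all add: has_derivative_mult_right holomorphic_svD)

lemma holomorphic_sv_partial_deriv:
  fixes f :: "complex ^ 'n \<Rightarrow> complex"
  assumes \<Omega>: "open \<Omega>" and f: "holomorphic_sv f \<Omega>" and b: "b \<in> Basis"
  shows "holomorphic_sv (partial_deriv b f) \<Omega>"
proof -
  obtain i c where b: "b = axis i c" using b by (metis Basis_complex_vec_cases)
  show ?thesis
    by (rule holomorphic_sv_cong[OF \<Omega> _ holomorphic_sv_cmult[OF holomorphic_sv_partial_deriv_axis[OF \<Omega> f]], of c i])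
      (simp add: b holomorphic_svD(3)[OF f, of _ i c])
qed

lemma holomorphic_sv_smooth:
  fixes f :: "complex ^ 'n \<Rightarrow> complex"
  assumes \<Omega>: "open \<Omega>" and f: "holomorphic_sv f \<Omega>"
  shows "smooth_on f \<Omega>"
proof -
  have "Ck_on k f \<Omega>" for k
    using f
  proof (induction k arbitrary: f)
    case 0
    then show ?case by (simp add: holomorphic_sv_continuous)
  next
    case (Suc k)
    then show ?case
      using holomorphic_sv_partial_deriv[OF \<Omega>] differentiableI[OF holomorphic_svD(1)[OF Suc.prems]] by auto
  qed
  then show ?thesis by (simp add: smooth_on_def)
qed

lemma holomorphic_sv_mult:
  assumes "holomorphic_sv f \<Omega>" "holomorphic_sv g \<Omega>"
  shows "holomorphic_sv (\<lambda>z. f z * g z) \<Omega>"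
  by (rule holomorphic_svI[OF has_derivative_mult[OF holomorphic_svD(1)[OF assms(1)] holomorphic_svD(1)[OF assms(2)]]])
    (simp_all add: holomorphic_svD(2)[OF assms(1)] holomorphic_svD(2)[OF assms(2)] algebra_simps)

text \<open>
  Conjugate holomorphic functions inherit these properties by conjugation. Their derivatives are conjugate
  linear, which ties the two real derivatives in each complex coordinate together.
\<close>

lemma conj_holomorphic_sv_smooth:
  assumes "open \<Omega>" "conj_holomorphic_sv u \<Omega>"
  shows "smooth_on u \<Omega>"
  using smooth_on_linear[OF bounded_linear_cnj assms(1) holomorphic_sv_smooth[OF assms(1)]] assms(2)
  by (force simp: conj_holomorphic_sv_def)

lemma partial_deriv_cnj:
  assumes "open \<Omega>" "conj_holomorphic_sv u \<Omega>" "z \<in> \<Omega>"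
  shows "partial_deriv b (\<lambda>z. cnj (u z)) z = cnj (partial_deriv b u z)"
  by (rule partial_deriv_linear[OF bounded_linear_cnj smooth_on_differentiable[OF conj_holomorphic_sv_smooth]])
    (use assms in auto)

lemma conj_holomorphic_sv_partial_deriv:
  assumes "open \<Omega>" "conj_holomorphic_sv u \<Omega>" "b \<in> Basis"
  shows "conj_holomorphic_sv (partial_deriv b u) \<Omega>"
  unfolding conj_holomorphic_sv_def
  by (rule holomorphic_sv_cong[OF assms(1) partial_deriv_cnj[OF assms(1,2)] holomorphic_sv_partial_deriv])
    (use assms in \<open>auto simp: conj_holomorphic_sv_def\<close>)

lemma conj_holomorphic_sv_partial_deriv_axis:
  assumes "open \<Omega>" "conj_holomorphic_sv u \<Omega>" "z \<in> \<Omega>"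
  shows "partial_deriv (axis i c) u z = cnj c * partial_deriv (axis i 1) u z"
proof -
  have "cnj (partial_deriv (axis i c) u z) = cnj (cnj c * partial_deriv (axis i 1) u z)"
    unfolding partial_deriv_cnj[OF assms, symmetric] complex_cnj_mult complex_cnj_cnj
    using assms by (intro holomorphic_svD(3)) (auto simp: conj_holomorphic_sv_def)
  then show ?thesis by (metis complex_cnj_cnj)
qed

lemma conj_holomorphic_sv_mult_cnj:
  assumes "conj_holomorphic_sv u \<Omega>" "holomorphic_sv h \<Omega>"
  shows "conj_holomorphic_sv (\<lambda>z. u z * cnj (h z)) \<Omega>"
  using holomorphic_sv_mult assms by (simp add: conj_holomorphic_sv_def)

section \<open>Smoothness up to the boundary\<close>

text \<open>
  Smoothness on some neighbourhood of the closure. It passes to derivatives and, on bounded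
  sets, implies boundedness. The neighbourhood is not fixed because inverting a function may shrink it.
\<close>

definition smooth_upto_boundary :: "'a::euclidean_space set \<Rightarrow> ('a \<Rightarrow> 'b::real_normed_vector) \<Rightarrow> bool" where
  "smooth_upto_boundary \<Omega> f \<longleftrightarrow> (\<exists>V. open V \<and> closure \<Omega> \<subseteq> V \<and> smooth_on f V)"

lemma smooth_upto_boundaryI:
  "open V \<Longrightarrow> closure \<Omega> \<subseteq> V \<Longrightarrow> smooth_on f V \<Longrightarrow> smooth_upto_boundary \<Omega> f"
  by (auto simp: smooth_upto_boundary_def)

lemma smooth_upto_boundary_UNIV: "smooth_on f UNIV \<Longrightarrow> smooth_upto_boundary \<Omega> f"
  by (rule smooth_upto_boundaryI[of UNIV]) auto

lemma smooth_upto_boundary_smooth_on: "smooth_upto_boundary \<Omega> f \<Longrightarrow> smooth_on f \<Omega>"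
  unfolding smooth_upto_boundary_def using closure_subset smooth_on_subset by (metis order_trans)

lemma smooth_upto_boundary_partial_deriv:
  "smooth_upto_boundary \<Omega> f \<Longrightarrow> b \<in> Basis \<Longrightarrow> smooth_upto_boundary \<Omega> (partial_deriv b f)"
  unfolding smooth_upto_boundary_def using smooth_on_partial_deriv by blast

lemma smooth_upto_boundary_linear:
  "bounded_linear l \<Longrightarrow> smooth_upto_boundary \<Omega> f \<Longrightarrow> smooth_upto_boundary \<Omega> (\<lambda>x. l (f x))"
  unfolding smooth_upto_boundary_def using smooth_on_linear by blast

lemma smooth_upto_boundary_const [simp]: "smooth_upto_boundary \<Omega> (\<lambda>x. c)"
  by (simp add: smooth_upto_boundary_UNIV)

lemma smooth_upto_boundary_add:
  assumes "smooth_upto_boundary \<Omega> f" "smooth_upto_boundary \<Omega> g"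
  shows "smooth_upto_boundary \<Omega> (\<lambda>x. f x + g x)"
proof -
  obtain U V where *: "open U" "closure \<Omega> \<subseteq> U" "smooth_on f U" "open V" "closure \<Omega> \<subseteq> V" "smooth_on g V"
    using assms by (auto simp: smooth_upto_boundary_def)
  then have "smooth_on (\<lambda>x. f x + g x) (U \<inter> V)"
    by (intro smooth_on_add open_Int) (auto intro: smooth_on_subset)
  then show ?thesis using * by (intro smooth_upto_boundaryI[of "U \<inter> V"]) auto
qed

lemma smooth_upto_boundary_mult:
  fixes f g :: "'a::euclidean_space \<Rightarrow> 'b::real_normed_algebra"
  assumes "smooth_upto_boundary \<Omega> f" "smooth_upto_boundary \<Omega> g"
  shows "smooth_upto_boundary \<Omega> (\<lambda>x. f x * g x)"
proof -
  obtain U V where *: "open U" "closure \<Omega> \<subseteq> U" "smooth_on f U" "open V" "closure \<Omega> \<subseteq> V" "smooth_on g V"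
    using assms by (auto simp: smooth_upto_boundary_def)
  then have "smooth_on (\<lambda>x. f x * g x) (U \<inter> V)"
    by (intro smooth_on_mult open_Int) (auto intro: smooth_on_subset)
  then show ?thesis using * by (intro smooth_upto_boundaryI[of "U \<inter> V"]) auto
qed

lemma smooth_upto_boundary_power:
  fixes f :: "'a::euclidean_space \<Rightarrow> 'b::real_normed_algebra_1"
  shows "smooth_upto_boundary \<Omega> f \<Longrightarrow> smooth_upto_boundary \<Omega> (\<lambda>x. f x ^ n)"
  by (induction n) (auto intro: smooth_upto_boundary_mult)

lemma smooth_upto_boundary_diff:
  assumes "smooth_upto_boundary \<Omega> f" "smooth_upto_boundary \<Omega> g"
  shows "smooth_upto_boundary \<Omega> (\<lambda>x. f x - g x)"
  using smooth_upto_boundary_add[OF assms(1) smooth_upto_boundary_linear[OF bounded_linear_minus[OF bounded_linear_ident] assms(2)]]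
  by simp

lemma smooth_upto_boundary_sum:
  "(\<And>i. i \<in> I \<Longrightarrow> smooth_upto_boundary \<Omega> (f i)) \<Longrightarrow> smooth_upto_boundary \<Omega> (\<lambda>x. \<Sum>i\<in>I. f i x)"
  by (induction I rule: infinite_finite_induct) (auto intro: smooth_upto_boundary_add)

lemma smooth_upto_boundary_bounded:
  assumes "bounded \<Omega>" "smooth_upto_boundary \<Omega> f"
  obtains M where "M > 0" "\<And>x. x \<in> \<Omega> \<Longrightarrow> norm (f x) \<le> M"
proof -
  obtain V where V: "open V" "closure \<Omega> \<subseteq> V" "smooth_on f V"
    using assms(2) by (auto simp: smooth_upto_boundary_def)
  have "continuous_on (closure \<Omega>) f" using V smooth_on_continuous continuous_on_subset by blast
  moreover have "compact (closure \<Omega>)" using assms(1) by simp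
  ultimately have "bounded (f ` closure \<Omega>)" by (intro compact_imp_bounded compact_continuous_image)
  then obtain M where "M > 0" "\<And>x. x \<in> closure \<Omega> \<Longrightarrow> norm (f x) \<le> M" by (auto simp: bounded_pos)
  then show ?thesis using that[of M] closure_subset[of \<Omega>] by blast
qed

lemma smooth_on_measurable:
  fixes f :: "'a::euclidean_space \<Rightarrow> complex"
  shows "open \<Omega> \<Longrightarrow> smooth_on f \<Omega> \<Longrightarrow> f \<in> borel_measurable (lebesgue_on \<Omega>)"
  by (intro continuous_imp_measurable_on_sets_lebesgue smooth_on_continuous) auto

section \<open>Cutoff functions adapted to the boundary\<close>

lemma smooth_step_deriv_bounded:
  obtains M where "M > 0" "\<And>t. \<bar>partial_deriv 1 smooth_step t\<bar> \<le> M"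
    "\<And>t. t < 0 \<or> 1 < t \<Longrightarrow> partial_deriv 1 smooth_step t = 0"
proof -
  let ?d = "partial_deriv 1 smooth_step"
  have z: "?d t = 0" if t: "t < 0 \<or> 1 < t" for t
  proof -
    have "?d t = partial_deriv 1 (\<lambda>_. smooth_step t) t"
    proof (cases "t < 0")
      case True
      then show ?thesis
        by (intro partial_deriv_cong_open[of "{..<0}"]) (auto simp: smooth_step_le_0)
    next
      case False
      then show ?thesis using t
        by (intro partial_deriv_cong_open[of "{1<..}"]) (auto simp: smooth_step_ge_1)
    qed
    then show ?thesis by (simp add: partial_deriv_eq[OF has_derivative_const])
  qed
  have "continuous_on {0..1} ?d"
    by (rule continuous_on_subset[OF smooth_on_continuous[OF smooth_on_partial_deriv[OF smooth_on_smooth_step]]]) auto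
  then have "bounded (?d ` {0..1})"
    by (intro compact_imp_bounded compact_continuous_image) auto
  then obtain M where "M > 0" and M: "\<And>t. t \<in> {0..1} \<Longrightarrow> norm (?d t) \<le> M" by (auto simp: bounded_pos)
  then have "\<bar>?d t\<bar> \<le> M" for t using z[of t] by (cases "t \<in> {0..1}") auto
  then show ?thesis using that[of M] z \<open>M > 0\<close> by blast
qed

locale boundary_weight =
  fixes \<Omega> :: "(complex ^ 'n) set" and \<rho> :: "complex ^ 'n \<Rightarrow> real"
  assumes open_dom: "open \<Omega>" and bounded_dom: "bounded \<Omega>"
    and smooth_\<rho>: "smooth_on \<rho> UNIV"
    and \<rho>_pos: "\<And>x. x \<in> \<Omega> \<Longrightarrow> \<rho> x > 0"
    and \<rho>_frontier: "\<And>x. x \<in> frontier \<Omega> \<Longrightarrow> \<rho> x = 0"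
begin

text \<open>
  The weight as a complex function, so that it can be multiplied with functions in \<^const>\<open>L2\<close>.
\<close>

definition wt :: "complex ^ 'n \<Rightarrow> complex" where
  "wt x = complex_of_real (\<rho> x)"

lemma smooth_wt: "smooth_upto_boundary \<Omega> wt"
  unfolding wt_def[abs_def]
  by (intro smooth_upto_boundary_linear[OF bounded_linear_of_real] smooth_upto_boundary_UNIV smooth_\<rho>)

lemma partial_deriv_wt: "partial_deriv b wt x = complex_of_real (partial_deriv b \<rho> x)"
  unfolding wt_def[abs_def]
  by (rule partial_deriv_linear[OF bounded_linear_of_real smooth_on_differentiable[OF smooth_\<rho>]]) simp

text \<open>
  Compactly contained in \<open>\<Omega>\<close>, since \<open>\<rho>\<close> vanishes on the boundary; these sets carry the cutoffs.
\<close>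

definition interior_part :: "nat \<Rightarrow> (complex ^ 'n) set" where
  "interior_part n = {x \<in> closure \<Omega>. 1 / Suc n \<le> \<rho> x}"

lemma interior_part_compact_subset: "compact (interior_part n)" "interior_part n \<subseteq> \<Omega>"
proof -
  have "continuous_on UNIV \<rho>" using smooth_\<rho> smooth_on_continuous by blast
  then have "closed {x. 1 / Suc n \<le> \<rho> x}" by (intro closed_Collect_le continuous_on_const)
  moreover have "interior_part n = closure \<Omega> \<inter> {x. 1 / Suc n \<le> \<rho> x}" by (auto simp: interior_part_def)
  ultimately show "compact (interior_part n)"
    using bounded_dom by (simp add: compact_Int_closed)
  have "x \<in> \<Omega>" if "x \<in> closure \<Omega>" "1 / Suc n \<le> \<rho> x" for x
  proof (rule ccontr)
    assume "x \<notin> \<Omega>"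
    then have "x \<in> frontier \<Omega>" using that open_dom by (simp add: frontier_def interior_open)
    then have "1 / real (Suc n) \<le> 0" using \<rho>_frontier that by simp
    then show False by (simp add: divide_simps split: if_splits)
  qed
  then show "interior_part n \<subseteq> \<Omega>" by (auto simp: interior_part_def)
qed

text \<open>
  Equal to \<open>1\<close> where \<open>\<rho> \<ge> 2 / (n + 1)\<close> and to \<open>0\<close> where \<open>\<rho> \<le> 1 / (n + 1)\<close>. Outside \<open>\<Omega>\<close> the sign of \<open>\<rho>\<close> is
  unknown, so the value there is set to \<open>0\<close>.
\<close>

definition cutoff :: "nat \<Rightarrow> complex ^ 'n \<Rightarrow> real" where
  "cutoff n x = (if x \<in> \<Omega> then smooth_step (Suc n * \<rho> x - 1) else 0)"

lemma cutoff_range: "0 \<le> cutoff n x" "cutoff n x \<le> 1"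
  by (auto simp: cutoff_def smooth_step_nonneg smooth_step_le_1)

lemma cutoff_0: "x \<notin> interior_part n \<Longrightarrow> cutoff n x = 0"
  using closure_subset[of \<Omega>]
  by (auto simp: cutoff_def interior_part_def divide_simps mult.commute not_le intro!: smooth_step_le_0)

lemma smooth_on_cutoff: "smooth_on (cutoff n) \<Omega>"
proof (rule smooth_on_cong[OF open_dom])
  have "smooth_on (\<lambda>x. Suc n * \<rho> x - 1) \<Omega>"
    using smooth_on_subset[OF smooth_\<rho>, of \<Omega>] open_dom by (intro smooth_on_diff smooth_on_mult smooth_on_const) auto
  then show "smooth_on (\<lambda>x. smooth_step (Suc n * \<rho> x - 1)) \<Omega>"
    by (rule smooth_on_compose_real[OF open_dom _ _ smooth_on_smooth_step]) auto
qed (simp add: cutoff_def)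

lemma partial_deriv_cutoff:
  assumes x: "x \<in> \<Omega>"
  shows "partial_deriv b (cutoff n) x = partial_deriv 1 smooth_step (Suc n * \<rho> x - 1) * (Suc n * partial_deriv b \<rho> x)"
proof -
  have "((\<lambda>x. Suc n * \<rho> x - 1) has_derivative (\<lambda>v. Suc n * partial_deriv v \<rho> x - 0)) (at x)"
    by (intro has_derivative_diff has_derivative_mult_right has_derivative_const smooth_on_has_derivative[OF smooth_\<rho>]) auto
  note d = this
  have "partial_deriv b (cutoff n) x = partial_deriv b (\<lambda>x. smooth_step (Suc n * \<rho> x - 1)) x"
    using x open_dom by (intro partial_deriv_cong_open[of \<Omega>]) (auto simp: cutoff_def)
  also have "\<dots> = partial_deriv 1 smooth_step (Suc n * \<rho> x - 1) * partial_deriv b (\<lambda>x. Suc n * \<rho> x - 1) x"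
    by (rule partial_deriv_eq[OF has_derivative_compose_real[OF smooth_on_smooth_step]]) (use d in \<open>auto intro: differentiableI\<close>)
  finally show ?thesis using partial_deriv_eq[OF d] by simp
qed

lemma eventually_large: "x \<in> \<Omega> \<Longrightarrow> \<forall>\<^sub>F n in sequentially. 2 < Suc n * \<rho> x"
proof -
  assume x: "x \<in> \<Omega>"
  obtain N where "2 / \<rho> x < real N" using reals_Archimedean2 by blast
  then have "2 < real (Suc n) * \<rho> x" if "N \<le> n" for n
  proof -
    have "2 / \<rho> x < Suc n" using \<open>2 / \<rho> x < real N\<close> that by linarith
    then show ?thesis using \<rho>_pos[OF x] by (simp add: divide_less_eq)
  qed
  then show ?thesis by (auto simp: eventually_sequentially)
qed

lemma cutoff_tendsto: "x \<in> \<Omega> \<Longrightarrow> (\<lambda>n. cutoff n x) \<longlonglongrightarrow> 1"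
  by (rule tendsto_eventually, rule eventually_mono[OF eventually_large])
    (auto simp: cutoff_def intro!: smooth_step_ge_1)

lemma partial_deriv_cutoff_tendsto: "x \<in> \<Omega> \<Longrightarrow> (\<lambda>n. partial_deriv b (cutoff n) x) \<longlonglongrightarrow> 0"
proof (rule tendsto_eventually)
  assume x: "x \<in> \<Omega>"
  have z: "partial_deriv 1 smooth_step t = 0" if "1 < t" for t
    using smooth_step_deriv_bounded that by metis
  from eventually_large[OF x] show "\<forall>\<^sub>F n in sequentially. partial_deriv b (cutoff n) x = 0"
    by eventually_elim (simp add: partial_deriv_cutoff[OF x] z)
qed

text \<open>
  The derivative is of order \<open>n\<close>, but it is nonzero only where \<open>\<rho>\<close> is of order \<open>1 / n\<close>. So its product with \<open>\<rho>\<close> is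
  bounded independently of \<open>n\<close>.
\<close>

lemma partial_deriv_cutoff_bound:
  assumes b: "b \<in> Basis"
  obtains C where "C > 0" "\<And>n x. x \<in> \<Omega> \<Longrightarrow> \<bar>partial_deriv b (cutoff n) x\<bar> * \<rho> x \<le> C"
proof -
  obtain M where M: "M > 0" "\<And>t. \<bar>partial_deriv 1 smooth_step t\<bar> \<le> M"
    "\<And>t. t < 0 \<or> 1 < t \<Longrightarrow> partial_deriv 1 smooth_step t = 0"
    using smooth_step_deriv_bounded by metis
  have "smooth_upto_boundary \<Omega> (partial_deriv b \<rho>)"
    by (intro smooth_upto_boundary_partial_deriv smooth_upto_boundary_UNIV smooth_\<rho> b)
  then obtain P where P: "P > 0" "\<And>x. x \<in> \<Omega> \<Longrightarrow> norm (partial_deriv b \<rho> x) \<le> P"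
    using smooth_upto_boundary_bounded[OF bounded_dom] by metis
  have "\<bar>partial_deriv b (cutoff n) x\<bar> * \<rho> x \<le> M * (2 * P)" if x: "x \<in> \<Omega>" for n x
  proof (cases "Suc n * \<rho> x - 1 \<le> 1")
    case True
    have "\<bar>partial_deriv b (cutoff n) x\<bar> * \<rho> x =
        \<bar>partial_deriv 1 smooth_step (Suc n * \<rho> x - 1)\<bar> * ((Suc n * \<rho> x) * \<bar>partial_deriv b \<rho> x\<bar>)"
      by (simp add: partial_deriv_cutoff[OF x] abs_mult)
    also have "\<dots> \<le> M * (2 * P)"
      using M P(2)[OF x] True \<rho>_pos[OF x] P(1) by (intro mult_mono) auto
    finally show ?thesis .
  next
    case False
    then show ?thesis using M P by (simp add: partial_deriv_cutoff[OF x])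
  qed
  then show ?thesis using that[of "M * (2 * P)"] M P by auto
qed

end

section \<open>The Caccioppoli inequality for conjugate holomorphic functions\<close>

text \<open>
  Twice the Wirtinger derivative \<open>\<partial>/\<partial>z\<^sub>i\<close>, which annihilates conjugate holomorphic functions.
\<close>

definition dz :: "'n \<Rightarrow> (complex ^ 'n \<Rightarrow> complex) \<Rightarrow> complex ^ 'n \<Rightarrow> complex" where
  "dz i f x = partial_deriv (axis i 1) f x - \<i> * partial_deriv (axis i \<i>) f x"

lemma dz_mult:
  assumes "f differentiable (at x)" "g differentiable (at x)"
  shows "dz i (\<lambda>x. f x * g x) x = f x * dz i g x + dz i f x * g x"
  by (simp add: dz_def partial_deriv_mult[OF assms] algebra_simps)

lemma dz_0_open: "open U \<Longrightarrow> x \<in> U \<Longrightarrow> (\<And>y. y \<in> U \<Longrightarrow> f y = 0) \<Longrightarrow> dz i f x = 0"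
  by (simp add: dz_def partial_deriv_0_open)

lemma dz_conj_holomorphic:
  "open \<Omega> \<Longrightarrow> conj_holomorphic_sv u \<Omega> \<Longrightarrow> z \<in> \<Omega> \<Longrightarrow> dz i u z = 0"
  by (simp add: dz_def conj_holomorphic_sv_partial_deriv_axis[of \<Omega> u z i \<i>])

lemma dz_cnj:
  assumes "open \<Omega>" "conj_holomorphic_sv u \<Omega>" "z \<in> \<Omega>"
  shows "dz i (\<lambda>z. cnj (u z)) z = 2 * cnj (partial_deriv (axis i 1) u z)"
  by (simp add: dz_def partial_deriv_cnj[OF assms] conj_holomorphic_sv_partial_deriv_axis[OF assms, of i \<i>])

lemma axis_complex_in_Basis: "axis i 1 \<in> (Basis :: (complex ^ 'n) set)" "axis i \<i> \<in> (Basis :: (complex ^ 'n) set)"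
  by (auto simp: Basis_complex_def)

lemma smooth_on_dz: "open U \<Longrightarrow> smooth_on f U \<Longrightarrow> smooth_on (dz i f) U"
  unfolding dz_def[abs_def]
  by (intro smooth_on_diff smooth_on_mult smooth_on_const smooth_on_partial_deriv axis_complex_in_Basis) auto

lemma smooth_upto_boundary_dz: "smooth_upto_boundary \<Omega> f \<Longrightarrow> smooth_upto_boundary \<Omega> (dz i f)"
  unfolding smooth_upto_boundary_def using smooth_on_dz by blast

lemma integral_dz_zero:
  fixes v :: "complex ^ 'n \<Rightarrow> complex"
  assumes \<Omega>: "open \<Omega>" and v: "smooth_on v \<Omega>" and K: "compact K" "K \<subseteq> \<Omega>" "\<And>x. x \<notin> K \<Longrightarrow> v x = 0"
  shows "integrable (lebesgue_on \<Omega>) (dz i v)" "(LINT x|lebesgue_on \<Omega>. dz i v x) = 0"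
proof -
  have v1: "Ck_on 1 v \<Omega>" using v by (simp only: smooth_on_def)
  note * = integral_partial_deriv_zero[OF \<Omega> v1 K axis_complex_in_Basis(1)]
    integral_partial_deriv_zero[OF \<Omega> v1 K axis_complex_in_Basis(2)]
  show "integrable (lebesgue_on \<Omega>) (dz i v)" "(LINT x|lebesgue_on \<Omega>. dz i v x) = 0"
    unfolding dz_def[abs_def] using * by simp_all
qed

text \<open>
  Since \<open>p\<close> is conjugate holomorphic too, \<open>dz i\<close> of \<open>E\<^sup>2 p (cnj g)\<close> is \<open>2 E\<^sup>2 \<bar>p\<bar>\<^sup>2 + 2 E (dz i E) p (cnj g)\<close>,
  and its integral vanishes. The first term is therefore controlled by the second, and the
  inequality \<open>s t \<le> (s\<^sup>2 + t\<^sup>2) / 2\<close> lets half of the first term be absorbed.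
\<close>

lemma caccioppoli_compact_support:
  fixes g E :: "complex ^ 'n::finite \<Rightarrow> complex" and i :: "'n"
  assumes \<Omega>: "open \<Omega>" and g: "conj_holomorphic_sv g \<Omega>" and E: "smooth_on E \<Omega>" "\<And>x. E x \<in> \<real>"
    and K: "compact K" "K \<subseteq> \<Omega>" "\<And>x. x \<notin> K \<Longrightarrow> E x = 0"
  defines "p \<equiv> partial_deriv (axis i 1) g"
  shows "integrable (lebesgue_on \<Omega>) (\<lambda>x. (norm (E x * p x))\<^sup>2)"
    "(LINT x|lebesgue_on \<Omega>. (norm (E x * p x))\<^sup>2) \<le> (LINT x|lebesgue_on \<Omega>. (norm (dz i E x * g x))\<^sup>2)"
proof -
  have p: "conj_holomorphic_sv p \<Omega>"
    unfolding p_def by (intro conj_holomorphic_sv_partial_deriv \<Omega> g axis_complex_in_Basis)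
  note sg = conj_holomorphic_sv_smooth[OF \<Omega> g] and sp = conj_holomorphic_sv_smooth[OF \<Omega> p]
  have scg: "smooth_on (\<lambda>x. cnj (g x)) \<Omega>" by (rule smooth_on_linear[OF bounded_linear_cnj \<Omega> sg])
  note sdE = smooth_on_dz[OF \<Omega> E(1), of i]
  have dE0: "dz i E x = 0" if "x \<notin> K" for x
    by (rule dz_0_open[of "-K"]) (use K that compact_imp_closed in auto)
  have int: "integrable (lebesgue_on \<Omega>) f" if "smooth_on f \<Omega>" "\<And>x. x \<notin> K \<Longrightarrow> f x = 0" for f :: "complex ^ 'n \<Rightarrow> complex"
    by (rule lebesgue_on_compact_support(1)[OF \<Omega> smooth_on_continuous[OF that(1)] K(1,2) that(2)])
  define c where "c x = E x * dz i E x * (p x * cnj (g x))" for x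
  define a where "a x = (E x * p x) * (E x * cnj (p x))" for x
  have int_c: "integrable (lebesgue_on \<Omega>) c"
    unfolding c_def by (intro int smooth_on_mult \<Omega> E sdE sp scg) (simp add: K)
  have int_a: "integrable (lebesgue_on \<Omega>) a"
    unfolding a_def by (intro int smooth_on_mult \<Omega> E sp smooth_on_linear[OF bounded_linear_cnj]) (simp add: K)
  have norm_a: "norm (a x) = (norm (E x * p x))\<^sup>2" for x
    by (simp add: a_def norm_mult power2_eq_square)
  have a_real: "a x = complex_of_real ((norm (E x * p x))\<^sup>2)" for x
  proof -
    have "E x * cnj (p x) = cnj (E x * p x)" using E(2)[of x] by (simp add: Reals_cnj_iff)
    then show ?thesis unfolding a_def by (metis complex_norm_square)
  qed
  show int1: "integrable (lebesgue_on \<Omega>) (\<lambda>x. (norm (E x * p x))\<^sup>2)"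
    using integrable_norm[OF int_a] by (simp add: norm_a)
  have "integrable (lebesgue_on \<Omega>) (\<lambda>x. (dz i E x * g x) * (dz i E x * g x))"
    by (intro int smooth_on_mult \<Omega> sdE sg) (simp add: dE0)
  from integrable_norm[OF this]
  have int2: "integrable (lebesgue_on \<Omega>) (\<lambda>x. (norm (dz i E x * g x))\<^sup>2)"
    by (simp add: norm_mult power2_eq_square)
  define v where "v x = E x * E x * (p x * cnj (g x))" for x
  have sv: "smooth_on v \<Omega>" unfolding v_def by (intro smooth_on_mult \<Omega> E sp scg)
  have dv: "dz i v x = 2 * (a x + c x)" if x: "x \<in> \<Omega>" for x
  proof -
    note d = smooth_on_differentiable[OF _ x]
    have "dz i v x = E x * E x * dz i (\<lambda>x. p x * cnj (g x)) x + dz i (\<lambda>x. E x * E x) x * (p x * cnj (g x))"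
      unfolding v_def by (intro dz_mult d smooth_on_mult \<Omega> E sp scg)
    also have "dz i (\<lambda>x. p x * cnj (g x)) x = p x * (2 * cnj (p x)) + 0 * cnj (g x)"
      using dz_mult[OF d[OF sp] d[OF scg], of i] dz_cnj[OF \<Omega> g x] dz_conj_holomorphic[OF \<Omega> p x]
      by (simp add: p_def)
    also have "dz i (\<lambda>x. E x * E x) x = E x * dz i E x + dz i E x * E x"
      by (intro dz_mult d E)
    finally show ?thesis by (simp add: a_def c_def algebra_simps)
  qed
  have "(LINT x|lebesgue_on \<Omega>. 2 * (a x + c x)) = (LINT x|lebesgue_on \<Omega>. dz i v x)"
    using dv by (intro Bochner_Integration.integral_cong) auto
  also have "\<dots> = 0" by (rule integral_dz_zero[OF \<Omega> sv K(1,2)]) (simp add: v_def K)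
  finally have "2 * ((LINT x|lebesgue_on \<Omega>. a x) + (LINT x|lebesgue_on \<Omega>. c x)) = 0"
    using int_a int_c by (simp only: integral_mult_right_zero Bochner_Integration.integral_add)
  then have "(LINT x|lebesgue_on \<Omega>. a x) + (LINT x|lebesgue_on \<Omega>. c x) = 0"
    unfolding mult_eq_0_iff by simp
  then have "norm (LINT x|lebesgue_on \<Omega>. a x) = norm (LINT x|lebesgue_on \<Omega>. c x)"
    by (simp add: eq_neg_iff_add_eq_0[symmetric])
  moreover have "(LINT x|lebesgue_on \<Omega>. a x) = complex_of_real (LINT x|lebesgue_on \<Omega>. (norm (E x * p x))\<^sup>2)"
    unfolding a_real by (rule integral_complex_of_real)
  ultimately have "(LINT x|lebesgue_on \<Omega>. (norm (E x * p x))\<^sup>2) = norm (LINT x|lebesgue_on \<Omega>. c x)"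
    by simp
  also have "\<dots> \<le> (LINT x|lebesgue_on \<Omega>. norm (c x))" by (rule integral_norm_bound)
  also have "\<dots> \<le> (LINT x|lebesgue_on \<Omega>. (norm (E x * p x))\<^sup>2 / 2 + (norm (dz i E x * g x))\<^sup>2 / 2)"
  proof (rule integral_mono)
    show "norm (c x) \<le> (norm (E x * p x))\<^sup>2 / 2 + (norm (dz i E x * g x))\<^sup>2 / 2" for x
    proof -
      have "norm (c x) = norm (E x * p x) * norm (dz i E x * g x)" by (simp add: c_def norm_mult)
      moreover have "0 \<le> (norm (E x * p x) - norm (dz i E x * g x))\<^sup>2" by simp
      ultimately show ?thesis unfolding power2_diff by linarith
    qed
  qed (use int1 int2 int_c in auto)
  also have "\<dots> = (LINT x|lebesgue_on \<Omega>. (norm (E x * p x))\<^sup>2) / 2 + (LINT x|lebesgue_on \<Omega>. (norm (dz i E x * g x))\<^sup>2) / 2"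
    using int1 int2 by simp
  finally show "(LINT x|lebesgue_on \<Omega>. (norm (E x * p x))\<^sup>2) \<le> (LINT x|lebesgue_on \<Omega>. (norm (dz i E x * g x))\<^sup>2)"
    by simp
qed

context boundary_weight
begin

lemma norm_wt: "x \<in> \<Omega> \<Longrightarrow> norm (wt x) = \<rho> x"
  using \<rho>_pos[of x] by (simp add: wt_def)

lemma smooth_on_wt: "smooth_on wt \<Omega>"
  using smooth_wt by (rule smooth_upto_boundary_smooth_on)

lemma dz_wt_power: "x \<in> \<Omega> \<Longrightarrow> dz i (\<lambda>x. wt x ^ Suc j) x = of_nat (Suc j) * wt x ^ j * dz i wt x"
proof (induction j)
  case (Suc j)
  have "dz i (\<lambda>x. wt x * wt x ^ Suc j) x = wt x * dz i (\<lambda>x. wt x ^ Suc j) x + dz i wt x * wt x ^ Suc j"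
    using Suc.prems by (intro dz_mult smooth_on_differentiable[of _ \<Omega>] smooth_on_power smooth_on_wt open_dom)
  then show ?case using Suc by (simp add: algebra_simps)
qed simp

definition complex_cutoff :: "nat \<Rightarrow> complex ^ 'n \<Rightarrow> complex" where
  "complex_cutoff n x = complex_of_real (cutoff n x)"

lemma smooth_on_complex_cutoff: "smooth_on (complex_cutoff n) \<Omega>"
  unfolding complex_cutoff_def[abs_def] by (rule smooth_on_linear[OF bounded_linear_of_real open_dom smooth_on_cutoff])

lemma norm_complex_cutoff: "norm (complex_cutoff n x) \<le> 1"
  using cutoff_range[of n x] by (simp add: complex_cutoff_def)

lemma complex_cutoff_0: "x \<notin> interior_part n \<Longrightarrow> complex_cutoff n x = 0"
  by (simp add: complex_cutoff_def cutoff_0)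

lemma complex_cutoff_tendsto: "x \<in> \<Omega> \<Longrightarrow> (\<lambda>n. complex_cutoff n x) \<longlonglongrightarrow> 1"
  using tendsto_of_real[OF cutoff_tendsto] by (simp add: complex_cutoff_def[abs_def])

lemma dz_complex_cutoff: "x \<in> \<Omega> \<Longrightarrow> dz i (complex_cutoff n) x =
    complex_of_real (partial_deriv (axis i 1) (cutoff n) x) - \<i> * complex_of_real (partial_deriv (axis i \<i>) (cutoff n) x)"
  unfolding dz_def complex_cutoff_def[abs_def]
  by (simp add: partial_deriv_linear[OF bounded_linear_of_real smooth_on_differentiable[OF smooth_on_cutoff]])

lemma dz_complex_cutoff_tendsto: "x \<in> \<Omega> \<Longrightarrow> (\<lambda>n. dz i (complex_cutoff n) x) \<longlonglongrightarrow> 0"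
  unfolding dz_complex_cutoff by (auto intro!: tendsto_eq_intros partial_deriv_cutoff_tendsto)

lemma dz_complex_cutoff_bound:
  obtains C where "C > 0" "\<And>n x. x \<in> \<Omega> \<Longrightarrow> norm (dz i (complex_cutoff n) x) * \<rho> x \<le> C"
proof -
  obtain C1 where C1: "C1 > 0" "\<And>n x. x \<in> \<Omega> \<Longrightarrow> \<bar>partial_deriv (axis i 1) (cutoff n) x\<bar> * \<rho> x \<le> C1"
    using partial_deriv_cutoff_bound[OF axis_complex_in_Basis(1)] by metis
  obtain C2 where C2: "C2 > 0" "\<And>n x. x \<in> \<Omega> \<Longrightarrow> \<bar>partial_deriv (axis i \<i>) (cutoff n) x\<bar> * \<rho> x \<le> C2"
    using partial_deriv_cutoff_bound[OF axis_complex_in_Basis(2)] by metis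
  have "norm (dz i (complex_cutoff n) x) * \<rho> x \<le> C1 + C2" if x: "x \<in> \<Omega>" for n x
  proof -
    have "norm (dz i (complex_cutoff n) x) \<le> \<bar>partial_deriv (axis i 1) (cutoff n) x\<bar> + \<bar>partial_deriv (axis i \<i>) (cutoff n) x\<bar>"
      unfolding dz_complex_cutoff[OF x] using norm_triangle_ineq4[of "complex_of_real (partial_deriv (axis i 1) (cutoff n) x)"]
      by (metis (no_types, lifting) norm_ii norm_mult norm_of_real mult_1)
    then have "norm (dz i (complex_cutoff n) x) * \<rho> x \<le> (\<bar>partial_deriv (axis i 1) (cutoff n) x\<bar> + \<bar>partial_deriv (axis i \<i>) (cutoff n) x\<bar>) * \<rho> x"
      using \<rho>_pos[OF x] by (intro mult_right_mono) auto
    then show ?thesis using C1(2)[OF x, of n] C2(2)[OF x, of n] by (simp add: distrib_right)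
  qed
  then show ?thesis using that[of "C1 + C2"] C1 C2 by auto
qed

section \<open>Integration by parts with a weight vanishing on the boundary\<close>

text \<open>
  With a cutoff in front, the integral vanishes because the support is compact. The extra term in
  which the cutoff is differentiated stays bounded, thanks to the factor \<open>wt\<close>, and tends to zero pointwise.
  Dominated convergence removes the cutoff.
\<close>

lemma integral_dz_weighted_zero:
  assumes A: "smooth_upto_boundary \<Omega> A" and u: "conj_holomorphic_sv u \<Omega>" "integrable (lebesgue_on \<Omega>) u"
  shows "(LINT x|lebesgue_on \<Omega>. dz i (\<lambda>x. wt x * A x) x * u x) = 0"
proof -
  define W where "W x = wt x * A x" for x
  have W: "smooth_upto_boundary \<Omega> W" unfolding W_def by (intro smooth_upto_boundary_mult smooth_wt A)
  note sW = smooth_upto_boundary_smooth_on[OF W] and su = conj_holomorphic_sv_smooth[OF open_dom u(1)]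
  obtain M1 where M1: "M1 > 0" "\<And>x. x \<in> \<Omega> \<Longrightarrow> norm (dz i W x) \<le> M1"
    using smooth_upto_boundary_bounded[OF bounded_dom smooth_upto_boundary_dz[OF W, of i]] by metis
  obtain M2 where M2: "M2 > 0" "\<And>x. x \<in> \<Omega> \<Longrightarrow> norm (A x) \<le> M2"
    using smooth_upto_boundary_bounded[OF bounded_dom A] by metis
  obtain C where C: "C > 0" "\<And>n x. x \<in> \<Omega> \<Longrightarrow> norm (dz i (complex_cutoff n) x) * \<rho> x \<le> C"
    using dz_complex_cutoff_bound by metis
  define v where "v n x = complex_cutoff n x * (W x * u x)" for n x
  have sv: "smooth_on (v n) \<Omega>" for n
    unfolding v_def by (intro smooth_on_mult open_dom smooth_on_complex_cutoff sW su)
  have v0: "x \<notin> interior_part n \<Longrightarrow> v n x = 0" for n x by (simp add: v_def complex_cutoff_0)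
  note int_v = integral_dz_zero[OF open_dom sv interior_part_compact_subset v0]
  have dv: "dz i (v n) x = complex_cutoff n x * (dz i W x * u x) + dz i (complex_cutoff n) x * (wt x * A x * u x)" if x: "x \<in> \<Omega>" for n x
  proof -
    note d = smooth_on_differentiable[OF _ x]
    have "dz i (v n) x = complex_cutoff n x * dz i (\<lambda>x. W x * u x) x + dz i (complex_cutoff n) x * (W x * u x)"
      unfolding v_def by (intro dz_mult d smooth_on_mult open_dom smooth_on_complex_cutoff sW su)
    also have "dz i (\<lambda>x. W x * u x) x = W x * dz i u x + dz i W x * u x"
      by (intro dz_mult d sW su)
    finally show ?thesis by (simp add: dz_conj_holomorphic[OF open_dom u(1) x] W_def)
  qed
  have "(\<lambda>n. LINT x|lebesgue_on \<Omega>. dz i (v n) x) \<longlonglongrightarrow> (LINT x|lebesgue_on \<Omega>. dz i W x * u x)"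
  proof (rule integral_dominated_convergence)
    show "(\<lambda>x. dz i W x * u x) \<in> borel_measurable (lebesgue_on \<Omega>)"
      by (intro smooth_on_measurable open_dom smooth_on_mult smooth_on_dz sW su)
    show "dz i (v n) \<in> borel_measurable (lebesgue_on \<Omega>)" for n
      using int_v(1) by (rule borel_measurable_integrable)
    show "integrable (lebesgue_on \<Omega>) (\<lambda>x. (M1 + C * M2) * norm (u x))" using u(2) by simp
    show "AE x in lebesgue_on \<Omega>. (\<lambda>n. dz i (v n) x) \<longlonglongrightarrow> dz i W x * u x"
    proof (rule AE_I2)
      fix x assume "x \<in> space (lebesgue_on \<Omega>)"
      then have x: "x \<in> \<Omega>" by simp
      show "(\<lambda>n. dz i (v n) x) \<longlonglongrightarrow> dz i W x * u x"
        unfolding dv[OF x] by (auto intro!: tendsto_eq_intros complex_cutoff_tendsto dz_complex_cutoff_tendsto x)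
    qed
    show "AE x in lebesgue_on \<Omega>. norm (dz i (v n) x) \<le> (M1 + C * M2) * norm (u x)" for n
    proof (rule AE_I2)
      fix x assume "x \<in> space (lebesgue_on \<Omega>)"
      then have x: "x \<in> \<Omega>" by simp
      have "norm (dz i (v n) x) \<le> norm (complex_cutoff n x) * norm (dz i W x) * norm (u x)
          + (norm (dz i (complex_cutoff n) x) * \<rho> x) * norm (A x) * norm (u x)"
        unfolding dv[OF x] by (rule order_trans[OF norm_triangle_ineq]) (simp add: norm_mult norm_wt[OF x])
      also have "\<dots> \<le> 1 * M1 * norm (u x) + C * M2 * norm (u x)"
        using norm_complex_cutoff[of n x] M1(2)[OF x] M2(2)[OF x] C x M1(1) M2(1) \<rho>_pos[OF x]
        by (intro add_mono mult_right_mono mult_mono) auto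
      finally show "norm (dz i (v n) x) \<le> (M1 + C * M2) * norm (u x)" by (simp add: algebra_simps)
    qed
  qed
  then show ?thesis using int_v(2) by (simp add: LIMSEQ_const_iff W_def[abs_def])
qed

section \<open>Weighted estimates for derivatives\<close>

text \<open>
  The Caccioppoli inequality with \<open>E = complex_cutoff n * wt\<^sup>j\<^sup>+\<^sup>1\<close>. A derivative of \<open>E\<close> is bounded by a multiple
  of \<open>wt\<^sup>j\<close>, uniformly in \<open>n\<close>, so Fatou's lemma yields the estimate without cutoff.
\<close>

lemma weighted_derivative_estimate:
  assumes b: "b \<in> Basis"
  shows "\<exists>C\<ge>0. \<forall>g. conj_holomorphic_sv g \<Omega> \<longrightarrow> (\<lambda>x. wt x ^ j * g x) \<in> L2 \<Omega> \<longrightarrow>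
     (\<lambda>x. wt x ^ Suc j * partial_deriv b g x) \<in> L2 \<Omega> \<and>
     L2_norm \<Omega> (\<lambda>x. wt x ^ Suc j * partial_deriv b g x) \<le> C * L2_norm \<Omega> (\<lambda>x. wt x ^ j * g x)"
proof -
  obtain i c where bc: "b = axis i c" "c \<in> {1, \<i>}" using b by (metis Basis_complex_vec_cases)
  have c1: "norm c = 1" using bc by auto
  obtain M where M: "M > 0" "\<And>x. x \<in> \<Omega> \<Longrightarrow> norm (dz i wt x) \<le> M"
    using smooth_upto_boundary_bounded[OF bounded_dom smooth_upto_boundary_dz[OF smooth_wt, of i]] by metis
  obtain C where C: "C > 0" "\<And>n x. x \<in> \<Omega> \<Longrightarrow> norm (dz i (complex_cutoff n) x) * \<rho> x \<le> C"
    using dz_complex_cutoff_bound by metis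
  define D where "D = Suc j * M + C"
  define E where "E n x = complex_cutoff n x * wt x ^ Suc j" for n x
  have sE: "smooth_on (E n) \<Omega>" for n
    unfolding E_def by (intro smooth_on_mult smooth_on_power open_dom smooth_on_complex_cutoff smooth_on_wt)
  have ER: "E n x \<in> \<real>" for n x by (simp add: E_def complex_cutoff_def wt_def)
  have E0: "x \<notin> interior_part n \<Longrightarrow> E n x = 0" for n x by (simp add: E_def complex_cutoff_0)
  have dE: "norm (dz i (E n) x) \<le> D * norm (wt x ^ j)" if x: "x \<in> \<Omega>" for n x
  proof -
    note d = smooth_on_differentiable[OF _ x]
    have "dz i (E n) x = complex_cutoff n x * dz i (\<lambda>x. wt x ^ Suc j) x + dz i (complex_cutoff n) x * wt x ^ Suc j"
      unfolding E_def by (intro dz_mult d smooth_on_power open_dom smooth_on_complex_cutoff smooth_on_wt)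
    also have "norm \<dots> \<le> norm (complex_cutoff n x) * (Suc j * norm (dz i wt x) * \<rho> x ^ j) + (norm (dz i (complex_cutoff n) x) * \<rho> x) * \<rho> x ^ j"
      unfolding dz_wt_power[OF x]
      by (rule order_trans[OF norm_triangle_ineq]) (simp add: norm_mult norm_power norm_wt[OF x] mult_ac del: of_nat_Suc)
    also have "\<dots> \<le> 1 * (Suc j * M * \<rho> x ^ j) + C * \<rho> x ^ j"
      using norm_complex_cutoff[of n x] M(2)[OF x] C x M(1) \<rho>_pos[OF x]
      by (intro add_mono mult_right_mono mult_mono mult_nonneg_nonneg) auto
    finally show ?thesis by (simp add: D_def norm_power norm_wt[OF x] algebra_simps)
  qed
  have "D \<ge> 0" using M C by (simp add: D_def)
  show ?thesis
  proof (rule exI[of _ D], intro conjI[OF \<open>D \<ge> 0\<close>] allI impI)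
    fix g assume g: "conj_holomorphic_sv g \<Omega>" and L: "(\<lambda>x. wt x ^ j * g x) \<in> L2 \<Omega>"
    define p where "p = partial_deriv (axis i 1) g"
    let ?B = "(D * L2_norm \<Omega> (\<lambda>x. wt x ^ j * g x))\<^sup>2"
    note sb = smooth_on_partial_deriv[OF conj_holomorphic_sv_smooth[OF open_dom g]]
    have sp: "smooth_on p \<Omega>" unfolding p_def by (intro sb axis_complex_in_Basis)
    note cac = caccioppoli_compact_support[OF open_dom g sE ER interior_part_compact_subset E0, where i=i, folded p_def]
    have bound: "(LINT x|lebesgue_on \<Omega>. (norm (E n x * p x))\<^sup>2) \<le> ?B" for n
    proof -
      have "(LINT x|lebesgue_on \<Omega>. (norm (E n x * p x))\<^sup>2) \<le> (LINT x|lebesgue_on \<Omega>. (norm (dz i (E n) x * g x))\<^sup>2)"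
        by (rule cac(2))
      also have "\<dots> \<le> (LINT x|lebesgue_on \<Omega>. D\<^sup>2 * (norm (wt x ^ j * g x))\<^sup>2)"
      proof (rule integral_mono')
        show "integrable (lebesgue_on \<Omega>) (\<lambda>x. D\<^sup>2 * (norm (wt x ^ j * g x))\<^sup>2)"
          using L2_square_integrable[OF L] by simp
        fix x assume "x \<in> space (lebesgue_on \<Omega>)"
        then have "norm (dz i (E n) x * g x) \<le> D * norm (wt x ^ j * g x)"
          using mult_right_mono[OF dE[of x n] norm_ge_zero[of "g x"]] by (simp add: norm_mult mult.assoc)
        from power_mono[OF this, of 2]
        show "(norm (dz i (E n) x * g x))\<^sup>2 \<le> D\<^sup>2 * (norm (wt x ^ j * g x))\<^sup>2"
          by (simp add: power_mult_distrib)
      qed simp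
      also have "\<dots> = ?B" by (simp add: power_mult_distrib L2_norm_square)
      finally show ?thesis .
    qed
    have lim: "(\<lambda>n. (norm (E n x * p x))\<^sup>2) \<longlonglongrightarrow> (norm (wt x ^ Suc j * p x))\<^sup>2" if "x \<in> \<Omega>" for x
      unfolding E_def
      by (rule tendsto_power, rule tendsto_norm, rule tendsto_mult[OF _ tendsto_const])
        (use tendsto_mult[OF complex_cutoff_tendsto[OF that] tendsto_const[of "wt x ^ Suc j"]] in simp)
    have meas: "(\<lambda>x. wt x ^ Suc j * f x) \<in> borel_measurable (lebesgue_on \<Omega>)" if "smooth_on f \<Omega>" for f
      by (intro smooth_on_measurable open_dom smooth_on_mult smooth_on_power smooth_on_wt that)
    \<comment> \<open>Both real derivatives in the \<open>i\<close>-th complex coordinate have the same modulus.\<close>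
    have eq: "norm (partial_deriv b g x) = norm (p x)" if "x \<in> \<Omega>" for x
      using conj_holomorphic_sv_partial_deriv_axis[OF open_dom g that, of i c] c1 by (simp add: bc p_def norm_mult)
    have "integrable (lebesgue_on \<Omega>) (\<lambda>x. (norm (wt x ^ Suc j * p x))\<^sup>2) \<and>
        (LINT x|lebesgue_on \<Omega>. (norm (wt x ^ Suc j * p x))\<^sup>2) \<le> ?B"
    proof (intro conjI)
      note * = integral_le_pointwise_limit[where f="\<lambda>n x. (norm (E n x * p x))\<^sup>2" and B="?B" and M="lebesgue_on \<Omega>"
          and g="\<lambda>x. (norm (wt x ^ Suc j * p x))\<^sup>2", OF cac(1) _ bound]
      have m: "(\<lambda>x. (norm (wt x ^ Suc j * p x))\<^sup>2) \<in> borel_measurable (lebesgue_on \<Omega>)"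
        using meas[OF sp] by measurable
      show "integrable (lebesgue_on \<Omega>) (\<lambda>x. (norm (wt x ^ Suc j * p x))\<^sup>2)" by (rule *(1)) (use m lim in auto)
      show "(LINT x|lebesgue_on \<Omega>. (norm (wt x ^ Suc j * p x))\<^sup>2) \<le> ?B" by (rule *(2)) (use m lim in auto)
    qed
    note res = this
    have mem: "(\<lambda>x. wt x ^ Suc j * partial_deriv b g x) \<in> L2 \<Omega>"
      by (rule L2I_bound[OF meas[OF sb[OF b]], of "\<lambda>x. (norm (wt x ^ Suc j * p x))\<^sup>2"])
        (use res eq in \<open>auto simp: norm_mult\<close>)
    moreover have "L2_norm \<Omega> (\<lambda>x. wt x ^ Suc j * partial_deriv b g x) \<le> D * L2_norm \<Omega> (\<lambda>x. wt x ^ j * g x)"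
      by (rule L2_norm_leI[OF mem, of "\<lambda>x. (norm (wt x ^ Suc j * p x))\<^sup>2"])
        (use res eq \<open>D \<ge> 0\<close> in \<open>auto simp: norm_mult L2_norm_nonneg intro!: mult_nonneg_nonneg\<close>)
    ultimately show "(\<lambda>x. wt x ^ Suc j * partial_deriv b g x) \<in> L2 \<Omega> \<and>
     L2_norm \<Omega> (\<lambda>x. wt x ^ Suc j * partial_deriv b g x) \<le> D * L2_norm \<Omega> (\<lambda>x. wt x ^ j * g x)" by blast
  qed
qed

end

lemma fold_partial_deriv_cong:
  assumes "open U" "\<And>x. x \<in> U \<Longrightarrow> f x = g x" "x \<in> U"
  shows "fold partial_deriv L f x = fold partial_deriv L g x"
  using assms(2,3)
proof (induction L arbitrary: f g)
  case (Cons b L)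
  show ?case
    unfolding fold_simps using partial_deriv_cong_open[OF assms(1) _ Cons.prems(1)] Cons.prems(2) by (intro Cons.IH)
qed simp

lemma fold_partial_deriv_add:
  assumes "open U" "smooth_on f U" "smooth_on g U" "set L \<subseteq> Basis" "x \<in> U"
  shows "fold partial_deriv L (\<lambda>x. f x + g x) x = fold partial_deriv L f x + fold partial_deriv L g x"
  using assms(2-4)
proof (induction L arbitrary: f g)
  case (Cons b L)
  have "fold partial_deriv L (partial_deriv b (\<lambda>x. f x + g x)) x
      = fold partial_deriv L (\<lambda>x. partial_deriv b f x + partial_deriv b g x) x"
    using Cons.prems smooth_on_differentiable by (intro fold_partial_deriv_cong[OF assms(1) _ assms(5)] partial_deriv_add) blast+
  also have "\<dots> = fold partial_deriv L (partial_deriv b f) x + fold partial_deriv L (partial_deriv b g) x"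
    using Cons.prems by (intro Cons.IH smooth_on_partial_deriv) auto
  finally show ?case by simp
qed simp

context boundary_weight
begin

lemma partial_deriv_wt_power: "x \<in> \<Omega> \<Longrightarrow> partial_deriv b (\<lambda>x. wt x ^ Suc j) x = of_nat (Suc j) * wt x ^ j * partial_deriv b wt x"
proof (induction j)
  case (Suc j)
  have "partial_deriv b (\<lambda>x. wt x * wt x ^ Suc j) x = wt x * partial_deriv b (\<lambda>x. wt x ^ Suc j) x + partial_deriv b wt x * wt x ^ Suc j"
    using Suc.prems by (intro partial_deriv_mult smooth_on_differentiable[of _ \<Omega>] smooth_on_power smooth_on_wt open_dom)
  then show ?case using Suc by (simp add: algebra_simps)
qed simp

text \<open>
  One derivative of \<open>wt\<^sup>m\<^sup>+\<^sup>j a g\<close> either falls on \<open>wt\<^sup>m\<^sup>+\<^sup>j a\<close> and uses up a power of the weight, or it falls on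
  \<open>g\<close>. Then \<open>g\<close> is replaced by the conjugate holomorphic \<open>\<partial>g\<close>, and one of the \<open>m\<close> spare powers moves into the
  weight \<open>j + 1\<close> with which \<open>\<partial>g\<close> is controlled. Both terms have the original form with \<open>m - 1\<close> for \<open>m\<close>.
\<close>

lemma weighted_iterated_estimate:
  assumes "smooth_upto_boundary \<Omega> a" "set L \<subseteq> Basis" "length L \<le> m"
  shows "\<exists>C\<ge>0. \<forall>g. conj_holomorphic_sv g \<Omega> \<longrightarrow> (\<lambda>x. wt x ^ j * g x) \<in> L2 \<Omega> \<longrightarrow>
     fold partial_deriv L (\<lambda>x. wt x ^ (m + j) * a x * g x) \<in> L2 \<Omega> \<and>
     L2_norm \<Omega> (fold partial_deriv L (\<lambda>x. wt x ^ (m + j) * a x * g x)) \<le> C * L2_norm \<Omega> (\<lambda>x. wt x ^ j * g x)"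
  using assms
proof (induction L arbitrary: m j a)
  case Nil
  have sub: "smooth_upto_boundary \<Omega> (\<lambda>x. wt x ^ m * a x)"
    by (intro smooth_upto_boundary_mult smooth_upto_boundary_power smooth_wt Nil)
  obtain M where M: "M > 0" "\<And>x. x \<in> \<Omega> \<Longrightarrow> norm (wt x ^ m * a x) \<le> M"
    using smooth_upto_boundary_bounded[OF bounded_dom sub] by metis
  have meas: "(\<lambda>x. wt x ^ m * a x) \<in> borel_measurable (lebesgue_on \<Omega>)"
    by (intro smooth_on_measurable open_dom smooth_upto_boundary_smooth_on sub)
  have eq: "(\<lambda>x. wt x ^ (m + j) * a x * g x) = (\<lambda>x. wt x ^ m * a x * (wt x ^ j * g x))" for g
    by (simp add: power_add mult_ac)
  show ?case
    using L2_bounded_mult[OF _ meas M(2)] L2_norm_bounded_mult[OF _ meas M(2)] M(1)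
    by (intro exI[of _ M]) (auto simp: eq)
next
  case (Cons b L)
  then obtain m' where m: "m = Suc m'" "length L \<le> m'" by (cases m) auto
  have b: "b \<in> Basis" and L: "set L \<subseteq> Basis" using Cons.prems by auto
  define a' where "a' x = of_nat (Suc (m' + j)) * partial_deriv b wt x * a x + wt x * partial_deriv b a x" for x
  have a': "smooth_upto_boundary \<Omega> a'"
    unfolding a'_def using Cons.prems(1) b
    by (intro smooth_upto_boundary_add smooth_upto_boundary_mult smooth_upto_boundary_partial_deriv smooth_wt smooth_upto_boundary_const)
  obtain C1 where C1: "C1 \<ge> 0" "\<And>g. conj_holomorphic_sv g \<Omega> \<Longrightarrow> (\<lambda>x. wt x ^ j * g x) \<in> L2 \<Omega> \<Longrightarrow>
     fold partial_deriv L (\<lambda>x. wt x ^ (m' + j) * a' x * g x) \<in> L2 \<Omega> \<and>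
     L2_norm \<Omega> (fold partial_deriv L (\<lambda>x. wt x ^ (m' + j) * a' x * g x)) \<le> C1 * L2_norm \<Omega> (\<lambda>x. wt x ^ j * g x)"
    using Cons.IH[OF a' L m(2), of j] by auto
  obtain C2 where C2: "C2 \<ge> 0" "\<And>g. conj_holomorphic_sv g \<Omega> \<Longrightarrow> (\<lambda>x. wt x ^ Suc j * g x) \<in> L2 \<Omega> \<Longrightarrow>
     fold partial_deriv L (\<lambda>x. wt x ^ (m' + Suc j) * a x * g x) \<in> L2 \<Omega> \<and>
     L2_norm \<Omega> (fold partial_deriv L (\<lambda>x. wt x ^ (m' + Suc j) * a x * g x)) \<le> C2 * L2_norm \<Omega> (\<lambda>x. wt x ^ Suc j * g x)"
    using Cons.IH[OF Cons.prems(1) L m(2), of "Suc j"] by auto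
  obtain C3 where C3: "C3 \<ge> 0" "\<And>g. conj_holomorphic_sv g \<Omega> \<Longrightarrow> (\<lambda>x. wt x ^ j * g x) \<in> L2 \<Omega> \<Longrightarrow>
     (\<lambda>x. wt x ^ Suc j * partial_deriv b g x) \<in> L2 \<Omega> \<and>
     L2_norm \<Omega> (\<lambda>x. wt x ^ Suc j * partial_deriv b g x) \<le> C3 * L2_norm \<Omega> (\<lambda>x. wt x ^ j * g x)"
    using weighted_derivative_estimate[OF b, of j] by auto
  note sa = smooth_upto_boundary_smooth_on[OF Cons.prems(1)]
  show ?case
  proof (intro exI[of _ "2 * (C1 + C2 * C3)"] conjI allI impI)
    show "0 \<le> 2 * (C1 + C2 * C3)" using C1 C2 C3 by simp
    fix g assume g: "conj_holomorphic_sv g \<Omega>" "(\<lambda>x. wt x ^ j * g x) \<in> L2 \<Omega>"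
    let ?N = "L2_norm \<Omega> (\<lambda>x. wt x ^ j * g x)"
    define f1 where "f1 x = wt x ^ (m' + j) * a' x * g x" for x
    define f2 where "f2 x = wt x ^ (m' + Suc j) * a x * partial_deriv b g x" for x
    note sg = conj_holomorphic_sv_smooth[OF open_dom g(1)]
    have s1: "smooth_on f1 \<Omega>" unfolding f1_def
      by (intro smooth_on_mult smooth_on_power open_dom smooth_on_wt sg smooth_upto_boundary_smooth_on[OF a'])
    have s2: "smooth_on f2 \<Omega>" unfolding f2_def
      by (intro smooth_on_mult smooth_on_power open_dom smooth_on_wt sa smooth_on_partial_deriv sg b)
    have dg: "conj_holomorphic_sv (partial_deriv b g) \<Omega>" by (intro conj_holomorphic_sv_partial_deriv open_dom g b)
    note e1 = C1(2)[OF g, folded f1_def] and e3 = C3(2)[OF g]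
    note e2 = C2(2)[OF dg e3[THEN conjunct1], folded f2_def]
    have "partial_deriv b (\<lambda>x. wt x ^ (m + j) * a x * g x) x = f1 x + f2 x" if x: "x \<in> \<Omega>" for x
    proof -
      note d = smooth_on_differentiable[OF _ x]
      have "partial_deriv b (\<lambda>x. wt x ^ Suc (m' + j) * a x * g x) x =
          wt x ^ Suc (m' + j) * a x * partial_deriv b g x + partial_deriv b (\<lambda>x. wt x ^ Suc (m' + j) * a x) x * g x"
        by (intro partial_deriv_mult d smooth_on_mult smooth_on_power open_dom smooth_on_wt sg sa)
      also have "partial_deriv b (\<lambda>x. wt x ^ Suc (m' + j) * a x) x =
          wt x ^ Suc (m' + j) * partial_deriv b a x + partial_deriv b (\<lambda>x. wt x ^ Suc (m' + j)) x * a x"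
        by (intro partial_deriv_mult d smooth_on_power open_dom smooth_on_wt sa)
      finally show ?thesis
        unfolding partial_deriv_wt_power[OF x] f1_def f2_def a'_def by (simp add: m algebra_simps)
    qed
    then have eq: "fold partial_deriv (b # L) (\<lambda>x. wt x ^ (m + j) * a x * g x) x
        = fold partial_deriv L f1 x + fold partial_deriv L f2 x" if "x \<in> \<Omega>" for x
      unfolding fold_simps fold_partial_deriv_add[OF open_dom s1 s2 L that, symmetric]
      using that by (intro fold_partial_deriv_cong[OF open_dom])
    show "fold partial_deriv (b # L) (\<lambda>x. wt x ^ (m + j) * a x * g x) \<in> L2 \<Omega>"
      by (rule L2_cong(1)[OF eq, THEN iffD2], assumption, rule L2_add) (use e1 e2 in auto)
    have "L2_norm \<Omega> (\<lambda>x. fold partial_deriv L f1 x + fold partial_deriv L f2 x) \<le>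
        2 * (L2_norm \<Omega> (fold partial_deriv L f1) + L2_norm \<Omega> (fold partial_deriv L f2))"
      using e1 e2 by (intro L2_norm_add_le) auto
    also have "L2_norm \<Omega> (\<lambda>x. fold partial_deriv L f1 x + fold partial_deriv L f2 x)
        = L2_norm \<Omega> (fold partial_deriv (b # L) (\<lambda>x. wt x ^ (m + j) * a x * g x))"
      by (rule L2_cong(2)[OF eq, symmetric])
    also have "2 * (L2_norm \<Omega> (fold partial_deriv L f1) + L2_norm \<Omega> (fold partial_deriv L f2))
        \<le> 2 * (C1 * ?N + C2 * (C3 * ?N))"
    proof (intro mult_left_mono add_mono)
      show "L2_norm \<Omega> (fold partial_deriv L f1) \<le> C1 * ?N" using e1 by blast
      have "L2_norm \<Omega> (fold partial_deriv L f2) \<le> C2 * L2_norm \<Omega> (\<lambda>x. wt x ^ Suc j * partial_deriv b g x)"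
        using e2 by blast
      also have "\<dots> \<le> C2 * (C3 * ?N)" using e3 C2(1) by (intro mult_left_mono) auto
      finally show "L2_norm \<Omega> (fold partial_deriv L f2) \<le> C2 * (C3 * ?N)" .
    qed simp
    finally show "L2_norm \<Omega> (fold partial_deriv (b # L) (\<lambda>x. wt x ^ (m + j) * a x * g x)) \<le> 2 * (C1 + C2 * C3) * ?N"
      by (simp add: algebra_simps)
  qed
qed

section \<open>Replacing a function by one that vanishes on the boundary\<close>

text \<open>
  In the step from \<open>m\<close> to \<open>m + 1\<close>, the function \<open>N\<close>, the squared gradient of \<open>\<rho>\<close> plus \<open>\<rho>\<^sup>2\<close>, has no zero
  on the closure: \<open>\<rho>\<close> is positive inside and the gradient is nonzero on the boundary. Dividing by \<open>N\<close> splits \<open>1\<close> into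
  a part with the factor \<open>\<Sum>\<^sub>i \<bar>dz i wt\<bar>\<^sup>2\<close> and a part with the factor \<open>wt\<^sup>2\<close>. The
  latter already has the required divisibility. In the former, \<open>wt\<^sup>m (dz i wt)\<close> is the derivative of
  \<open>wt\<^sup>m\<^sup>+\<^sup>1 / (m + 1)\<close>, and integration by parts moves that derivative onto the smooth coefficient.
\<close>

lemma weighted_integral_identity:
  assumes grad: "\<And>x. x \<in> frontier \<Omega> \<Longrightarrow> \<exists>b\<in>Basis. partial_deriv b \<rho> x \<noteq> 0"
  shows "\<exists>a. smooth_upto_boundary \<Omega> a \<and> (\<forall>u. conj_holomorphic_sv u \<Omega> \<longrightarrow> integrable (lebesgue_on \<Omega>) u \<longrightarrow>
     (LINT x|lebesgue_on \<Omega>. u x) = (LINT x|lebesgue_on \<Omega>. wt x ^ m * a x * u x))"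
proof (induction m)
  case 0
  show ?case by (intro exI[of _ "\<lambda>_. 1"]) simp
next
  case (Suc m)
  then obtain a where a: "smooth_upto_boundary \<Omega> a" and
    IH: "\<And>u. conj_holomorphic_sv u \<Omega> \<Longrightarrow> integrable (lebesgue_on \<Omega>) u \<Longrightarrow>
     (LINT x|lebesgue_on \<Omega>. u x) = (LINT x|lebesgue_on \<Omega>. wt x ^ m * a x * u x)" by auto
  define G :: "complex ^ 'n \<Rightarrow> real" where
    "G x = (\<Sum>i\<in>UNIV. (partial_deriv (axis i 1) \<rho> x)\<^sup>2 + (partial_deriv (axis i \<i>) \<rho> x)\<^sup>2)" for x
  define N where "N x = G x + (\<rho> x)\<^sup>2" for x
  have G0: "0 \<le> G x" for x unfolding G_def by (intro sum_nonneg add_nonneg_nonneg) auto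
  have sN: "smooth_on N UNIV"
    unfolding N_def G_def
    by (intro smooth_on_add smooth_on_sum smooth_on_power smooth_on_partial_deriv smooth_\<rho> axis_complex_in_Basis open_UNIV)
  have N0: "N x \<noteq> 0" if "x \<in> closure \<Omega>" for x
  proof (cases "x \<in> \<Omega>")
    case True
    then have "0 < (\<rho> x)\<^sup>2" using \<rho>_pos[OF True] by simp
    then show ?thesis using G0[of x] unfolding N_def by linarith
  next
    case False
    then have "x \<in> frontier \<Omega>" using that open_dom by (simp add: frontier_def interior_open)
    then obtain b where "b \<in> Basis" "partial_deriv b \<rho> x \<noteq> 0" using grad by blast
    then obtain i c where "partial_deriv (axis i c) \<rho> x \<noteq> 0" "c \<in> {1, \<i>}"
      by (metis Basis_complex_vec_cases)
    then have "0 < (partial_deriv (axis i 1) \<rho> x)\<^sup>2 + (partial_deriv (axis i \<i>) \<rho> x)\<^sup>2"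
      by (auto intro: add_pos_nonneg add_nonneg_pos)
    then have "0 < G x" unfolding G_def by (intro sum_pos2[of _ i]) auto
    then show ?thesis using zero_le_power2[of "\<rho> x"] unfolding N_def by linarith
  qed
  define V where "V = {x. N x \<noteq> 0}"
  have V: "open V" "closure \<Omega> \<subseteq> V"
    using smooth_on_continuous[OF sN] N0 by (auto simp: V_def intro!: open_Collect_neq continuous_on_const)
  define J where "J x = complex_of_real (inverse (N x))" for x
  have J: "smooth_upto_boundary \<Omega> J"
    unfolding J_def
    by (intro smooth_upto_boundary_linear[OF bounded_linear_of_real] smooth_upto_boundaryI[OF V]
        smooth_on_inverse smooth_on_subset[OF sN] V(1)) (auto simp: V_def)
  have dzw: "dz i wt x = complex_of_real (partial_deriv (axis i 1) \<rho> x) - \<i> * complex_of_real (partial_deriv (axis i \<i>) \<rho> x)" for i x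
    by (simp add: dz_def partial_deriv_wt)
  have G_eq: "complex_of_real (G x) = (\<Sum>i\<in>UNIV. cnj (dz i wt x) * dz i wt x)" for x
    unfolding G_def of_real_sum by (intro sum.cong) (simp_all add: dzw power2_eq_square algebra_simps)
  have partition: "1 = (\<Sum>i\<in>UNIV. cnj (dz i wt x) * dz i wt x * J x) + wt x ^ 2 * J x" if "x \<in> \<Omega>" for x
  proof -
    have "N x \<noteq> 0" using N0 that closure_subset by blast
    then have "1 = complex_of_real (N x) * J x" by (simp add: J_def)
    also have "complex_of_real (N x) = complex_of_real (G x) + wt x ^ 2" by (simp add: N_def wt_def)
    finally show ?thesis by (simp add: G_eq distrib_right sum_distrib_right)
  qed
  define A where "A i x = cnj (dz i wt x) * J x * a x" for i x
  have A: "smooth_upto_boundary \<Omega> (A i)" for i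
    unfolding A_def
    by (intro smooth_upto_boundary_mult J a smooth_upto_boundary_linear[OF bounded_linear_cnj] smooth_upto_boundary_dz smooth_wt)
  define k where "k = inverse (of_nat (Suc m) :: complex)"
  have k: "k * of_nat (Suc m) = 1" unfolding k_def by (simp del: of_nat_Suc)
  define a' where "a' x = wt x * J x * a x - k * (\<Sum>i\<in>UNIV. dz i (A i) x)" for x
  have a': "smooth_upto_boundary \<Omega> a'"
    unfolding a'_def
    by (intro smooth_upto_boundary_diff smooth_upto_boundary_mult smooth_upto_boundary_sum smooth_upto_boundary_const
        J a smooth_wt smooth_upto_boundary_dz A)
  show ?case
  proof (intro exI[of _ a'] conjI allI impI a')
    fix u assume u: "conj_holomorphic_sv u \<Omega>" "integrable (lebesgue_on \<Omega>) u"
    have int: "integrable (lebesgue_on \<Omega>) (\<lambda>x. f x * u x)" if f: "smooth_upto_boundary \<Omega> f" for f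
    proof -
      obtain M where M: "M > 0" "\<And>x. x \<in> \<Omega> \<Longrightarrow> norm (f x) \<le> M"
        using smooth_upto_boundary_bounded[OF bounded_dom f] by metis
      have [measurable]: "f \<in> borel_measurable (lebesgue_on \<Omega>)"
        by (intro smooth_on_measurable open_dom smooth_upto_boundary_smooth_on f)
      have [measurable]: "u \<in> borel_measurable (lebesgue_on \<Omega>)" using u(2) by auto
      show ?thesis
      proof (rule Bochner_Integration.integrable_bound)
        show "integrable (lebesgue_on \<Omega>) (\<lambda>x. M * norm (u x))" using u(2) by simp
        show "AE x in lebesgue_on \<Omega>. norm (f x * u x) \<le> norm (M * norm (u x))"
          using M by (intro AE_I2) (auto simp: norm_mult intro!: mult_right_mono)
      qed measurable
    qed
    define F where "F i x = dz i (\<lambda>x. wt x * (wt x ^ m * A i x)) x" for i x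
    have sF: "smooth_upto_boundary \<Omega> (F i)" for i
      unfolding F_def by (intro smooth_upto_boundary_dz smooth_upto_boundary_mult smooth_upto_boundary_power smooth_wt A)
    have F0: "(LINT x|lebesgue_on \<Omega>. F i x * u x) = 0" for i
      unfolding F_def
      by (intro integral_dz_weighted_zero u smooth_upto_boundary_mult smooth_upto_boundary_power smooth_wt A)
    have F_eq: "F i x = of_nat (Suc m) * wt x ^ m * dz i wt x * A i x + wt x ^ Suc m * dz i (A i) x" if x: "x \<in> \<Omega>" for i x
    proof -
      have "F i x = dz i (\<lambda>x. wt x ^ Suc m * A i x) x" by (simp add: F_def mult.assoc)
      also have "\<dots> = wt x ^ Suc m * dz i (A i) x + dz i (\<lambda>x. wt x ^ Suc m) x * A i x"
        by (intro dz_mult smooth_on_differentiable[OF _ x] smooth_on_power open_dom smooth_on_wt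
            smooth_upto_boundary_smooth_on[OF A])
      finally show ?thesis unfolding dz_wt_power[OF x] by simp
    qed
    have pointwise: "wt x ^ m * a x = k * (\<Sum>i\<in>UNIV. F i x) + wt x ^ Suc m * a' x" if x: "x \<in> \<Omega>" for x
    proof -
      have "wt x ^ m * a x = wt x ^ m * a x * ((\<Sum>i\<in>UNIV. cnj (dz i wt x) * dz i wt x * J x) + wt x ^ 2 * J x)"
        using partition[OF x] by simp
      also have "\<dots> = (\<Sum>i\<in>UNIV. wt x ^ m * dz i wt x * A i x) + wt x ^ Suc m * (wt x * J x * a x)"
        by (simp add: A_def distrib_left sum_distrib_left sum_distrib_right power2_eq_square mult_ac)
      also have "(\<Sum>i\<in>UNIV. wt x ^ m * dz i wt x * A i x) = k * (\<Sum>i\<in>UNIV. F i x) - wt x ^ Suc m * (k * (\<Sum>i\<in>UNIV. dz i (A i) x))"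
      proof -
        have "k * F i x = wt x ^ m * dz i wt x * A i x + wt x ^ Suc m * (k * dz i (A i) x)" for i
        proof -
          have "k * F i x = (k * of_nat (Suc m)) * (wt x ^ m * dz i wt x * A i x) + wt x ^ Suc m * (k * dz i (A i) x)"
            unfolding F_eq[OF x] by (simp only: distrib_left mult_ac)
          then show ?thesis by (simp only: k mult_1)
        qed
        then have "k * (\<Sum>i\<in>UNIV. F i x) = (\<Sum>i\<in>UNIV. wt x ^ m * dz i wt x * A i x) + wt x ^ Suc m * (k * (\<Sum>i\<in>UNIV. dz i (A i) x))"
          by (simp only: sum_distrib_left sum.distrib)
        then show ?thesis by simp
      qed
      finally show ?thesis by (simp add: a'_def right_diff_distrib)
    qed
    have "(LINT x|lebesgue_on \<Omega>. u x) = (LINT x|lebesgue_on \<Omega>. wt x ^ m * a x * u x)" by (rule IH[OF u])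
    also have "\<dots> = (LINT x|lebesgue_on \<Omega>. k * (\<Sum>i\<in>UNIV. F i x * u x) + wt x ^ Suc m * a' x * u x)"
      by (intro Bochner_Integration.integral_cong) (simp_all add: pointwise distrib_right sum_distrib_right mult.assoc del: power_Suc)
    also have "\<dots> = (LINT x|lebesgue_on \<Omega>. k * (\<Sum>i\<in>UNIV. F i x * u x)) + (LINT x|lebesgue_on \<Omega>. wt x ^ Suc m * a' x * u x)"
      by (intro Bochner_Integration.integral_add integrable_mult_right Bochner_Integration.integrable_sum int sF
          smooth_upto_boundary_mult smooth_upto_boundary_power smooth_wt a')
    also have "(LINT x|lebesgue_on \<Omega>. k * (\<Sum>i\<in>UNIV. F i x * u x)) = 0"
      using int[OF sF] F0 by (simp add: Bochner_Integration.integral_sum)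
    finally show "(LINT x|lebesgue_on \<Omega>. u x) = (LINT x|lebesgue_on \<Omega>. wt x ^ Suc m * a' x * u x)" by simp
  qed
qed

text \<open>
  Membership in the Bergman space and orthogonality to it are tested by the same conditions for \<open>f\<close> and for \<open>a f\<close>,
  because the functions \<open>f * cnj h\<close> are conjugate holomorphic and integrable. So the two descriptions that
  define the projections are equivalent.
\<close>

lemma bergman_proj_weight:
  assumes a: "smooth_upto_boundary \<Omega> a" and
    id: "\<And>u. conj_holomorphic_sv u \<Omega> \<Longrightarrow> integrable (lebesgue_on \<Omega>) u \<Longrightarrow>
     (LINT x|lebesgue_on \<Omega>. u x) = (LINT x|lebesgue_on \<Omega>. a x * u x)"
    and f: "f \<in> L2 \<Omega>" "conj_holomorphic_sv f \<Omega>"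
  shows "bergman_proj \<Omega> f = bergman_proj \<Omega> (\<lambda>x. a x * f x)"
proof -
  obtain M where M: "M > 0" "\<And>x. x \<in> \<Omega> \<Longrightarrow> norm (a x) \<le> M"
    using smooth_upto_boundary_bounded[OF bounded_dom a] by metis
  have af: "(\<lambda>x. a x * f x) \<in> L2 \<Omega>"
    by (rule L2_bounded_mult[OF f(1) _ M(2)])
      (intro smooth_on_measurable open_dom smooth_upto_boundary_smooth_on a)
  have "L2_inner \<Omega> (\<lambda>z. f z - g z) h = L2_inner \<Omega> (\<lambda>z. a z * f z - g z) h"
    if g: "g \<in> bergman_space \<Omega>" and h: "h \<in> bergman_space \<Omega>" for g h
  proof -
    have h': "h \<in> L2 \<Omega>" "holomorphic_sv h \<Omega>" and g': "g \<in> L2 \<Omega>" using g h by (auto simp: bergman_space_def)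
    have "(LINT x|lebesgue_on \<Omega>. f x * cnj (h x)) = (LINT x|lebesgue_on \<Omega>. a x * (f x * cnj (h x)))"
      by (rule id[OF conj_holomorphic_sv_mult_cnj[OF f(2) h'(2)] L2_mult_integrable[OF f(1) h'(1)]])
    then show ?thesis
      using L2_mult_integrable[OF f(1) h'(1)] L2_mult_integrable[OF af h'(1)] L2_mult_integrable[OF g' h'(1)]
      by (simp add: L2_inner_def left_diff_distrib mult.assoc)
  qed
  then show ?thesis unfolding bergman_proj_def by (intro arg_cong[where f=The] ext) auto
qed

end

theorem theorem1p10:
  fixes \<Omega> :: "(complex ^ 'n) set" and k1 k2 :: nat and C1 :: real
  assumes "smoothly_bounded_domain \<Omega>"
    and "k1 \<ge> 1" and "k2 \<ge> 1" and "C1 > 0"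
    and "\<forall>f \<in> sobolev k1 \<Omega>. bergman_proj \<Omega> f \<in> sobolev k2 \<Omega> \<and>
           sobolev_norm k2 \<Omega> (bergman_proj \<Omega> f) \<le> C1 * sobolev_norm k1 \<Omega> f"
  shows "\<exists>C > 0. \<forall>f \<in> L2 \<Omega>. conj_holomorphic_sv f \<Omega> \<longrightarrow>
           bergman_proj \<Omega> f \<in> sobolev k2 \<Omega> \<and>
           sobolev_norm k2 \<Omega> (bergman_proj \<Omega> f) \<le> C * L2_norm \<Omega> f"
proof -
  have \<Omega>: "open \<Omega>" "bounded \<Omega>" using assms(1) by (auto simp: smoothly_bounded_domain_def)
  obtain \<rho> :: "complex ^ 'n \<Rightarrow> real" where \<rho>: "smooth_on \<rho> UNIV" "\<And>x. x \<in> \<Omega> \<Longrightarrow> \<rho> x > 0"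
    "\<And>x. x \<in> frontier \<Omega> \<Longrightarrow> \<rho> x = 0"
    "\<And>x. x \<in> frontier \<Omega> \<Longrightarrow> \<exists>b\<in>Basis. partial_deriv b \<rho> x \<noteq> 0"
    using global_defining_function[OF assms(1)] by metis
  interpret boundary_weight \<Omega> \<rho>
    by (intro boundary_weight.intro \<Omega> \<rho>(1-3))
  obtain a where a: "smooth_upto_boundary \<Omega> a" and id: "\<And>u. conj_holomorphic_sv u \<Omega> \<Longrightarrow> integrable (lebesgue_on \<Omega>) u \<Longrightarrow>
     (LINT x|lebesgue_on \<Omega>. u x) = (LINT x|lebesgue_on \<Omega>. wt x ^ k1 * a x * u x)"
    using weighted_integral_identity[OF \<rho>(4), of k1] by auto
  have wa: "smooth_upto_boundary \<Omega> (\<lambda>x. wt x ^ k1 * a x)"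
    by (intro smooth_upto_boundary_mult smooth_upto_boundary_power smooth_wt a)
  let ?Ls = "{L :: (complex ^ 'n) list. set L \<subseteq> Basis \<and> length L \<le> k1}"
  have "finite ?Ls" by (intro finite_lists_length_le) simp
  have "\<forall>L\<in>?Ls. \<exists>C. C \<ge> 0 \<and> (\<forall>f. conj_holomorphic_sv f \<Omega> \<longrightarrow> f \<in> L2 \<Omega> \<longrightarrow>
     fold partial_deriv L (\<lambda>x. wt x ^ k1 * a x * f x) \<in> L2 \<Omega> \<and>
     L2_norm \<Omega> (fold partial_deriv L (\<lambda>x. wt x ^ k1 * a x * f x)) \<le> C * L2_norm \<Omega> f)"
    using weighted_iterated_estimate[OF a, of _ k1 0] by simp
  from bchoice[OF this] obtain c where
    c: "\<forall>L\<in>?Ls. c L \<ge> 0 \<and> (\<forall>f. conj_holomorphic_sv f \<Omega> \<longrightarrow> f \<in> L2 \<Omega> \<longrightarrow>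
     fold partial_deriv L (\<lambda>x. wt x ^ k1 * a x * f x) \<in> L2 \<Omega> \<and>
     L2_norm \<Omega> (fold partial_deriv L (\<lambda>x. wt x ^ k1 * a x * f x)) \<le> c L * L2_norm \<Omega> f)"
    by (rule exE)
  define S where "S = sum c ?Ls"
  have cS: "c L \<le> S" if "L \<in> ?Ls" for L
    unfolding S_def using \<open>finite ?Ls\<close> c that by (intro member_le_sum) auto
  have S0: "S \<ge> 0" unfolding S_def using c by (intro sum_nonneg) blast
  define D where "D = sqrt (card (multi_indices k1 :: (complex ^ 'n \<Rightarrow> nat) set))"
  have D0: "D \<ge> 0" by (simp add: D_def)
  show ?thesis
  proof (intro exI[of _ "C1 * (D * S) + 1"] conjI ballI impI)
    show "0 < C1 * (D * S) + 1" using assms(4) S0 D0 by (simp add: add_nonneg_pos)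
    fix f assume f: "f \<in> L2 \<Omega>" "conj_holomorphic_sv f \<Omega>"
    define u where "u x = wt x ^ k1 * a x * f x" for x
    have su: "smooth_on u \<Omega>" unfolding u_def
      by (intro smooth_on_mult open_dom smooth_upto_boundary_smooth_on[OF wa, THEN smooth_on_mult[OF open_dom]]
          conj_holomorphic_sv_smooth f)
    have bd: "fold partial_deriv L u \<in> L2 \<Omega> \<and> L2_norm \<Omega> (fold partial_deriv L u) \<le> S * L2_norm \<Omega> f"
      if "set L \<subseteq> Basis" "length L \<le> k1" for L
    proof -
      have "c L * L2_norm \<Omega> f \<le> S * L2_norm \<Omega> f" using that by (intro mult_right_mono cS L2_norm_nonneg) auto
      then show ?thesis unfolding u_def using c[rule_format, of L] f that by force
    qed
    note sob = sobolev_norm_smooth_le[OF \<Omega> su bd]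
    have eq: "bergman_proj \<Omega> f = bergman_proj \<Omega> u"
      unfolding u_def by (rule bergman_proj_weight[OF wa id f])
    show "bergman_proj \<Omega> f \<in> sobolev k2 \<Omega>" using assms(5) sob(1) by (simp add: eq)
    have "sobolev_norm k2 \<Omega> (bergman_proj \<Omega> f) \<le> C1 * sobolev_norm k1 \<Omega> u" using assms(5) sob(1) by (simp add: eq)
    also have "\<dots> \<le> C1 * (D * (S * L2_norm \<Omega> f))"
      using sob(2) assms(4) by (intro mult_left_mono) (auto simp: D_def)
    also have "\<dots> \<le> (C1 * (D * S) + 1) * L2_norm \<Omega> f"
      using L2_norm_nonneg[of \<Omega> f] by (simp add: algebra_simps)
    finally show "sobolev_norm k2 \<Omega> (bergman_proj \<Omega> f) \<le> (C1 * (D * S) + 1) * L2_norm \<Omega> f" .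
  qed
qed

end
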